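(* Let $(X,\mu)$ and $(Y,\nu)$ be standard $\sigma$-finite measure spaces and let $\varphi:X\times Y\to\mathbb{C}$ be measurable. (i) If $\kappa_\varphi^{w^*}$ is not an operator $M$-set then $\varphi$ is a closable multiplier. (ii) If $\kappa_\varphi^{w^*}$ is an operator $M_1$-set then $\varphi$ is not a closable multiplier.
   Context: Write $H_1=L^2(X,\mu)$, $H_2=L^2(Y,\nu)$; for $k\in L^2(X\times Y,\mu\times\nu)$ let $I_k:H_1\to H_2$ be $(I_k\xi)(y)=\int_X k(x,y)\xi(x)\,d\mu(x)$. Multipliers. For measurable $\varphi:X\times Y\to\mathbb{C}$ let $D(\varphi)=\{k\in L^2(X\times Y):\varphi k\in L^2(X\times Y)\}$ and let $S_\varphi$ be the densely defined operator on the space $\mathcal{K}(H_1,H_2)$ of compact operators (operator norm) with domain $\{I_k:k\in D(\varphi)\}$ given by $S_\varphi(I_k)=I_{\varphi k}$. The function $\varphi$ is a closable multiplier if the norm closure of the graph of $S_\varphi$ is the graph of an operator; it is a w*-closable multiplier if the weak* closure of the graph of $S_\varphi$ in $\mathcal{K}(H_1,H_2)^{**}\oplus\mathcal{K}(H_1,H_2)^{**}=\mathcal{B}(H_1,H_2)\oplus\mathcal{B}(H_1,H_2)$ is the graph of an operator. The same definitions apply on a rectangle $\alpha\times\beta$ with the restricted measures. Pseudo-topology. A rectangle is a set $\alpha\times\beta$ with $\alpha\subseteq X$, $\beta\subseteq Y$ measurable. A set is marginally null if it is contained in $(X_0\times Y)\cup(X\times Y_0)$ with $\mu(X_0)=\nu(Y_0)=0$;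 sets are marginally equivalent if their symmetric difference is marginally null, marginally disjoint if their intersection is marginally null, and $E$ marginally contains $F$ if $F\setminus E$ is marginally null. A set is $\omega$-open if it is marginally equivalent to a countable union of rectangles; complements of $\omega$-open sets are $\omega$-closed. For a family $\mathcal{E}$ of $\omega$-open sets, its $\omega$-union is the (unique up to marginal equivalence) countable union of elements of $\mathcal{E}$ which marginally contains every element of $\mathcal{E}$. The set $\kappa_\varphi^{w^*}$ is the complement of the $\omega$-union of the family of all rectangles $\alpha\times\beta$ such that $\varphi|_{\alpha\times\beta}$ is a w*-closable multiplier on $\alpha\times\beta$. Supports and bimodules. For measurable $\alpha$, $P(\alpha)$ is the operator of multiplication by $\chi_\alpha$. An $\omega$-closed set $\kappa$ supports $T\in\mathcal{B}(H_1,H_2)$ if $P(\beta)TP(\alpha)=0$ whenever $\alpha\times\beta$ is a rectangle marginally disjoint from $\kappa$. The support of a set of operators is the smallest (up to marginal equivalence) $\omega$-closed set supporting all of its elements. A bimodule is a subspace $\mathcal{W}\subseteq\mathcal{B}(H_1,H_2)$ with $M_bTM_a\in\mathcal{W}$ for all $T\in\mathcal{W}$, $a\in L^\infty(X,\mu)$, $b\in L^\infty(Y,\nu)$, where $M_a, M_b$ are multiplication operators. For every $\omega$-closed $\kappa$ there is a smallest weak*-closed bimodule with support $\kappa$, denoted $\mathfrak{M}_{\min}(\kappa)$. An $\omega$-closed set $E$ is an operator $M$-set if it supports a non-zero compact operator, and an operator $M_1$-set if $\mathfrak{M}_{\min}(E)$ contains a non-zero compact operator. *)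

theory Defs
  imports "HOL-Analysis.Analysis"
begin

text \<open>
  Elements of \<open>L\<^sup>2\<close> are represented by square-integrable functions, and operators by maps on such
  functions; equality almost everywhere (resp. \<open>op_eq\<close>) plays the role of equality.  All notions
  below are invariant under it.
\<close>

section \<open>Measure spaces and function spaces\<close>

definition standard_borel_measure :: "'a measure \<Rightarrow> bool" where
  "standard_borel_measure M \<longleftrightarrow>
    (\<exists>T. completely_metrizable_space T \<and> second_countable T \<and> topspace T = space M \<and>
         sets M = sigma_sets (topspace T) {U. openin T U})"

definition L2 :: "'a measure \<Rightarrow> ('a \<Rightarrow> complex) set" where
  "L2 M = {f \<in> borel_measurable M. integrable M (\<lambda>x. (norm (f x))\<^sup>2)}"

definition L2_norm :: "'a measure \<Rightarrow> ('a \<Rightarrow> complex) \<Rightarrow> real" where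
  "L2_norm M f = sqrt (\<integral>x. (norm (f x))\<^sup>2 \<partial>M)"

definition Linfty :: "'a measure \<Rightarrow> ('a \<Rightarrow> complex) set" where
  "Linfty M = {a \<in> borel_measurable M. \<exists>C. AE x in M. norm (a x) \<le> C}"


section \<open>Bounded and compact operators\<close>

type_synonym ('a, 'b) oper = "('a \<Rightarrow> complex) \<Rightarrow> ('b \<Rightarrow> complex)"

text \<open>Linearity and boundedness imply that almost everywhere equal functions have almost everywhere
  equal images.\<close>

definition bounded_ops :: "'a measure \<Rightarrow> 'b measure \<Rightarrow> ('a, 'b) oper set" where
  "bounded_ops M N = {T.
     (\<forall>f\<in>L2 M. T f \<in> L2 N) \<and>
     (\<forall>f\<in>L2 M. \<forall>g\<in>L2 M. AE y in N. T (\<lambda>x. f x + g x) y = T f y + T g y) \<and>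
     (\<forall>c. \<forall>f\<in>L2 M. AE y in N. T (\<lambda>x. c * f x) y = c * T f y) \<and>
     (\<exists>C. \<forall>f\<in>L2 M. L2_norm N (T f) \<le> C * L2_norm M f)}"

definition op_eq :: "'a measure \<Rightarrow> 'b measure \<Rightarrow> ('a, 'b) oper \<Rightarrow> ('a, 'b) oper \<Rightarrow> bool" where
  "op_eq M N S T \<longleftrightarrow> (\<forall>f\<in>L2 M. AE y in N. S f y = T f y)"

definition zero_op :: "('a, 'b) oper" where
  "zero_op = (\<lambda>f y. 0)"

definition op_norm :: "'a measure \<Rightarrow> 'b measure \<Rightarrow> ('a, 'b) oper \<Rightarrow> real" where
  "op_norm M N T = (SUP f\<in>{f \<in> L2 M. L2_norm M f \<le> 1}. L2_norm N (T f))"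

definition compact_ops :: "'a measure \<Rightarrow> 'b measure \<Rightarrow> ('a, 'b) oper set" where
  "compact_ops M N = {T \<in> bounded_ops M N.
     \<forall>f::nat \<Rightarrow> 'a \<Rightarrow> complex. (\<forall>n. f n \<in> L2 M \<and> L2_norm M (f n) \<le> 1) \<longrightarrow>
       (\<exists>r g. strict_mono r \<and> g \<in> L2 N \<and>
          (\<lambda>n. L2_norm N (\<lambda>y. T (f (r n)) y - g y)) \<longlonglongrightarrow> 0)}"

definition mult_op :: "('a \<Rightarrow> complex) \<Rightarrow> ('a, 'a) oper" where
  "mult_op a f = (\<lambda>x. a x * f x)"

abbreviation proj_op :: "'a set \<Rightarrow> ('a, 'a) oper" where
  "proj_op A \<equiv> mult_op (indicator A)"


section \<open>The weak* topology\<close>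

text \<open>
  The dual of the compact operators is the space of trace class operators.  A trace class operator
  \<open>H\<^sub>2 \<rightarrow> H\<^sub>1\<close> is a series of rank one operators, given by sequences \<open>f\<close> in \<open>L\<^sup>2(M)\<close> and \<open>g\<close> in
  \<open>L\<^sup>2(N)\<close> with square-summable norms (the elements \<open>\<Sum>\<^sub>i f\<^sub>i \<otimes> g\<^sub>i\<close> of the projective tensor
  product); the trace pairing with \<open>T\<close> is \<open>\<Sum>\<^sub>i \<langle>T f\<^sub>i, cnj g\<^sub>i\<rangle>\<close>.
\<close>

definition trace_class :: "'a measure \<Rightarrow> 'b measure \<Rightarrow>
    ((nat \<Rightarrow> 'a \<Rightarrow> complex) \<times> (nat \<Rightarrow> 'b \<Rightarrow> complex)) set" where
  "trace_class M N = {(f, g). (\<forall>i. f i \<in> L2 M \<and> g i \<in> L2 N) \<and>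
     summable (\<lambda>i. (L2_norm M (f i))\<^sup>2) \<and> summable (\<lambda>i. (L2_norm N (g i))\<^sup>2)}"

definition trace_pairing :: "'b measure \<Rightarrow> ('a, 'b) oper \<Rightarrow>
    (nat \<Rightarrow> 'a \<Rightarrow> complex) \<times> (nat \<Rightarrow> 'b \<Rightarrow> complex) \<Rightarrow> complex" where
  "trace_pairing N T h = (\<Sum>i. \<integral>y. T (fst h i) y * snd h i y \<partial>N)"

definition weak_star :: "'a measure \<Rightarrow> 'b measure \<Rightarrow> ('a, 'b) oper topology" where
  "weak_star M N = pullback_topology (bounded_ops M N)
     (\<lambda>T. restrict (trace_pairing N T) (trace_class M N))
     (product_topology (\<lambda>_. euclidean) (trace_class M N))"


section \<open>Closable multipliers\<close>

definition int_op :: "'a measure \<Rightarrow> ('a \<times> 'b \<Rightarrow> complex) \<Rightarrow> ('a, 'b) oper" where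
  "int_op M k \<xi> = (\<lambda>y. \<integral>x. k (x, y) * \<xi> x \<partial>M)"

definition mult_dom :: "'a measure \<Rightarrow> 'b measure \<Rightarrow> ('a \<times> 'b \<Rightarrow> complex) \<Rightarrow>
    ('a \<times> 'b \<Rightarrow> complex) set" where
  "mult_dom M N \<phi> = {k \<in> L2 (M \<Otimes>\<^sub>M N). (\<lambda>z. \<phi> z * k z) \<in> L2 (M \<Otimes>\<^sub>M N)}"

definition mult_graph :: "'a measure \<Rightarrow> 'b measure \<Rightarrow> ('a \<times> 'b \<Rightarrow> complex) \<Rightarrow>
    (('a, 'b) oper \<times> ('a, 'b) oper) set" where
  "mult_graph M N \<phi> = (\<lambda>k. (int_op M k, int_op M (\<lambda>z. \<phi> z * k z))) ` mult_dom M N \<phi>"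

text \<open>A linear subspace of a direct sum is the graph of an operator iff it is single-valued.\<close>

definition is_op_graph :: "'a measure \<Rightarrow> 'b measure \<Rightarrow> (('a, 'b) oper \<times> ('a, 'b) oper) set \<Rightarrow> bool"
  where
  "is_op_graph M N G \<longleftrightarrow>
    (\<forall>A B A' B'. (A, B) \<in> G \<longrightarrow> (A', B') \<in> G \<longrightarrow> op_eq M N A A' \<longrightarrow> op_eq M N B B')"

definition norm_closure :: "'a measure \<Rightarrow> 'b measure \<Rightarrow> (('a, 'b) oper \<times> ('a, 'b) oper) set \<Rightarrow>
    (('a, 'b) oper \<times> ('a, 'b) oper) set" where
  "norm_closure M N G = {(A, B). A \<in> compact_ops M N \<and> B \<in> compact_ops M N \<and>
     (\<forall>\<epsilon>>0. \<exists>(S, T)\<in>G. op_norm M N (\<lambda>f y. A f y - S f y) < \<epsilon> \<and>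
                      op_norm M N (\<lambda>f y. B f y - T f y) < \<epsilon>)}"

definition closable_multiplier :: "'a measure \<Rightarrow> 'b measure \<Rightarrow> ('a \<times> 'b \<Rightarrow> complex) \<Rightarrow> bool" where
  "closable_multiplier M N \<phi> \<longleftrightarrow> is_op_graph M N (norm_closure M N (mult_graph M N \<phi>))"

definition wstar_closable_multiplier ::
    "'a measure \<Rightarrow> 'b measure \<Rightarrow> ('a \<times> 'b \<Rightarrow> complex) \<Rightarrow> bool" where
  "wstar_closable_multiplier M N \<phi> \<longleftrightarrow>
    is_op_graph M N (prod_topology (weak_star M N) (weak_star M N) closure_of mult_graph M N \<phi>)"


section \<open>The pseudo-topology\<close>

definition rectangles :: "'a measure \<Rightarrow> 'b measure \<Rightarrow> ('a \<times> 'b) set set" where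
  "rectangles M N = {\<alpha> \<times> \<beta> | \<alpha> \<beta>. \<alpha> \<in> sets M \<and> \<beta> \<in> sets N}"

definition marg_null :: "'a measure \<Rightarrow> 'b measure \<Rightarrow> ('a \<times> 'b) set \<Rightarrow> bool" where
  "marg_null M N E \<longleftrightarrow> (\<exists>X\<^sub>0\<in>null_sets M. \<exists>Y\<^sub>0\<in>null_sets N. E \<subseteq> X\<^sub>0 \<times> space N \<union> space M \<times> Y\<^sub>0)"

definition marg_equiv :: "'a measure \<Rightarrow> 'b measure \<Rightarrow> ('a \<times> 'b) set \<Rightarrow> ('a \<times> 'b) set \<Rightarrow> bool" where
  "marg_equiv M N E F \<longleftrightarrow> marg_null M N ((E - F) \<union> (F - E))"

definition marg_disjoint :: "'a measure \<Rightarrow> 'b measure \<Rightarrow> ('a \<times> 'b) set \<Rightarrow> ('a \<times> 'b) set \<Rightarrow> bool"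
  where
  "marg_disjoint M N E F \<longleftrightarrow> marg_null M N (E \<inter> F)"

definition marg_contains :: "'a measure \<Rightarrow> 'b measure \<Rightarrow> ('a \<times> 'b) set \<Rightarrow> ('a \<times> 'b) set \<Rightarrow> bool"
  where
  "marg_contains M N E F \<longleftrightarrow> marg_null M N (F - E)"

definition omega_open :: "'a measure \<Rightarrow> 'b measure \<Rightarrow> ('a \<times> 'b) set \<Rightarrow> bool" where
  "omega_open M N E \<longleftrightarrow> E \<subseteq> space M \<times> space N \<and>
    (\<exists>\<C>. countable \<C> \<and> \<C> \<subseteq> rectangles M N \<and> marg_equiv M N E (\<Union>\<C>))"

definition omega_closed :: "'a measure \<Rightarrow> 'b measure \<Rightarrow> ('a \<times> 'b) set \<Rightarrow> bool" where
  "omega_closed M N E \<longleftrightarrow> E \<subseteq> space M \<times> space N \<and> omega_open M N (space M \<times> space N - E)"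

definition is_omega_union ::
    "'a measure \<Rightarrow> 'b measure \<Rightarrow> ('a \<times> 'b) set set \<Rightarrow> ('a \<times> 'b) set \<Rightarrow> bool" where
  "is_omega_union M N \<E> U \<longleftrightarrow>
    (\<exists>\<C>. countable \<C> \<and> \<C> \<subseteq> \<E> \<and> U = \<Union>\<C>) \<and> (\<forall>E\<in>\<E>. marg_contains M N U E)"

text \<open>The choice is unique up to marginal equivalence only.\<close>

definition omega_union :: "'a measure \<Rightarrow> 'b measure \<Rightarrow> ('a \<times> 'b) set set \<Rightarrow> ('a \<times> 'b) set" where
  "omega_union M N \<E> = (SOME U. is_omega_union M N \<E> U)"

lemma is_omega_union_unique:
  assumes "is_omega_union M N \<E> U" "is_omega_union M N \<E> V"
  shows "marg_equiv M N U V"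
proof -
  have null_Union: "marg_null M N (\<Union>\<D>)"
    if cnt: "countable \<D>" and nul: "\<And>D. D \<in> \<D> \<Longrightarrow> marg_null M N D" for \<D>
  proof -
    obtain A B where AB: "\<And>D. D \<in> \<D> \<Longrightarrow> A D \<in> null_sets M \<and> B D \<in> null_sets N \<and>
        D \<subseteq> A D \<times> space N \<union> space M \<times> B D"
      using nul unfolding marg_null_def by metis
    have "(\<Union>D\<in>\<D>. A D) \<in> null_sets M" "(\<Union>D\<in>\<D>. B D) \<in> null_sets N"
      using AB cnt by (auto intro!: null_sets_UN')
    moreover have "\<Union>\<D> \<subseteq> (\<Union>D\<in>\<D>. A D) \<times> space N \<union> space M \<times> (\<Union>D\<in>\<D>. B D)"
    proof
      fix z assume "z \<in> \<Union>\<D>"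
      then obtain D where "D \<in> \<D>" "z \<in> D" by auto
      with AB[of D] show "z \<in> (\<Union>D\<in>\<D>. A D) \<times> space N \<union> space M \<times> (\<Union>D\<in>\<D>. B D)"
        by blast
    qed
    ultimately show ?thesis
      unfolding marg_null_def by blast
  qed
  have diff: "marg_null M N (V' - U')"
    if U': "is_omega_union M N \<E> U'" and V': "is_omega_union M N \<E> V'" for U' V'
  proof -
    obtain \<C> where \<C>: "countable \<C>" "\<C> \<subseteq> \<E>" "V' = \<Union>\<C>"
      using V' unfolding is_omega_union_def by blast
    have "marg_null M N (\<Union>((\<lambda>C. C - U') ` \<C>))"
      using \<C> U' by (intro null_Union) (auto simp: is_omega_union_def marg_contains_def)
    moreover have "V' - U' = \<Union>((\<lambda>C. C - U') ` \<C>)"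
      using \<C>(3) by auto
    ultimately show ?thesis by simp
  qed
  have "marg_null M N (\<Union>{U - V, V - U})"
    by (rule null_Union) (use diff assms in auto)
  then show ?thesis
    by (simp add: marg_equiv_def)
qed

definition kappa_wstar :: "'a measure \<Rightarrow> 'b measure \<Rightarrow> ('a \<times> 'b \<Rightarrow> complex) \<Rightarrow> ('a \<times> 'b) set" where
  "kappa_wstar M N \<phi> = space M \<times> space N -
     omega_union M N {\<alpha> \<times> \<beta> | \<alpha> \<beta>. \<alpha> \<in> sets M \<and> \<beta> \<in> sets N \<and>
       wstar_closable_multiplier (restrict_space M \<alpha>) (restrict_space N \<beta>) \<phi>}"


section \<open>Supports, bimodules and operator M-sets\<close>

definition supports_op :: "'a measure \<Rightarrow> 'b measure \<Rightarrow> ('a \<times> 'b) set \<Rightarrow> ('a, 'b) oper \<Rightarrow> bool" where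
  "supports_op M N \<kappa> T \<longleftrightarrow> (\<forall>\<alpha>\<in>sets M. \<forall>\<beta>\<in>sets N. marg_disjoint M N (\<alpha> \<times> \<beta>) \<kappa> \<longrightarrow>
     op_eq M N (proj_op \<beta> \<circ> T \<circ> proj_op \<alpha>) zero_op)"

definition is_support ::
    "'a measure \<Rightarrow> 'b measure \<Rightarrow> ('a, 'b) oper set \<Rightarrow> ('a \<times> 'b) set \<Rightarrow> bool" where
  "is_support M N \<W> \<kappa> \<longleftrightarrow> omega_closed M N \<kappa> \<and> (\<forall>T\<in>\<W>. supports_op M N \<kappa> T) \<and>
     (\<forall>\<kappa>'. omega_closed M N \<kappa>' \<and> (\<forall>T\<in>\<W>. supports_op M N \<kappa>' T) \<longrightarrow> marg_contains M N \<kappa>' \<kappa>)"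

text \<open>The second clause says that \<open>\<W>\<close> is a set of operators, i.e. of classes modulo \<open>op_eq\<close>.\<close>

definition bimodule :: "'a measure \<Rightarrow> 'b measure \<Rightarrow> ('a, 'b) oper set \<Rightarrow> bool" where
  "bimodule M N \<W> \<longleftrightarrow> \<W> \<subseteq> bounded_ops M N \<and>
     (\<forall>T\<in>\<W>. \<forall>S\<in>bounded_ops M N. op_eq M N S T \<longrightarrow> S \<in> \<W>) \<and>
     zero_op \<in> \<W> \<and>
     (\<forall>S\<in>\<W>. \<forall>T\<in>\<W>. (\<lambda>f y. S f y + T f y) \<in> \<W>) \<and>
     (\<forall>c. \<forall>T\<in>\<W>. (\<lambda>f y. c * T f y) \<in> \<W>) \<and>
     (\<forall>T\<in>\<W>. \<forall>a\<in>Linfty M. \<forall>b\<in>Linfty N. mult_op b \<circ> T \<circ> mult_op a \<in> \<W>)"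

definition wstar_closed_bimodules_on ::
    "'a measure \<Rightarrow> 'b measure \<Rightarrow> ('a \<times> 'b) set \<Rightarrow> ('a, 'b) oper set set" where
  "wstar_closed_bimodules_on M N \<kappa> =
     {\<W>. bimodule M N \<W> \<and> closedin (weak_star M N) \<W> \<and> is_support M N \<W> \<kappa>}"

text \<open>The smallest member of a family of sets is its intersection (lemma \<open>M_min_eqI\<close>).\<close>

definition M_min :: "'a measure \<Rightarrow> 'b measure \<Rightarrow> ('a \<times> 'b) set \<Rightarrow> ('a, 'b) oper set" where
  "M_min M N \<kappa> = \<Inter>(wstar_closed_bimodules_on M N \<kappa>)"

lemma M_min_eqI:
  assumes "\<W> \<in> wstar_closed_bimodules_on M N \<kappa>"
    and "\<And>\<V>. \<V> \<in> wstar_closed_bimodules_on M N \<kappa> \<Longrightarrow> \<W> \<subseteq> \<V>"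
  shows "M_min M N \<kappa> = \<W>"
  unfolding M_min_def using assms by blast

definition operator_M_set :: "'a measure \<Rightarrow> 'b measure \<Rightarrow> ('a \<times> 'b) set \<Rightarrow> bool" where
  "operator_M_set M N E \<longleftrightarrow> omega_closed M N E \<and>
     (\<exists>T\<in>compact_ops M N. \<not> op_eq M N T zero_op \<and> supports_op M N E T)"

definition operator_M1_set :: "'a measure \<Rightarrow> 'b measure \<Rightarrow> ('a \<times> 'b) set \<Rightarrow> bool" where
  "operator_M1_set M N E \<longleftrightarrow> omega_closed M N E \<and>
     (\<exists>T\<in>compact_ops M N. \<not> op_eq M N T zero_op \<and> T \<in> M_min M N E)"

end

theory Submission
  imports Defs "HOL-Library.Diagonal_Subsequence"
begin

text \<open>
  Write \<open>G\<close> for the graph of \<open>S\<^sub>\<phi>\<close>, \<open>W\<close> for the set of all bounded \<open>B\<close> with \<open>(0, B)\<close> in the weak* closure of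
  \<open>G\<close>, and \<open>V\<close> for the set of all compact \<open>B\<close> with \<open>(0, B)\<close> in the norm closure of \<open>G\<close>.  As \<open>G\<close> is linear,
  \<open>\<phi>\<close> is a w*-closable multiplier iff \<open>W = 0\<close>, and a closable one iff \<open>V = 0\<close>.  Both parts of the
  theorem compare these two spaces.

  The space \<open>W\<close> is a weak*-closed bimodule, because \<open>G\<close> is invariant under multiplication of kernels by
  \<open>a(x) b(y)\<close>.  Its support is \<open>\<kappa>\<close>, the complement of the \<open>\<omega>\<close>-union of the rectangles on which \<open>\<phi>\<close> is
  w*-closable (\<open>kappa_wstar_support\<close>).  Indeed, restricting kernels to a rectangle and extending them by
  zero shows that \<open>\<phi>\<close> is w*-closable on \<open>\<alpha> \<times> \<beta>\<close> iff \<open>P(\<beta>) B P(\<alpha>) = 0\<close> for all \<open>B \<in> W\<close>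
  (\<open>wstar_closable_on_rectangle_iff\<close>), and an operator that vanishes on countably many rectangles
  vanishes on every rectangle that they cover (\<open>vanishes_on_marginal_cover\<close>).  The latter is where the
  measure spaces have to be standard: up to a small set the rectangle is compact, and the cover
  is relatively open, so finitely many of the rectangles suffice.

  The space \<open>V\<close> consists of the compact operators in \<open>W\<close>.  One inclusion is clear, and the
  other one (\<open>compact_wstar_multivalued_part\<close>) expresses that the compact operators have the trace class
  operators as their dual: if \<open>(0, B)\<close> is not in the norm closure of \<open>G\<close>, a pair of trace class
  operators annihilates \<open>G\<close> but not \<open>(0, B)\<close>, so \<open>(0, B)\<close> is not in the weak* closure either.  The
  elements of \<open>G\<close> are pairs of Hilbert--Schmidt operators, so the separation can take place in the
  Hilbert space \<open>L\<^sup>2 \<oplus> L\<^sup>2\<close>, where a nearest point argument gives it (\<open>L2_pair_separation\<close>).  The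
  separating kernel defines a functional that is bounded in the operator norm, and the singular value
  decomposition turns it into a trace class operator (\<open>trace_class_representation\<close>).

  Now (i) if \<open>\<phi>\<close> is not closable, a nonzero element of \<open>V\<close> is a nonzero compact operator in \<open>W\<close>, hence
  supported by \<open>\<kappa>\<close>.  (ii) As \<open>W\<close> is one of the bimodules over which the smallest one is formed, a
  nonzero compact operator in the smallest bimodule with support \<open>\<kappa>\<close> belongs to \<open>W\<close>, hence to \<open>V\<close>.
\<close>

section \<open>The space of square-integrable functions\<close>


definition L2_inner :: "'a measure \<Rightarrow> ('a \<Rightarrow> complex) \<Rightarrow> ('a \<Rightarrow> complex) \<Rightarrow> complex" where
  "L2_inner M f g = (\<integral>x. f x * cnj (g x) \<partial>M)"

lemma L2_measurable [measurable_dest]: "f \<in> L2 M \<Longrightarrow> f \<in> borel_measurable M"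
  by (simp add: L2_def)

lemma L2_integrable: "f \<in> L2 M \<Longrightarrow> integrable M (\<lambda>x. (norm (f x))\<^sup>2)"
  by (simp add: L2_def)

lemma L2_I: "f \<in> borel_measurable M \<Longrightarrow> integrable M (\<lambda>x. (norm (f x))\<^sup>2) \<Longrightarrow> f \<in> L2 M"
  by (simp add: L2_def)

lemma L2_dominated:
  assumes "f \<in> borel_measurable M" "g \<in> L2 M" "AE x in M. norm (f x) \<le> C * norm (g x)"
  shows "f \<in> L2 M"
proof (rule L2_I[OF assms(1)])
  have i: "integrable M (\<lambda>x. C\<^sup>2 * (norm (g x))\<^sup>2)"
    using L2_integrable[OF assms(2)] by simp
  have "AE x in M. norm ((norm (f x))\<^sup>2) \<le> norm (C\<^sup>2 * (norm (g x))\<^sup>2)"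
    using assms(3)
  proof eventually_elim
    case (elim x)
    have "(norm (f x))\<^sup>2 \<le> (C * norm (g x))\<^sup>2" by (rule power_mono[OF elim]) simp
    then show ?case by (simp add: power_mult_distrib)
  qed
  then show "integrable M (\<lambda>x. (norm (f x))\<^sup>2)"
    using assms(1) by (intro Bochner_Integration.integrable_bound[OF i]) auto
qed

lemma L2_zero [simp, intro]: "(\<lambda>x. 0) \<in> L2 M"
  by (simp add: L2_def)

lemma L2_cmult [intro]: "f \<in> L2 M \<Longrightarrow> (\<lambda>x. c * f x) \<in> L2 M"
  by (rule L2_dominated[where g=f and C="norm c"]) (auto simp: norm_mult dest: L2_measurable)

lemma L2_add [intro]:
  assumes "f \<in> L2 M" "g \<in> L2 M" shows "(\<lambda>x. f x + g x) \<in> L2 M"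
proof (rule L2_I)
  have [measurable]: "f \<in> borel_measurable M" "g \<in> borel_measurable M" using assms by (auto dest: L2_measurable)
  show "(\<lambda>x. f x + g x) \<in> borel_measurable M" by measurable
  have i: "integrable M (\<lambda>x. 2 * (norm (f x))\<^sup>2 + 2 * (norm (g x))\<^sup>2)"
    using assms by (simp add: L2_integrable)
  show "integrable M (\<lambda>x. (norm (f x + g x))\<^sup>2)"
  proof (rule Bochner_Integration.integrable_bound[OF i])
    show "AE x in M. norm ((norm (f x + g x))\<^sup>2) \<le> norm (2 * (norm (f x))\<^sup>2 + 2 * (norm (g x))\<^sup>2)"
    proof (rule AE_I2)
      fix x
      have "(norm (f x + g x))\<^sup>2 \<le> (norm (f x) + norm (g x))\<^sup>2"
        by (intro power_mono norm_triangle_ineq) simp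
      also have "\<dots> \<le> 2 * (norm (f x))\<^sup>2 + 2 * (norm (g x))\<^sup>2"
        using sum_squares_bound[of "norm (f x)" "norm (g x)"] by (simp add: power2_eq_square algebra_simps)
      finally show "norm ((norm (f x + g x))\<^sup>2) \<le> norm (2 * (norm (f x))\<^sup>2 + 2 * (norm (g x))\<^sup>2)" by simp
    qed
  qed measurable
qed

lemma L2_diff [intro]: "f \<in> L2 M \<Longrightarrow> g \<in> L2 M \<Longrightarrow> (\<lambda>x. f x - g x) \<in> L2 M"
  using L2_add[of f M "\<lambda>x. -1 * g x"] L2_cmult[of g M "-1"] by simp

lemma borel_measurable_cnj [measurable]: "cnj \<in> borel_measurable borel"
  by (intro borel_measurable_continuous_onI continuous_on_cnj continuous_on_id)

lemma L2_cnj [intro]: "f \<in> L2 M \<Longrightarrow> (\<lambda>x. cnj (f x)) \<in> L2 M"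
  by (rule L2_dominated[where g=f and C=1])
    (auto intro: measurable_compose[OF _ borel_measurable_cnj] L2_measurable)

lemma L2_sum [intro]: "(\<And>i. i \<in> I \<Longrightarrow> f i \<in> L2 M) \<Longrightarrow> (\<lambda>x. \<Sum>i\<in>I. f i x) \<in> L2 M"
  by (induction I rule: infinite_finite_induct) auto

lemma L2_mult_integrable:
  assumes "f \<in> L2 M" "g \<in> L2 M" shows "integrable M (\<lambda>x. f x * g x)"
proof -
  have [measurable]: "f \<in> borel_measurable M" "g \<in> borel_measurable M" using assms by (auto dest: L2_measurable)
  have i: "integrable M (\<lambda>x. (norm (f x))\<^sup>2 + (norm (g x))\<^sup>2)"
    using assms by (simp add: L2_integrable)
  show ?thesis
  proof (rule Bochner_Integration.integrable_bound[OF i])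
    show "AE x in M. norm (f x * g x) \<le> norm ((norm (f x))\<^sup>2 + (norm (g x))\<^sup>2)"
    proof (rule AE_I2)
      fix x
      have "2 * (norm (f x) * norm (g x)) \<le> (norm (f x))\<^sup>2 + (norm (g x))\<^sup>2"
        using sum_squares_bound[of "norm (f x)" "norm (g x)"] by simp
      then have "norm (f x) * norm (g x) \<le> (norm (f x))\<^sup>2 + (norm (g x))\<^sup>2"
        using mult_nonneg_nonneg[OF norm_ge_zero norm_ge_zero, of "f x" "g x"] by linarith
      then show "norm (f x * g x) \<le> norm ((norm (f x))\<^sup>2 + (norm (g x))\<^sup>2)" by (simp add: norm_mult)
    qed
  qed measurable
qed

lemma L2_norm_nonneg [simp]: "0 \<le> L2_norm M f"
  by (simp add: L2_norm_def)

lemma L2_norm_power2: "(L2_norm M f)\<^sup>2 = (\<integral>x. (norm (f x))\<^sup>2 \<partial>M)"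
  by (simp add: L2_norm_def)

lemma L2_norm_zero [simp]: "L2_norm M (\<lambda>x. 0) = 0"
  by (simp add: L2_norm_def)

lemma L2_norm_cong_AE:
  assumes "f \<in> borel_measurable M" "g \<in> borel_measurable M" "AE x in M. f x = g x"
  shows "L2_norm M f = L2_norm M g"
proof -
  have "(\<integral>x. (norm (f x))\<^sup>2 \<partial>M) = (\<integral>x. (norm (g x))\<^sup>2 \<partial>M)"
    using assms by (intro integral_cong_AE) auto
  then show ?thesis by (simp add: L2_norm_def)
qed

lemma L2_norm_eq_0_iff: "f \<in> L2 M \<Longrightarrow> L2_norm M f = 0 \<longleftrightarrow> (AE x in M. f x = 0)"
  using integral_nonneg_eq_0_iff_AE[of M "\<lambda>x. (norm (f x))\<^sup>2"] L2_integrable[of f M]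
  by (simp add: L2_norm_def)

lemma L2_norm_eq_0D: "f \<in> L2 M \<Longrightarrow> L2_norm M f = 0 \<Longrightarrow> AE x in M. f x = 0"
  using L2_norm_eq_0_iff by blast

lemma L2_norm_cmult: "L2_norm M (\<lambda>x. c * f x) = norm c * L2_norm M f"
  by (simp add: L2_norm_def norm_mult power_mult_distrib real_sqrt_mult)

lemma L2_norm_cnj [simp]: "L2_norm M (\<lambda>x. cnj (f x)) = L2_norm M f"
  by (simp add: L2_norm_def)

lemma L2_norm_minus_commute: "L2_norm M (\<lambda>x. f x - g x) = L2_norm M (\<lambda>x. g x - f x)"
  by (simp add: L2_norm_def norm_minus_commute)

lemma L2_norm_mono:
  assumes "f \<in> borel_measurable M" "g \<in> L2 M" "AE x in M. norm (f x) \<le> norm (g x)"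
  shows "L2_norm M f \<le> L2_norm M g"
proof -
  have f: "f \<in> L2 M" by (rule L2_dominated[OF assms(1,2), of 1]) (use assms(3) in simp)
  have "AE x in M. (norm (f x))\<^sup>2 \<le> (norm (g x))\<^sup>2"
    using assms(3) by eventually_elim (simp add: power_mono)
  then have "(\<integral>x. (norm (f x))\<^sup>2 \<partial>M) \<le> (\<integral>x. (norm (g x))\<^sup>2 \<partial>M)"
    using f assms(2) by (intro integral_mono_AE L2_integrable)
  then show ?thesis by (simp add: L2_norm_def)
qed

lemma L2_inner_self: "L2_inner M f f = of_real ((L2_norm M f)\<^sup>2)"
proof -
  have "(\<lambda>x. f x * cnj (f x)) = (\<lambda>x. complex_of_real ((norm (f x))\<^sup>2))"
    by (rule ext) (simp only: complex_norm_square)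
  then show ?thesis unfolding L2_inner_def L2_norm_power2 by (simp del: of_real_power)
qed

lemma L2_inner_integrable: "f \<in> L2 M \<Longrightarrow> g \<in> L2 M \<Longrightarrow> integrable M (\<lambda>x. f x * cnj (g x))"
  using L2_mult_integrable[OF _ L2_cnj] .

lemma L2_inner_commute: "L2_inner M g f = cnj (L2_inner M f g)"
  unfolding L2_inner_def by (subst Bochner_Integration.integral_cnj[symmetric]) (simp add: mult.commute)

lemma L2_inner_add_left: "f \<in> L2 M \<Longrightarrow> g \<in> L2 M \<Longrightarrow> h \<in> L2 M \<Longrightarrow>
    L2_inner M (\<lambda>x. f x + g x) h = L2_inner M f h + L2_inner M g h"
  unfolding L2_inner_def by (simp add: distrib_right L2_inner_integrable)

lemma L2_inner_diff_left: "f \<in> L2 M \<Longrightarrow> g \<in> L2 M \<Longrightarrow> h \<in> L2 M \<Longrightarrow>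
    L2_inner M (\<lambda>x. f x - g x) h = L2_inner M f h - L2_inner M g h"
  unfolding L2_inner_def by (simp add: left_diff_distrib L2_inner_integrable)

lemma L2_inner_cmult_left: "L2_inner M (\<lambda>x. c * f x) h = c * L2_inner M f h"
  unfolding L2_inner_def by (simp add: mult.assoc)

lemma L2_inner_cmult_right: "L2_inner M h (\<lambda>x. c * f x) = cnj c * L2_inner M h f"
  by (subst (1 2) L2_inner_commute) (simp add: L2_inner_cmult_left)

lemma L2_inner_add_right: "f \<in> L2 M \<Longrightarrow> g \<in> L2 M \<Longrightarrow> h \<in> L2 M \<Longrightarrow>
    L2_inner M h (\<lambda>x. f x + g x) = L2_inner M h f + L2_inner M h g"
  by (subst (1 2 3) L2_inner_commute) (simp add: L2_inner_add_left)

lemma L2_inner_diff_right: "f \<in> L2 M \<Longrightarrow> g \<in> L2 M \<Longrightarrow> h \<in> L2 M \<Longrightarrow>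
    L2_inner M h (\<lambda>x. f x - g x) = L2_inner M h f - L2_inner M h g"
  by (subst (1 2 3) L2_inner_commute) (simp add: L2_inner_diff_left)

lemma L2_inner_sum_left: "(\<And>i. i \<in> I \<Longrightarrow> f i \<in> L2 M) \<Longrightarrow> h \<in> L2 M \<Longrightarrow>
    L2_inner M (\<lambda>x. \<Sum>i\<in>I. f i x) h = (\<Sum>i\<in>I. L2_inner M (f i) h)"
proof (induction I rule: infinite_finite_induct)
  case (insert i I)
  then show ?case using L2_sum[of I f M] by (simp add: L2_inner_add_left)
qed (simp_all add: L2_inner_def)

lemma L2_inner_sum_right: "(\<And>i. i \<in> I \<Longrightarrow> f i \<in> L2 M) \<Longrightarrow> h \<in> L2 M \<Longrightarrow>
    L2_inner M h (\<lambda>x. \<Sum>i\<in>I. f i x) = (\<Sum>i\<in>I. L2_inner M h (f i))"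
  by (subst (1 2) L2_inner_commute) (simp add: L2_inner_sum_left)

lemma L2_inner_cong_AE:
  assumes "f \<in> L2 M" "f' \<in> L2 M" "g \<in> L2 M" "g' \<in> L2 M" "AE x in M. f x = f' x" "AE x in M. g x = g' x"
  shows "L2_inner M f g = L2_inner M f' g'"
  unfolding L2_inner_def
proof (rule integral_cong_AE)
  show "AE x in M. f x * cnj (g x) = f' x * cnj (g' x)"
    using assms(5,6) by eventually_elim simp
qed (simp_all add: borel_measurable_integrable L2_inner_integrable assms)

lemma L2_norm_add_power2:
  assumes "f \<in> L2 M" "g \<in> L2 M"
  shows "(L2_norm M (\<lambda>x. f x + g x))\<^sup>2 = (L2_norm M f)\<^sup>2 + 2 * Re (L2_inner M f g) + (L2_norm M g)\<^sup>2"
proof -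
  let ?h = "\<lambda>x. f x + g x"
  have h: "?h \<in> L2 M" using assms by blast
  have "complex_of_real ((L2_norm M ?h)\<^sup>2) = L2_inner M ?h ?h" by (simp only: L2_inner_self)
  also have "\<dots> = L2_inner M f f + L2_inner M f g + (L2_inner M g f + L2_inner M g g)"
    by (simp only: L2_inner_add_left[OF assms h] L2_inner_add_right[OF assms(1,2)] assms)
  also have "\<dots> = of_real ((L2_norm M f)\<^sup>2 + 2 * Re (L2_inner M f g) + (L2_norm M g)\<^sup>2)"
    unfolding L2_inner_self L2_inner_commute[of M g f] by (simp add: complex_eq_iff)
  finally show ?thesis by (simp only: of_real_eq_iff)
qed

lemma L2_cauchy_schwarz_mult:
  assumes "f \<in> L2 M" "g \<in> L2 M"
  shows "norm (\<integral>x. f x * g x \<partial>M) \<le> L2_norm M f * L2_norm M g"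
proof -
  have [measurable]: "f \<in> borel_measurable M" "g \<in> borel_measurable M" using assms by (auto dest: L2_measurable)
  have sq: "(\<integral>\<^sup>+ x. (ennreal (norm (u x)))\<^sup>2 \<partial>M) = ennreal ((L2_norm M u)\<^sup>2)" if "u \<in> L2 M" for u
    unfolding L2_norm_power2 using L2_integrable[OF that]
    by (subst nn_integral_eq_integral[symmetric]) (auto simp: ennreal_power)
  have "norm (\<integral>x. f x * g x \<partial>M) \<le> (\<integral>x. norm (f x * g x) \<partial>M)" by (rule integral_norm_bound)
  moreover have "(\<integral>x. norm (f x * g x) \<partial>M)\<^sup>2 \<le> (L2_norm M f * L2_norm M g)\<^sup>2"
  proof -
    have "ennreal (\<integral>x. norm (f x * g x) \<partial>M) = (\<integral>\<^sup>+ x. ennreal (norm (f x)) * ennreal (norm (g x)) \<partial>M)"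
      using integrable_norm[OF L2_mult_integrable[OF assms]]
      by (subst nn_integral_eq_integral[symmetric]) (auto simp: norm_mult ennreal_mult)
    then have "(ennreal (\<integral>x. norm (f x * g x) \<partial>M))\<^sup>2 \<le> ennreal ((L2_norm M f)\<^sup>2) * ennreal ((L2_norm M g)\<^sup>2)"
      using Cauchy_Schwarz_nn_integral[of "\<lambda>x. ennreal (norm (f x))" M "\<lambda>x. ennreal (norm (g x))"]
      unfolding sq[OF assms(1)] sq[OF assms(2)] by simp
    then have "ennreal ((\<integral>x. norm (f x * g x) \<partial>M)\<^sup>2) \<le> ennreal ((L2_norm M f)\<^sup>2 * (L2_norm M g)\<^sup>2)"
      by (simp add: ennreal_power ennreal_mult)
    then show ?thesis by (simp add: power_mult_distrib)
  qed
  ultimately show ?thesis by (meson L2_norm_nonneg mult_nonneg_nonneg order_trans power2_le_imp_le)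
qed

lemma L2_cauchy_schwarz:
  "f \<in> L2 M \<Longrightarrow> g \<in> L2 M \<Longrightarrow> norm (L2_inner M f g) \<le> L2_norm M f * L2_norm M g"
  using L2_cauchy_schwarz_mult[OF _ L2_cnj, of f M g] by (simp add: L2_inner_def)

lemma L2_norm_triangle:
  assumes "f \<in> L2 M" "g \<in> L2 M"
  shows "L2_norm M (\<lambda>x. f x + g x) \<le> L2_norm M f + L2_norm M g"
proof (rule power2_le_imp_le)
  have "Re (L2_inner M f g) \<le> L2_norm M f * L2_norm M g"
    using L2_cauchy_schwarz[OF assms] complex_Re_le_cmod order_trans by blast
  then show "(L2_norm M (\<lambda>x. f x + g x))\<^sup>2 \<le> (L2_norm M f + L2_norm M g)\<^sup>2"
    unfolding L2_norm_add_power2[OF assms] by (simp add: power2_sum)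
qed simp

lemma L2_norm_triangle_diff:
  assumes "f \<in> L2 M" "g \<in> L2 M"
  shows "L2_norm M (\<lambda>x. f x - g x) \<le> L2_norm M f + L2_norm M g"
  using L2_norm_triangle[OF assms(1) L2_cmult[OF assms(2), of "-1"]] L2_norm_cmult[of M "-1" g] by simp

lemma L2_norm_triangle_mid:
  assumes "f \<in> L2 M" "g \<in> L2 M" "h \<in> L2 M"
  shows "L2_norm M (\<lambda>x. f x - h x) \<le> L2_norm M (\<lambda>x. f x - g x) + L2_norm M (\<lambda>x. g x - h x)"
  using L2_norm_triangle[OF L2_diff[OF assms(1,2)] L2_diff[OF assms(2,3)]] by simp

lemma L2_norm_triangle_rev:
  assumes "f \<in> L2 M" "g \<in> L2 M"
  shows "\<bar>L2_norm M f - L2_norm M g\<bar> \<le> L2_norm M (\<lambda>x. f x - g x)"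
  using L2_norm_triangle[OF L2_diff[OF assms] assms(2)]
    L2_norm_triangle[OF L2_diff[OF assms(2,1)] assms(1)] L2_norm_minus_commute[of M f g] by simp

lemma L2_norm_sum:
  assumes "\<And>i. i \<in> I \<Longrightarrow> f i \<in> L2 M"
  shows "L2_norm M (\<lambda>x. \<Sum>i\<in>I. f i x) \<le> (\<Sum>i\<in>I. L2_norm M (f i))"
  using assms
proof (induction I rule: infinite_finite_induct)
  case (insert i I)
  have "L2_norm M (\<lambda>x. f i x + (\<Sum>i\<in>I. f i x)) \<le> L2_norm M (f i) + L2_norm M (\<lambda>x. \<Sum>i\<in>I. f i x)"
    using insert by (intro L2_norm_triangle) auto
  then show ?case using insert.IH insert.prems insert.hyps by simp
qed simp_all

lemma L2_norm_tendsto: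
  assumes "\<And>n. f n \<in> L2 M" "g \<in> L2 M" "(\<lambda>n. L2_norm M (\<lambda>x. f n x - g x)) \<longlonglongrightarrow> 0"
  shows "(\<lambda>n. L2_norm M (f n)) \<longlonglongrightarrow> L2_norm M g"
  using L2_norm_triangle_rev[OF assms(1,2)]
  by (intro LIM_zero_cancel[OF Lim_null_comparison[OF _ assms(3)]]) auto

lemma L2_inner_tendsto:
  assumes "\<And>n. f n \<in> L2 M" "g \<in> L2 M" "h \<in> L2 M" "(\<lambda>n. L2_norm M (\<lambda>x. f n x - g x)) \<longlonglongrightarrow> 0"
  shows "(\<lambda>n. L2_inner M (f n) h) \<longlonglongrightarrow> L2_inner M g h"
proof (rule LIM_zero_cancel[OF Lim_null_comparison])
  show "\<forall>\<^sub>F n in sequentially. norm (L2_inner M (f n) h - L2_inner M g h) \<le> L2_norm M (\<lambda>x. f n x - g x) * L2_norm M h"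
    using L2_cauchy_schwarz[OF L2_diff[OF assms(1,2)] assms(3)] L2_inner_diff_left[OF assms(1-3)] by simp
  show "(\<lambda>n. L2_norm M (\<lambda>x. f n x - g x) * L2_norm M h) \<longlonglongrightarrow> 0"
    using tendsto_mult_left_zero[OF assms(4)] .
qed

lemma L2_parallelogram:
  assumes "f \<in> L2 M" "g \<in> L2 M"
  shows "(L2_norm M (\<lambda>x. f x + g x))\<^sup>2 + (L2_norm M (\<lambda>x. f x - g x))\<^sup>2 = 2 * (L2_norm M f)\<^sup>2 + 2 * (L2_norm M g)\<^sup>2"
  using L2_norm_add_power2[OF assms] L2_norm_add_power2[OF assms(1) L2_cmult[OF assms(2), of "-1"]]
  by (simp only: L2_norm_cmult L2_inner_cmult_right) simp

section \<open>Completeness and separation\<close>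

lemma L2_nn_integral:
  assumes "f \<in> L2 M"
  shows "(\<integral>\<^sup>+ x. ennreal ((norm (f x))\<^sup>2) \<partial>M) = ennreal ((L2_norm M f)\<^sup>2)"
  unfolding L2_norm_power2 using L2_integrable[OF assms] by (subst nn_integral_eq_integral) auto

lemma L2_I_nn_integral:
  assumes [measurable]: "f \<in> borel_measurable M" and "(\<integral>\<^sup>+ x. ennreal ((norm (f x))\<^sup>2) \<partial>M) \<le> ennreal (c\<^sup>2)" "0 \<le> c"
  shows "f \<in> L2 M \<and> L2_norm M f \<le> c"
proof
  have "(\<integral>\<^sup>+ x. ennreal (norm ((norm (f x))\<^sup>2)) \<partial>M) < \<infinity>"
    using assms(2) by (simp add: order_le_less_trans)
  then show f: "f \<in> L2 M" by (intro L2_I integrableI_bounded) auto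
  have "ennreal ((L2_norm M f)\<^sup>2) \<le> ennreal (c\<^sup>2)"
    using L2_nn_integral[OF f] assms(2) by simp
  then have "(L2_norm M f)\<^sup>2 \<le> c\<^sup>2" by simp
  then show "L2_norm M f \<le> c" using assms(3) by (meson power2_le_imp_le)
qed

text \<open>The increments are so small that their squares, weighted by \<open>4 ^ k\<close>, still have a finite sum
  almost everywhere; where they do, the increments decay like \<open>2 ^ (- k)\<close>.\<close>

lemma L2_fast_Cauchy_convergent_AE:
  assumes f: "\<And>n. f n \<in> L2 M" and fast: "\<And>k. L2_norm M (\<lambda>x. f (Suc k) x - f k x) \<le> (1/4)^k"
  shows "AE x in M. convergent (\<lambda>k. f k x)"
proof -
  have [measurable]: "f n \<in> borel_measurable M" for n using f by (auto dest: L2_measurable)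
  define d where "d k x = (norm (f (Suc k) x - f k x))\<^sup>2" for k x
  have [measurable]: "d k \<in> borel_measurable M" for k unfolding d_def by measurable
  have "(\<integral>\<^sup>+x. (\<Sum>k. ennreal (4^k * d k x)) \<partial>M) = (\<Sum>k. \<integral>\<^sup>+x. ennreal (4^k * d k x) \<partial>M)"
    by (rule nn_integral_suminf) measurable
  also have "\<dots> \<le> (\<Sum>k. ennreal ((1/4)^k))"
  proof (rule suminf_le)
    fix k
    have "(\<integral>\<^sup>+x. ennreal (4^k * d k x) \<partial>M) = ennreal (4^k) * (\<integral>\<^sup>+x. ennreal (d k x) \<partial>M)"
      by (subst nn_integral_cmult[symmetric]) (auto simp: ennreal_mult d_def)
    also have "(\<integral>\<^sup>+x. ennreal (d k x) \<partial>M) = ennreal ((L2_norm M (\<lambda>x. f (Suc k) x - f k x))\<^sup>2)"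
      unfolding d_def using f by (intro L2_nn_integral) auto
    also have "ennreal (4^k) * ennreal ((L2_norm M (\<lambda>x. f (Suc k) x - f k x))\<^sup>2) \<le> ennreal (4^k) * ennreal (((1/4)^k)\<^sup>2)"
      using fast[of k] by (intro mult_left_mono ennreal_leI power_mono) auto
    finally have "(\<integral>\<^sup>+x. ennreal (4^k * d k x) \<partial>M) \<le> ennreal (4^k) * ennreal (((1/4)^k)\<^sup>2)" .
    also have "\<dots> = ennreal ((1/4)^k)"
      by (simp add: ennreal_mult[symmetric] power2_eq_square power_mult_distrib[symmetric] mult.assoc[symmetric])
    finally show "(\<integral>\<^sup>+x. ennreal (4^k * d k x) \<partial>M) \<le> ennreal ((1/4)^k)" .
  qed auto
  also have "\<dots> = ennreal (\<Sum>k. (1/4)^k)"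
    by (rule suminf_ennreal2) (auto intro: summable_geometric)
  finally have "(\<integral>\<^sup>+x. (\<Sum>k. ennreal (4^k * d k x)) \<partial>M) \<noteq> \<infinity>"
    by (auto simp: top_unique)
  then have "AE x in M. (\<Sum>k. ennreal (4^k * d k x)) \<noteq> \<infinity>"
    by (intro nn_integral_PInf_AE) auto
  then show ?thesis
  proof eventually_elim
    case (elim x)
    have nn: "0 \<le> 4^k * d k x" for k by (simp add: d_def)
    have "summable (\<lambda>k. 4^k * d k x)"
      using elim nn by (intro summable_suminf_not_top) auto
    then obtain C where C: "\<And>k. norm (4^k * d k x) \<le> C"
      using convergent_imp_Bseq[OF convergentI[OF summable_LIMSEQ_zero]] unfolding Bseq_def by meson
    have bound: "norm (f (Suc k) x - f k x) \<le> sqrt C * (1/2)^k" for k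
    proof -
      have "(2^k * norm (f (Suc k) x - f k x))\<^sup>2 \<le> C"
        using C[of k] by (simp add: d_def power_mult_distrib power2_eq_square[of "2^k"] power_mult_distrib[symmetric])
      then have "2^k * norm (f (Suc k) x - f k x) \<le> sqrt C" by (rule real_le_rsqrt)
      then show ?thesis by (simp add: field_simps power_one_over)
    qed
    have "summable (\<lambda>k. sqrt C * (1/2::real)^k)" by (intro summable_mult summable_geometric) simp
    then have "summable (\<lambda>k. f (Suc k) x - f k x)"
      using bound by (rule summable_comparison_test'[where N=0])
    then have "convergent (\<lambda>n. \<Sum>k<n. f (Suc k) x - f k x)"
      by (simp add: summable_iff_convergent)
    then have "convergent (\<lambda>n. f n x - f 0 x)" by (simp add: sum_lessThan_telescope[of "\<lambda>k. f k x"])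
    then show ?case using convergent_diff_const_right_iff[of "\<lambda>n. f n x" "f 0 x"] by simp
  qed
qed

text \<open>A rapidly converging subsequence converges almost everywhere, and Fatou's lemma identifies its limit
  as the limit in norm.\<close>

lemma L2_complete:
  assumes f: "\<And>n. f n \<in> L2 M"
    and Cauchy: "\<And>e. 0 < e \<Longrightarrow> \<exists>K. \<forall>m\<ge>K. \<forall>n\<ge>K. L2_norm M (\<lambda>x. f m x - f n x) < e"
  obtains g where "g \<in> L2 M" "(\<lambda>n. L2_norm M (\<lambda>x. f n x - g x)) \<longlonglongrightarrow> 0"
proof -
  have [measurable]: "f n \<in> borel_measurable M" for n using f by (auto dest: L2_measurable)
  have "\<exists>K. \<forall>k. \<forall>m\<ge>K k. \<forall>n\<ge>K k. L2_norm M (\<lambda>x. f m x - f n x) < (1/4)^k"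
    using Cauchy[of "(1/4)^_"] by (intro choice allI) simp
  then obtain K where K: "\<And>k m n. m \<ge> K k \<Longrightarrow> n \<ge> K k \<Longrightarrow> L2_norm M (\<lambda>x. f m x - f n x) < (1/4)^k" by blast
  define r where "r k = k + (\<Sum>i\<le>k. K i)" for k
  have rK: "r k \<ge> K k" for k unfolding r_def by (simp add: member_le_sum trans_le_add2)
  have "strict_mono r" unfolding r_def by (simp add: strict_mono_Suc_iff)
  then have r_ge: "r k \<ge> k" for k by (rule seq_suble)
  have "r (Suc k) \<ge> K k" for k using rK[of k] \<open>strict_mono r\<close> by (meson le_SucI le_trans order_refl strict_mono_less_eq)
  then have "L2_norm M (\<lambda>x. f (r (Suc k)) x - f (r k) x) \<le> (1/4)^k" for k
    using K[of k "r (Suc k)" "r k"] rK[of k] by (simp add: less_imp_le)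
  then have conv: "AE x in M. convergent (\<lambda>k. f (r k) x)"
    using f by (intro L2_fast_Cauchy_convergent_AE) auto
  define g where "g x = lim (\<lambda>k. f (r k) x)" for x
  have gm [measurable]: "g \<in> borel_measurable M" unfolding g_def by measurable
  have fg: "(\<lambda>x. f n x - g x) \<in> L2 M \<and> L2_norm M (\<lambda>x. f n x - g x) \<le> e"
    if e: "e > 0" and n: "\<And>m. m \<ge> n \<Longrightarrow> L2_norm M (\<lambda>x. f n x - f m x) < e" for n e
  proof (rule L2_I_nn_integral)
    have "(\<integral>\<^sup>+ x. ennreal ((norm (f n x - g x))\<^sup>2) \<partial>M) = (\<integral>\<^sup>+ x. liminf (\<lambda>k. ennreal ((norm (f n x - f (r k) x))\<^sup>2)) \<partial>M)"
    proof (rule nn_integral_cong_AE)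
      show "AE x in M. ennreal ((norm (f n x - g x))\<^sup>2) = liminf (\<lambda>k. ennreal ((norm (f n x - f (r k) x))\<^sup>2))"
        using conv
      proof eventually_elim
        case (elim x)
        then have "(\<lambda>k. f (r k) x) \<longlonglongrightarrow> g x" unfolding g_def by (simp add: convergent_LIMSEQ_iff)
        then have "(\<lambda>k. ennreal ((norm (f n x - f (r k) x))\<^sup>2)) \<longlonglongrightarrow> ennreal ((norm (f n x - g x))\<^sup>2)"
          by (intro tendsto_ennrealI tendsto_intros)
        then show ?case by (rule lim_imp_Liminf[OF sequentially_bot, symmetric])
      qed
    qed
    also have "\<dots> \<le> liminf (\<lambda>k. \<integral>\<^sup>+ x. ennreal ((norm (f n x - f (r k) x))\<^sup>2) \<partial>M)"
      by (rule nn_integral_liminf) measurable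
    also have "\<dots> = liminf (\<lambda>k. ennreal ((L2_norm M (\<lambda>x. f n x - f (r k) x))\<^sup>2))"
      using f by (subst L2_nn_integral) auto
    also have "\<dots> \<le> ennreal (e\<^sup>2)"
    proof (rule Liminf_le[OF sequentially_bot])
      show "\<forall>\<^sub>F k in sequentially. ennreal ((L2_norm M (\<lambda>x. f n x - f (r k) x))\<^sup>2) \<le> ennreal (e\<^sup>2)"
        using eventually_ge_at_top[of n]
      proof eventually_elim
        case (elim k)
        then have "n \<le> r k" using r_ge[of k] by simp
        from n[OF this] show ?case by (intro ennreal_leI power_mono) auto
      qed
    qed
    finally show "(\<integral>\<^sup>+ x. ennreal ((norm (f n x - g x))\<^sup>2) \<partial>M) \<le> ennreal (e\<^sup>2)" .
  qed (use e in auto)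
  have ev: "\<exists>n0. \<forall>n\<ge>n0. (\<lambda>x. f n x - g x) \<in> L2 M \<and> L2_norm M (\<lambda>x. f n x - g x) \<le> e" if e: "e > 0" for e
  proof -
    obtain n0 where "\<forall>m\<ge>n0. \<forall>n\<ge>n0. L2_norm M (\<lambda>x. f m x - f n x) < e"
      using Cauchy[OF e] by blast
    then show ?thesis using fg[OF e] by (meson order_trans)
  qed
  show thesis
  proof
    obtain n where n: "(\<lambda>x. f n x - g x) \<in> L2 M" using ev[of 1] by auto
    show "g \<in> L2 M" using L2_diff[OF f[of n] n] by simp
    show "(\<lambda>n. L2_norm M (\<lambda>x. f n x - g x)) \<longlonglongrightarrow> 0"
    proof (rule LIMSEQ_I)
      fix e :: real assume "e > 0"
      then obtain n0 where n0: "\<And>n. n \<ge> n0 \<Longrightarrow> L2_norm M (\<lambda>x. f n x - g x) \<le> e / 2"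
        using ev[of "e/2"] by auto
      have "norm (L2_norm M (\<lambda>x. f n x - g x) - 0) < e" if "n \<ge> n0" for n
        using n0[OF that] \<open>e > 0\<close> by simp
      then show "\<exists>no. \<forall>n\<ge>no. norm (L2_norm M (\<lambda>x. f n x - g x) - 0) < e" by blast
    qed
  qed
qed

text \<open>In a Hilbert space, a minimising sequence of a convex set that stays away from the origin
  converges by the parallelogram law, and its limit separates the convex set from the origin.  Two
  summands are needed because the set will consist of pairs of kernels.\<close>

lemma L2_pair_separation:
  fixes C :: "(('a \<Rightarrow> complex) \<times> ('a \<Rightarrow> complex)) set"
  assumes sub: "C \<subseteq> L2 M \<times> L2 M" and ne: "C \<noteq> {}"
    and conv: "\<And>u1 u2 v1 v2 t. (u1, u2) \<in> C \<Longrightarrow> (v1, v2) \<in> C \<Longrightarrow> 0 < t \<Longrightarrow> t < 1 \<Longrightarrow>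
      ((\<lambda>x. u1 x + of_real t * (v1 x - u1 x)), (\<lambda>x. u2 x + of_real t * (v2 x - u2 x))) \<in> C"
    and far: "\<And>u1 u2. (u1, u2) \<in> C \<Longrightarrow> d \<le> (L2_norm M u1)\<^sup>2 + (L2_norm M u2)\<^sup>2" and d: "0 < d"
  obtains h1 h2 m where "h1 \<in> L2 M" "h2 \<in> L2 M" "0 < m"
    "\<And>u1 u2. (u1, u2) \<in> C \<Longrightarrow> m \<le> Re (L2_inner M u1 h1 + L2_inner M u2 h2)"
proof -
  define q where "q u = (L2_norm M (fst u))\<^sup>2 + (L2_norm M (snd u))\<^sup>2" for u :: "('a \<Rightarrow> complex) \<times> ('a \<Rightarrow> complex)"
  define m where "m = (INF u\<in>C. q u)"
  have bdd: "bdd_below (q ` C)" by (rule bdd_belowI2[of _ 0]) (simp add: q_def)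
  have m_le: "m \<le> q u" if "u \<in> C" for u unfolding m_def using bdd that by (rule cINF_lower)
  have "d \<le> m" unfolding m_def using ne far by (intro cINF_greatest) (auto simp: q_def)
  have "\<exists>u. \<forall>n::nat. u n \<in> C \<and> q (u n) < m + 1 / Suc n"
  proof (intro choice allI)
    fix n :: nat
    have "m < m + 1 / Suc n" by simp
    then show "\<exists>u. u \<in> C \<and> q u < m + 1 / Suc n"
      unfolding m_def using cINF_less_iff[OF ne bdd] by blast
  qed
  then obtain u where u: "\<And>n. u n \<in> C" "\<And>n. q (u n) < m + 1 / Suc n" by blast
  define v w where "v n = fst (u n)" and "w n = snd (u n)" for n
  have v: "v n \<in> L2 M" and w: "w n \<in> L2 M" for n using u(1)[of n] sub by (auto simp: v_def w_def)
  have vw: "(v n, w n) \<in> C" and qvw: "(L2_norm M (v n))\<^sup>2 + (L2_norm M (w n))\<^sup>2 < m + 1 / Suc n" for n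
    using u[of n] by (simp_all add: v_def w_def q_def)
  have half: "L2_norm M (\<lambda>x. f x + of_real (1/2) * (g x - f x)) = L2_norm M (\<lambda>x. f x + g x) / 2" for f g :: "'a \<Rightarrow> complex"
  proof -
    have "(\<lambda>x. f x + of_real (1/2) * (g x - f x)) = (\<lambda>x. (1/2) * (f x + g x))"
      by (simp add: field_simps)
    then show ?thesis by (simp only: L2_norm_cmult) simp
  qed
  \<comment> \<open>parallelogram law: the midpoint of two almost minimal elements is in the set, so it is not much shorter\<close>
  have close: "(L2_norm M (\<lambda>x. v i x - v j x))\<^sup>2 + (L2_norm M (\<lambda>x. w i x - w j x))\<^sup>2 \<le> 2 / Suc i + 2 / Suc j" for i j
  proof -
    have "((\<lambda>x. v i x + of_real (1/2) * (v j x - v i x)), (\<lambda>x. w i x + of_real (1/2) * (w j x - w i x))) \<in> C"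
      by (rule conv[OF vw vw]) auto
    from m_le[OF this] have "4 * m \<le> (L2_norm M (\<lambda>x. v i x + v j x))\<^sup>2 + (L2_norm M (\<lambda>x. w i x + w j x))\<^sup>2"
      unfolding q_def fst_conv snd_conv half by (simp add: power_divide)
    then show ?thesis
      using L2_parallelogram[OF v v, of i j] L2_parallelogram[OF w w, of i j] qvw[of i] qvw[of j] by simp
  qed
  have cau: "\<exists>K. \<forall>i\<ge>K. \<forall>j\<ge>K. L2_norm M (\<lambda>x. v i x - v j x) < e \<and> L2_norm M (\<lambda>x. w i x - w j x) < e" if e: "e > 0" for e
  proof -
    obtain K :: nat where K: "4 / e\<^sup>2 < K" using reals_Archimedean2 by blast
    have "L2_norm M (\<lambda>x. v i x - v j x) < e \<and> L2_norm M (\<lambda>x. w i x - w j x) < e" if ij: "i \<ge> K" "j \<ge> K" for i j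
    proof -
      have K0: "0 < real K" using K e by (meson divide_pos_pos less_trans zero_less_numeral zero_less_power)
      have "2 / Suc i \<le> 2 / real K" "2 / Suc j \<le> 2 / real K" using ij K0 by (auto intro!: divide_left_mono)
      moreover have "4 / real K < e\<^sup>2" using K K0 e by (simp add: field_simps)
      ultimately have "2 / Suc i + 2 / Suc j < e\<^sup>2" by simp
      then have "(L2_norm M (\<lambda>x. v i x - v j x))\<^sup>2 < e\<^sup>2" "(L2_norm M (\<lambda>x. w i x - w j x))\<^sup>2 < e\<^sup>2"
        using close[of i j] zero_le_power2[of "L2_norm M (\<lambda>x. v i x - v j x)"] zero_le_power2[of "L2_norm M (\<lambda>x. w i x - w j x)"]
        by linarith+
      then show ?thesis using e by (auto intro: power2_less_imp_less)
    qed
    then show ?thesis by blast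
  qed
  have ch1: "\<exists>K. \<forall>i\<ge>K. \<forall>j\<ge>K. L2_norm M (\<lambda>x. v i x - v j x) < e" if "0 < e" for e
    using cau[OF that] by fast
  have ch2: "\<exists>K. \<forall>i\<ge>K. \<forall>j\<ge>K. L2_norm M (\<lambda>x. w i x - w j x) < e" if "0 < e" for e
    using cau[OF that] by fast
  obtain h1 where h1: "h1 \<in> L2 M" "(\<lambda>n. L2_norm M (\<lambda>x. v n x - h1 x)) \<longlonglongrightarrow> 0"
    by (rule L2_complete[OF v ch1])
  obtain h2 where h2: "h2 \<in> L2 M" "(\<lambda>n. L2_norm M (\<lambda>x. w n x - h2 x)) \<longlonglongrightarrow> 0"
    by (rule L2_complete[OF w ch2])
  have nv: "(\<lambda>n. L2_norm M (v n)) \<longlonglongrightarrow> L2_norm M h1" by (rule L2_norm_tendsto[OF v h1])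
  have nw: "(\<lambda>n. L2_norm M (w n)) \<longlonglongrightarrow> L2_norm M h2" by (rule L2_norm_tendsto[OF w h2])
  have qh: "(L2_norm M h1)\<^sup>2 + (L2_norm M h2)\<^sup>2 = m"
  proof (rule LIMSEQ_unique)
    show "(\<lambda>n. (L2_norm M (v n))\<^sup>2 + (L2_norm M (w n))\<^sup>2) \<longlonglongrightarrow> (L2_norm M h1)\<^sup>2 + (L2_norm M h2)\<^sup>2"
      by (intro tendsto_intros nv nw)
    have "(\<lambda>n. m + 1 / real (Suc n)) \<longlonglongrightarrow> m + 0" by (intro tendsto_intros LIMSEQ_Suc lim_1_over_n)
    then have lim: "(\<lambda>n. m + 1 / real (Suc n)) \<longlonglongrightarrow> m" by simp
    show "(\<lambda>n. (L2_norm M (v n))\<^sup>2 + (L2_norm M (w n))\<^sup>2) \<longlonglongrightarrow> m"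
    proof (rule tendsto_sandwich[OF _ _ tendsto_const lim])
      show "\<forall>\<^sub>F n in sequentially. m \<le> (L2_norm M (v n))\<^sup>2 + (L2_norm M (w n))\<^sup>2"
        using m_le[OF vw] by (simp add: q_def)
      show "\<forall>\<^sub>F n in sequentially. (L2_norm M (v n))\<^sup>2 + (L2_norm M (w n))\<^sup>2 \<le> m + 1 / real (Suc n)"
        using qvw by (simp add: less_imp_le)
    qed
  qed
  show thesis
  proof
    show "h1 \<in> L2 M" "h2 \<in> L2 M" "0 < m" using h1 h2 d \<open>d \<le> m\<close> by auto
    fix u1 u2 assume uC: "(u1, u2) \<in> C"
    then have u12: "u1 \<in> L2 M" "u2 \<in> L2 M" using sub by auto
    define D where "D = (L2_norm M (\<lambda>x. u1 x - h1 x))\<^sup>2 + (L2_norm M (\<lambda>x. u2 x - h2 x))\<^sup>2"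
    define R where "R = Re (L2_inner M u1 h1 + L2_inner M u2 h2) - m"
    \<comment> \<open>the segment from the limit towards \<open>u\<close> does not come closer to the origin; divide by its parameter\<close>
    have mid: "0 \<le> 2 * R + t * D" if t: "0 < t" "t < 1" for t
    proof -
      have ex: "(L2_norm M (\<lambda>x. f x + of_real t * (g x - f x)))\<^sup>2 = (L2_norm M f)\<^sup>2 + 2 * t * (Re (L2_inner M g f) - (L2_norm M f)\<^sup>2) + t\<^sup>2 * (L2_norm M (\<lambda>x. g x - f x))\<^sup>2"
        if "f \<in> L2 M" "g \<in> L2 M" for f g
      proof -
        have "Re (L2_inner M f (\<lambda>x. of_real t * (g x - f x))) = t * (Re (L2_inner M g f) - (L2_norm M f)\<^sup>2)"
          unfolding L2_inner_cmult_right L2_inner_diff_right[OF that(2,1,1)] L2_inner_self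
          by (subst L2_inner_commute) simp
        then show ?thesis
          using L2_norm_add_power2[OF that(1) L2_cmult[OF L2_diff[OF that(2,1)], of "of_real t"]] t
          unfolding L2_norm_cmult by (simp add: power_mult_distrib)
      qed
      have lim: "(\<lambda>n. L2_norm M (\<lambda>x. f n x + of_real t * (g x - f n x))) \<longlonglongrightarrow> L2_norm M (\<lambda>x. h x + of_real t * (g x - h x))"
        if "\<And>n. f n \<in> L2 M" "h \<in> L2 M" "g \<in> L2 M" "(\<lambda>n. L2_norm M (\<lambda>x. f n x - h x)) \<longlonglongrightarrow> 0" for f g h
      proof (rule L2_norm_tendsto)
        have "(\<lambda>x. (f n x + of_real t * (g x - f n x)) - (h x + of_real t * (g x - h x))) = (\<lambda>x. of_real (1 - t) * (f n x - h x))" for n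
          by (simp add: field_simps)
        then show "(\<lambda>n. L2_norm M (\<lambda>x. (f n x + of_real t * (g x - f n x)) - (h x + of_real t * (g x - h x)))) \<longlonglongrightarrow> 0"
          using tendsto_mult_right_zero[OF that(4)] by (simp only: L2_norm_cmult)
      qed (use that in \<open>auto intro!: L2_add L2_cmult L2_diff\<close>)
      have "m \<le> (L2_norm M (\<lambda>x. h1 x + of_real t * (u1 x - h1 x)))\<^sup>2 + (L2_norm M (\<lambda>x. h2 x + of_real t * (u2 x - h2 x)))\<^sup>2"
      proof (rule LIMSEQ_le_const)
        show "(\<lambda>n. (L2_norm M (\<lambda>x. v n x + of_real t * (u1 x - v n x)))\<^sup>2 + (L2_norm M (\<lambda>x. w n x + of_real t * (u2 x - w n x)))\<^sup>2)
          \<longlonglongrightarrow> (L2_norm M (\<lambda>x. h1 x + of_real t * (u1 x - h1 x)))\<^sup>2 + (L2_norm M (\<lambda>x. h2 x + of_real t * (u2 x - h2 x)))\<^sup>2"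
          by (intro tendsto_intros lim v w h1 h2 u12)
        show "\<exists>N. \<forall>n\<ge>N. m \<le> (L2_norm M (\<lambda>x. v n x + of_real t * (u1 x - v n x)))\<^sup>2 + (L2_norm M (\<lambda>x. w n x + of_real t * (u2 x - w n x)))\<^sup>2"
          using m_le[OF conv[OF vw uC t]] by (simp add: q_def)
      qed
      then have "0 \<le> t * (2 * R + t * D)"
        unfolding ex[OF h1(1) u12(1)] ex[OF h2(1) u12(2)] R_def D_def qh[symmetric]
        by (simp add: algebra_simps power2_eq_square)
      then show ?thesis using t by (simp add: zero_le_mult_iff)
    qed
    have "0 \<le> R"
    proof (rule ccontr)
      assume "\<not> 0 \<le> R"
      then have R: "R < 0" by simp
      have D0: "D \<ge> 0" by (simp add: D_def)
      define t where "t = min (1/2) (- R / (D + 1))"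
      have "0 < - R / (D + 1)" using R D0 by (intro divide_pos_pos) auto
      then have t: "0 < t" "t < 1" by (auto simp: t_def)
      have "t * D \<le> - R / (D + 1) * D" using D0 by (intro mult_right_mono) (auto simp: t_def)
      also have "\<dots> \<le> - R" using R D0 by (simp add: field_simps mult_le_0_iff)
      finally show False using mid[OF t] R by simp
    qed
    then show "m \<le> Re (L2_inner M u1 h1 + L2_inner M u2 h2)" by (simp add: R_def)
  qed
qed

section \<open>Bounded operators\<close>

lemma bounded_ops_L2: "T \<in> bounded_ops M N \<Longrightarrow> f \<in> L2 M \<Longrightarrow> T f \<in> L2 N"
  by (simp add: bounded_ops_def)

lemma bounded_ops_add: "T \<in> bounded_ops M N \<Longrightarrow> f \<in> L2 M \<Longrightarrow> g \<in> L2 M \<Longrightarrow>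
    AE y in N. T (\<lambda>x. f x + g x) y = T f y + T g y"
  by (simp add: bounded_ops_def)

lemma bounded_ops_cmult: "T \<in> bounded_ops M N \<Longrightarrow> f \<in> L2 M \<Longrightarrow>
    AE y in N. T (\<lambda>x. c * f x) y = c * T f y"
  by (simp add: bounded_ops_def)

lemma bounded_ops_bounded:
  assumes "T \<in> bounded_ops M N"
  obtains C where "0 \<le> C" "\<And>f. f \<in> L2 M \<Longrightarrow> L2_norm N (T f) \<le> C * L2_norm M f"
proof -
  obtain C where C: "\<And>f. f \<in> L2 M \<Longrightarrow> L2_norm N (T f) \<le> C * L2_norm M f"
    using assms unfolding bounded_ops_def by blast
  have "L2_norm N (T f) \<le> max 0 C * L2_norm M f" if "f \<in> L2 M" for f
    using C[OF that] by (rule order_trans) (simp add: mult_right_mono)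
  then show ?thesis using that[of "max 0 C"] by simp
qed

lemma bounded_opsI:
  assumes "\<And>f. f \<in> L2 M \<Longrightarrow> T f \<in> L2 N"
    and "\<And>f g. f \<in> L2 M \<Longrightarrow> g \<in> L2 M \<Longrightarrow> AE y in N. T (\<lambda>x. f x + g x) y = T f y + T g y"
    and "\<And>c f. f \<in> L2 M \<Longrightarrow> AE y in N. T (\<lambda>x. c * f x) y = c * T f y"
    and "\<And>f. f \<in> L2 M \<Longrightarrow> L2_norm N (T f) \<le> C * L2_norm M f"
  shows "T \<in> bounded_ops M N"
  using assms unfolding bounded_ops_def by blast

lemma op_norm_bdd_above:
  assumes "T \<in> bounded_ops M N"
  shows "bdd_above ((\<lambda>f. L2_norm N (T f)) ` {f \<in> L2 M. L2_norm M f \<le> 1})"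
proof -
  obtain C where C: "0 \<le> C" "\<And>f. f \<in> L2 M \<Longrightarrow> L2_norm N (T f) \<le> C * L2_norm M f"
    by (rule bounded_ops_bounded[OF assms]) blast
  have "L2_norm N (T f) \<le> C" if "f \<in> L2 M" "L2_norm M f \<le> 1" for f
    using C(2)[OF that(1)] mult_left_mono[OF that(2) C(1)] by simp
  then show ?thesis by (intro bdd_aboveI2[where M=C]) auto
qed

lemma L2_norm_bounded_ops_cmult:
  assumes "T \<in> bounded_ops M N" "f \<in> L2 M"
  shows "L2_norm N (T (\<lambda>x. c * f x)) = norm c * L2_norm N (T f)"
proof -
  have "L2_norm N (T (\<lambda>x. c * f x)) = L2_norm N (\<lambda>y. c * T f y)"
    by (intro L2_norm_cong_AE bounded_ops_cmult[OF assms(1)] L2_measurable L2_cmult bounded_ops_L2[OF assms(1)] assms(2))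
  then show ?thesis by (simp add: L2_norm_cmult)
qed

lemma op_norm_bound:
  assumes T: "T \<in> bounded_ops M N" and f: "f \<in> L2 M"
  shows "L2_norm N (T f) \<le> op_norm M N T * L2_norm M f"
proof (cases "L2_norm M f = 0")
  case True
  obtain C where C: "0 \<le> C" "\<And>f. f \<in> L2 M \<Longrightarrow> L2_norm N (T f) \<le> C * L2_norm M f"
    by (rule bounded_ops_bounded[OF T]) blast
  show ?thesis using C(2)[OF f] True by simp
next
  case False
  then have pos: "0 < L2_norm M f" by (simp add: less_le)
  let ?g = "\<lambda>x. complex_of_real (1 / L2_norm M f) * f x"
  have g: "?g \<in> L2 M" using f by (rule L2_cmult)
  have "L2_norm M ?g \<le> 1" using pos unfolding L2_norm_cmult by (simp add: norm_divide)
  then have "L2_norm N (T ?g) \<le> op_norm M N T"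
    unfolding op_norm_def using g by (intro cSUP_upper op_norm_bdd_above[OF T]) auto
  then show ?thesis
    unfolding L2_norm_bounded_ops_cmult[OF T f] using pos by (simp add: field_simps norm_divide)
qed

lemma op_norm_le:
  assumes "0 \<le> c" "\<And>f. f \<in> L2 M \<Longrightarrow> L2_norm N (T f) \<le> c * L2_norm M f"
  shows "op_norm M N T \<le> c"
  unfolding op_norm_def
proof (rule cSUP_least)
  show "{f \<in> L2 M. L2_norm M f \<le> 1} \<noteq> {}" using L2_zero[of M] L2_norm_zero[of M] by force
  fix f assume "f \<in> {f \<in> L2 M. L2_norm M f \<le> 1}"
  then show "L2_norm N (T f) \<le> c"
    using assms(2)[of f] mult_left_mono[OF _ assms(1), of "L2_norm M f" 1] by simp
qed

lemma op_norm_nonneg: "T \<in> bounded_ops M N \<Longrightarrow> 0 \<le> op_norm M N T"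
  unfolding op_norm_def
  by (rule cSUP_upper2[OF op_norm_bdd_above, where x="\<lambda>x. 0"]) auto

lemma bounded_ops_diff:
  assumes "T \<in> bounded_ops M N" "f \<in> L2 M" "g \<in> L2 M"
  shows "AE y in N. T (\<lambda>x. f x - g x) y = T f y - T g y"
  using bounded_ops_add[OF assms(1,2) L2_cmult[OF assms(3), of "-1"]] bounded_ops_cmult[OF assms(1,3), of "-1"]
  by (auto elim: eventually_elim2)

lemma bounded_ops_zero:
  assumes "T \<in> bounded_ops M N"
  shows "AE y in N. T (\<lambda>x. 0) y = 0"
  using bounded_ops_cmult[OF assms L2_zero, of 0] by simp

lemma bounded_ops_sum:
  assumes T: "T \<in> bounded_ops M N" and f: "\<And>i. i \<in> I \<Longrightarrow> f i \<in> L2 M"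
  shows "AE y in N. T (\<lambda>x. \<Sum>i\<in>I. c i * f i x) y = (\<Sum>i\<in>I. c i * T (f i) y)"
  using f
proof (induction I rule: infinite_finite_induct)
  case (insert i I)
  have "AE y in N. T (\<lambda>x. c i * f i x + (\<Sum>i\<in>I. c i * f i x)) y = T (\<lambda>x. c i * f i x) y + T (\<lambda>x. \<Sum>i\<in>I. c i * f i x) y"
    using insert.prems by (intro bounded_ops_add[OF T] L2_cmult L2_sum) auto
  moreover have "AE y in N. T (\<lambda>x. c i * f i x) y = c i * T (f i) y"
    using insert.prems by (intro bounded_ops_cmult[OF T]) auto
  moreover have "AE y in N. T (\<lambda>x. \<Sum>i\<in>I. c i * f i x) y = (\<Sum>i\<in>I. c i * T (f i) y)"
    using insert by blast
  ultimately show ?case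
    by eventually_elim (use insert in simp)
qed (use bounded_ops_zero[OF T] in simp_all)

lemma L2_norm_bounded_ops_diff:
  assumes "T \<in> bounded_ops M N" "f \<in> L2 M" "g \<in> L2 M"
  shows "L2_norm N (\<lambda>y. T f y - T g y) = L2_norm N (T (\<lambda>x. f x - g x))"
proof (rule L2_norm_cong_AE)
  show "AE y in N. T f y - T g y = T (\<lambda>x. f x - g x) y"
    using bounded_ops_diff[OF assms] by eventually_elim simp
qed (intro L2_measurable L2_diff bounded_ops_L2[OF assms(1)] assms)+

lemma bounded_ops_cong_AE:
  assumes T: "T \<in> bounded_ops M N" and fg: "f \<in> L2 M" "g \<in> L2 M" "AE x in M. f x = g x"
  shows "AE y in N. T f y = T g y"
proof -
  have d: "(\<lambda>x. f x - g x) \<in> L2 M" using fg by blast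
  then have "L2_norm M (\<lambda>x. f x - g x) = 0" using fg(3) by (simp add: L2_norm_eq_0_iff)
  then have "L2_norm N (\<lambda>y. T f y - T g y) \<le> 0"
    using op_norm_bound[OF T d] unfolding L2_norm_bounded_ops_diff[OF T fg(1,2)] by simp
  then have "L2_norm N (\<lambda>y. T f y - T g y) = 0" by (simp add: order_antisym)
  then have "AE y in N. T f y - T g y = 0"
    by (intro L2_norm_eq_0D L2_diff bounded_ops_L2[OF T] fg)
  then show ?thesis by simp
qed

lemma bounded_ops_op_diff [intro]:
  assumes S: "S \<in> bounded_ops M N" and T: "T \<in> bounded_ops M N"
  shows "(\<lambda>f y. S f y - T f y) \<in> bounded_ops M N"
proof (rule bounded_opsI)
  fix f g c assume f: "f \<in> L2 M"
  show "(\<lambda>y. S f y - T f y) \<in> L2 N" by (intro L2_diff bounded_ops_L2[OF S] bounded_ops_L2[OF T] f)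
  show "AE y in N. S (\<lambda>x. c * f x) y - T (\<lambda>x. c * f x) y = c * (S f y - T f y)"
    using bounded_ops_cmult[OF S f, of c] bounded_ops_cmult[OF T f, of c] by eventually_elim (simp add: right_diff_distrib)
  have "L2_norm N (\<lambda>y. S f y - T f y) \<le> L2_norm N (S f) + L2_norm N (T f)"
    by (intro L2_norm_triangle_diff bounded_ops_L2[OF S] bounded_ops_L2[OF T] f)
  also have "\<dots> \<le> op_norm M N S * L2_norm M f + op_norm M N T * L2_norm M f"
    by (intro add_mono op_norm_bound S T f)
  finally show "L2_norm N (\<lambda>y. S f y - T f y) \<le> (op_norm M N S + op_norm M N T) * L2_norm M f"
    by (simp add: algebra_simps)
  assume g: "g \<in> L2 M"
  show "AE y in N. S (\<lambda>x. f x + g x) y - T (\<lambda>x. f x + g x) y = S f y - T f y + (S g y - T g y)"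
    using bounded_ops_add[OF S f g] bounded_ops_add[OF T f g] by eventually_elim simp
qed

lemma zero_op_bounded [simp, intro]: "zero_op \<in> bounded_ops M N"
  by (rule bounded_opsI[where C=0]) (auto simp: zero_op_def)

lemma op_norm_diff_triangle:
  assumes R: "R \<in> bounded_ops M N" and S: "S \<in> bounded_ops M N" and T: "T \<in> bounded_ops M N"
  shows "op_norm M N (\<lambda>f y. R f y - T f y) \<le> op_norm M N (\<lambda>f y. R f y - S f y) + op_norm M N (\<lambda>f y. S f y - T f y)"
proof (rule op_norm_le)
  show "0 \<le> op_norm M N (\<lambda>f y. R f y - S f y) + op_norm M N (\<lambda>f y. S f y - T f y)"
    using R S T by (intro add_nonneg_nonneg op_norm_nonneg bounded_ops_op_diff)
  fix f assume f: "f \<in> L2 M"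
  have "L2_norm N (\<lambda>y. R f y - T f y) \<le> L2_norm N (\<lambda>y. R f y - S f y) + L2_norm N (\<lambda>y. S f y - T f y)"
    by (intro L2_norm_triangle_mid bounded_ops_L2[OF R] bounded_ops_L2[OF S] bounded_ops_L2[OF T] f)
  also have "\<dots> \<le> op_norm M N (\<lambda>f y. R f y - S f y) * L2_norm M f + op_norm M N (\<lambda>f y. S f y - T f y) * L2_norm M f"
    using op_norm_bound[OF bounded_ops_op_diff[OF R S] f] op_norm_bound[OF bounded_ops_op_diff[OF S T] f]
    by (rule add_mono)
  finally show "L2_norm N (\<lambda>y. R f y - T f y) \<le> (op_norm M N (\<lambda>f y. R f y - S f y) + op_norm M N (\<lambda>f y. S f y - T f y)) * L2_norm M f"
    by (simp add: algebra_simps)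
qed

lemma op_norm_minus_commute: "op_norm M N (\<lambda>f y. S f y - T f y) = op_norm M N (\<lambda>f y. T f y - S f y)"
  unfolding op_norm_def by (subst L2_norm_minus_commute) (rule refl)


section \<open>Orthonormal sequences\<close>

text \<open>Null vectors are permitted so that greedy choices can go on for ever, even if an operator has finite rank or
  the space has finite dimension.\<close>

definition orthonormal_or_zero :: "'a measure \<Rightarrow> (nat \<Rightarrow> 'a \<Rightarrow> complex) \<Rightarrow> bool" where
  "orthonormal_or_zero M f \<longleftrightarrow> (\<forall>i. f i \<in> L2 M \<and> (L2_norm M (f i) = 0 \<or> L2_norm M (f i) = 1)) \<and>
     (\<forall>i j. i \<noteq> j \<longrightarrow> L2_inner M (f i) (f j) = 0)"

lemma orthonormal_or_zero_L2: "orthonormal_or_zero M f \<Longrightarrow> f i \<in> L2 M"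
  by (simp add: orthonormal_or_zero_def)

lemma orthonormal_or_zero_norm: "orthonormal_or_zero M f \<Longrightarrow> L2_norm M (f i) = 0 \<or> L2_norm M (f i) = 1"
  by (simp add: orthonormal_or_zero_def)

lemma orthonormal_or_zero_norm_le: "orthonormal_or_zero M f \<Longrightarrow> L2_norm M (f i) \<le> 1"
  using orthonormal_or_zero_norm[of M f i] by auto

lemma orthonormal_or_zero_inner: "orthonormal_or_zero M f \<Longrightarrow> i \<noteq> j \<Longrightarrow> L2_inner M (f i) (f j) = 0"
  by (simp add: orthonormal_or_zero_def)

lemma orthonormal_or_zero_cnj:
  assumes "orthonormal_or_zero M f" shows "orthonormal_or_zero M (\<lambda>i x. cnj (f i x))"
proof -
  have "L2_inner M (\<lambda>x. cnj (f i x)) (\<lambda>x. cnj (f j x)) = cnj (L2_inner M (f i) (f j))" for i j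
    unfolding L2_inner_def by (subst Bochner_Integration.integral_cnj[symmetric]) simp
  then show ?thesis using assms unfolding orthonormal_or_zero_def by auto
qed

lemma orthogonal_sum_norm:
  fixes v :: "nat \<Rightarrow> 'a \<Rightarrow> complex"
  assumes v: "\<And>i. v i \<in> L2 M" and o: "\<And>i j. i \<noteq> j \<Longrightarrow> L2_inner M (v i) (v j) = 0"
  shows "(L2_norm M (\<lambda>x. \<Sum>i<n. c i * v i x))\<^sup>2 = (\<Sum>i<n. (norm (c i))\<^sup>2 * (L2_norm M (v i))\<^sup>2)"
proof (induction n)
  case (Suc n)
  have s: "(\<lambda>x. \<Sum>i<n. c i * v i x) \<in> L2 M" by (intro L2_sum L2_cmult v)
  have "L2_inner M (\<lambda>x. \<Sum>i<n. c i * v i x) (\<lambda>x. c n * v n x) = 0"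
    unfolding L2_inner_cmult_right
    by (subst L2_inner_sum_left) (auto simp: L2_inner_cmult_left o v intro!: L2_cmult)
  then show ?case
    using L2_norm_add_power2[OF s L2_cmult[OF v, of "c n" n]] Suc
    by (simp add: L2_norm_cmult power_mult_distrib)
qed simp

lemma residual_L2:
  assumes "\<And>i. f i \<in> L2 M" "u \<in> L2 M"
  shows "(\<lambda>x. u x - (\<Sum>i<n. L2_inner M u (f i) * f i x)) \<in> L2 M"
  using assms by (intro L2_diff L2_sum L2_cmult)

lemma residual_orthogonal:
  assumes f: "orthonormal_or_zero M f" and u: "u \<in> L2 M" and j: "j < n"
  shows "L2_inner M (\<lambda>x. u x - (\<Sum>i<n. L2_inner M u (f i) * f i x)) (f j) = 0"
proof -
  note fi = orthonormal_or_zero_L2[OF f]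
  have "L2_inner M (\<lambda>x. \<Sum>i<n. L2_inner M u (f i) * f i x) (f j) = (\<Sum>i<n. L2_inner M u (f i) * L2_inner M (f i) (f j))"
    by (subst L2_inner_sum_left) (auto simp: L2_inner_cmult_left fi intro!: L2_cmult)
  also have "\<dots> = (\<Sum>i<n. if i = j then L2_inner M u (f j) * L2_inner M (f j) (f j) else 0)"
    by (intro sum.cong) (auto simp: orthonormal_or_zero_inner[OF f])
  also have "\<dots> = L2_inner M u (f j) * L2_inner M (f j) (f j)" using j by simp
  also have "\<dots> = L2_inner M u (f j)"
    using orthonormal_or_zero_norm[OF f, of j]
  proof
    assume "L2_norm M (f j) = 0"
    then have "L2_inner M u (f j) = 0" using L2_cauchy_schwarz[OF u fi, of j] by simp
    then show ?thesis by simp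
  qed (simp add: L2_inner_self)
  finally show ?thesis
    by (subst L2_inner_diff_left) (auto intro!: L2_sum L2_cmult fi u)
qed

lemma bessel_residual:
  assumes f: "orthonormal_or_zero M f" and u: "u \<in> L2 M"
  shows "(L2_norm M (\<lambda>x. u x - (\<Sum>i<n. L2_inner M u (f i) * f i x)))\<^sup>2 = (L2_norm M u)\<^sup>2 - (\<Sum>i<n. (norm (L2_inner M u (f i)))\<^sup>2)"
proof -
  note fi = orthonormal_or_zero_L2[OF f]
  let ?p = "\<lambda>x. \<Sum>i<n. L2_inner M u (f i) * f i x" and ?r = "\<lambda>x. u x - (\<Sum>i<n. L2_inner M u (f i) * f i x)"
  have p: "?p \<in> L2 M" by (intro L2_sum L2_cmult fi)
  have r: "?r \<in> L2 M" by (rule residual_L2[OF fi u])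
  have "L2_inner M ?r ?p = 0"
    by (subst L2_inner_sum_right) (auto simp: L2_inner_cmult_right residual_orthogonal[OF f u] fi intro!: L2_cmult r)
  then have "(L2_norm M u)\<^sup>2 = (L2_norm M ?r)\<^sup>2 + (L2_norm M ?p)\<^sup>2"
    using L2_norm_add_power2[OF r p] by simp
  also have "(L2_norm M ?p)\<^sup>2 = (\<Sum>i<n. (norm (L2_inner M u (f i)))\<^sup>2 * (L2_norm M (f i))\<^sup>2)"
    by (rule orthogonal_sum_norm) (use f in \<open>auto simp: orthonormal_or_zero_def\<close>)
  also have "\<dots> = (\<Sum>i<n. (norm (L2_inner M u (f i)))\<^sup>2)"
  proof (rule sum.cong[OF refl])
    fix i
    show "(norm (L2_inner M u (f i)))\<^sup>2 * (L2_norm M (f i))\<^sup>2 = (norm (L2_inner M u (f i)))\<^sup>2"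
      using orthonormal_or_zero_norm[OF f, of i] L2_cauchy_schwarz[OF u fi, of i] by auto
  qed
  finally show ?thesis by simp
qed

lemma bessel_inequality:
  assumes "orthonormal_or_zero M f" "u \<in> L2 M"
  shows "(\<Sum>i<n. (norm (L2_inner M u (f i)))\<^sup>2) \<le> (L2_norm M u)\<^sup>2"
  using bessel_residual[OF assms, of n] zero_le_power2[of "L2_norm M (\<lambda>x. u x - (\<Sum>i<n. L2_inner M u (f i) * f i x))"]
  by linarith

lemma residual_norm_le:
  assumes "orthonormal_or_zero M f" "u \<in> L2 M"
  shows "L2_norm M (\<lambda>x. u x - (\<Sum>i<n. L2_inner M u (f i) * f i x)) \<le> L2_norm M u"
  by (rule power2_le_imp_le) (simp_all add: bessel_residual[OF assms] sum_nonneg)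

text \<open>With \<open>c = 1\<close> the vectors \<open>f n\<close> successively attain the norm of \<open>T\<close> on the orthogonal complement
  of their predecessors: they are singular vectors of \<open>T\<close>.  Since attaining the norm needs
  compactness, a constant \<open>c > 1\<close> serves as long as compactness is not yet established.\<close>

definition greedy_seq :: "'a measure \<Rightarrow> 'b measure \<Rightarrow> ('a, 'b) oper \<Rightarrow> real \<Rightarrow> (nat \<Rightarrow> 'a \<Rightarrow> complex) \<Rightarrow> bool" where
  "greedy_seq M N T c f \<longleftrightarrow> orthonormal_or_zero M f \<and>
     (\<forall>n. \<forall>u\<in>L2 M. (\<forall>i<n. L2_inner M u (f i) = 0) \<longrightarrow> L2_norm N (T u) \<le> c * L2_norm N (T (f n)) * L2_norm M u)"

lemma greedy_seqD:
  assumes "greedy_seq M N T c f"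
  shows "orthonormal_or_zero M f"
    and "u \<in> L2 M \<Longrightarrow> (\<And>i. i < n \<Longrightarrow> L2_inner M u (f i) = 0) \<Longrightarrow> L2_norm N (T u) \<le> c * L2_norm N (T (f n)) * L2_norm M u"
  using assms unfolding greedy_seq_def by auto

lemma greedy_seq_exists:
  assumes step: "\<And>(n::nat) f. (\<And>i. i < n \<Longrightarrow> f i \<in> L2 M) \<Longrightarrow> \<exists>r\<in>L2 M. (L2_norm M r = 0 \<or> L2_norm M r = 1) \<and>
      (\<forall>i<n. L2_inner M r (f i) = 0) \<and>
      (\<forall>u\<in>L2 M. (\<forall>i<n. L2_inner M u (f i) = 0) \<longrightarrow> L2_norm N (T u) \<le> c * L2_norm N (T r) * L2_norm M u)"
  shows "\<exists>f. greedy_seq M N T c f"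
proof -
  let ?P = "\<lambda>f (n::nat) r. r \<in> L2 M \<and> (L2_norm M r = 0 \<or> L2_norm M r = 1) \<and>
      (\<forall>i<n. L2_inner M r (f i) = 0) \<and>
      (\<forall>u\<in>L2 M. (\<forall>i<n. L2_inner M u (f i) = 0) \<longrightarrow> L2_norm N (T u) \<le> c * L2_norm N (T r) * L2_norm M u)"
  have "\<exists>f. \<forall>n. ?P f n (f n)"
  proof (rule dependent_wellorder_choice)
    fix n f assume "\<And>y. y < n \<Longrightarrow> ?P f y (f y)"
    then show "\<exists>r. ?P f n r" using step[of n f] by blast
  qed auto
  then obtain f where f: "\<And>n. ?P f n (f n)" by blast
  have "L2_inner M (f i) (f j) = 0" if "i \<noteq> j" for i j
  proof (cases "i < j")
    case True
    then have "L2_inner M (f j) (f i) = 0" using f by blast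
    then show ?thesis using L2_inner_commute[of M "f i" "f j"] by simp
  next
    case False
    then show ?thesis using f[of i] that by auto
  qed
  then show ?thesis unfolding greedy_seq_def orthonormal_or_zero_def using f by blast
qed

text \<open>The norm of the restriction of \<open>T\<close> to the orthogonal complement of finitely many vectors.\<close>

lemma norm_on_complement:
  assumes T: "T \<in> bounded_ops M N"
  obtains s where "0 \<le> s"
    "\<And>u. u \<in> L2 M \<Longrightarrow> \<forall>i<n. L2_inner M u (f i) = 0 \<Longrightarrow> L2_norm N (T u) \<le> s * L2_norm M u"
    "\<And>t. t < s \<Longrightarrow> \<exists>u\<in>L2 M. (\<forall>i<(n::nat). L2_inner M u (f i) = 0) \<and> L2_norm M u \<le> 1 \<and> t < L2_norm N (T u)"
proof -
  let ?E = "{u \<in> L2 M. \<forall>i<n. L2_inner M u (f i) = 0}"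
  let ?A = "{u \<in> ?E. L2_norm M u \<le> 1}"
  define s where "s = (SUP u\<in>?A. L2_norm N (T u))"
  have scale: "(\<lambda>x. c * u x) \<in> ?E" if "u \<in> ?E" for c u
    using that by (auto simp: L2_inner_cmult_left)
  have bdd: "bdd_above ((\<lambda>u. L2_norm N (T u)) ` ?A)"
    by (rule bdd_above_mono[OF op_norm_bdd_above[OF T]]) auto
  have zero: "(\<lambda>x. 0) \<in> ?A" by (simp add: L2_inner_def)
  then have ne: "?A \<noteq> {}" by blast
  show thesis
  proof
    show "0 \<le> s" unfolding s_def by (rule cSUP_upper2[OF bdd zero]) simp
    show "\<exists>u\<in>L2 M. (\<forall>i<n. L2_inner M u (f i) = 0) \<and> L2_norm M u \<le> 1 \<and> t < L2_norm N (T u)" if "t < s" for t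
      using that less_cSUP_iff[OF ne bdd, of t] unfolding s_def by blast
    fix u assume "u \<in> L2 M" "\<forall>i<n. L2_inner M u (f i) = 0"
    then have u: "u \<in> ?E" and uL: "u \<in> L2 M" by auto
    show "L2_norm N (T u) \<le> s * L2_norm M u"
    proof (cases "L2_norm M u = 0")
      case True
      then show ?thesis using op_norm_bound[OF T, of u] u by simp
    next
      case False
      then have pos: "0 < L2_norm M u" by (simp add: less_le)
      let ?g = "\<lambda>x. complex_of_real (1 / L2_norm M u) * u x"
      have "L2_norm M ?g \<le> 1" using pos unfolding L2_norm_cmult by (simp add: norm_divide)
      then have "L2_norm N (T ?g) \<le> s"
        unfolding s_def using scale[OF u] by (intro cSUP_upper bdd) blast
      moreover have "L2_norm N (T ?g) = L2_norm N (T u) / L2_norm M u"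
        unfolding L2_norm_bounded_ops_cmult[OF T uL] using pos by (simp add: norm_divide)
      ultimately have "L2_norm N (T u) / L2_norm M u \<le> s" by (simp only:)
      then show ?thesis using pos by (simp add: pos_divide_le_eq)
    qed
  qed
qed

lemma half_greedy_seq_exists:
  assumes T: "T \<in> bounded_ops M N"
  shows "\<exists>f. greedy_seq M N T 2 f"
proof (rule greedy_seq_exists)
  fix n and f :: "nat \<Rightarrow> 'a \<Rightarrow> complex"
  let ?E = "\<lambda>u. \<forall>i<n. L2_inner M u (f i) = 0"
  obtain s where s0: "0 \<le> s" and s_le: "\<And>u. u \<in> L2 M \<Longrightarrow> ?E u \<Longrightarrow> L2_norm N (T u) \<le> s * L2_norm M u"
    and s_sup: "\<And>t. t < s \<Longrightarrow> \<exists>u\<in>L2 M. ?E u \<and> L2_norm M u \<le> 1 \<and> t < L2_norm N (T u)"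
    by (rule norm_on_complement[OF T, of n f]) blast
  show "\<exists>r\<in>L2 M. (L2_norm M r = 0 \<or> L2_norm M r = 1) \<and> ?E r \<and>
      (\<forall>u\<in>L2 M. ?E u \<longrightarrow> L2_norm N (T u) \<le> 2 * L2_norm N (T r) * L2_norm M u)"
  proof (cases "s = 0")
    case True
    show ?thesis
    proof (intro bexI conjI ballI impI)
      fix u assume "u \<in> L2 M" "?E u"
      then have "L2_norm N (T u) \<le> 0" using s_le[of u] True by simp
      then show "L2_norm N (T u) \<le> 2 * L2_norm N (T (\<lambda>x. 0)) * L2_norm M u"
        by (rule order_trans) simp
    qed (auto simp: L2_inner_def)
  next
    case False
    then obtain r0 where r0: "r0 \<in> L2 M" "?E r0" "L2_norm M r0 \<le> 1" "s / 2 < L2_norm N (T r0)"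
      using s_sup[of "s / 2"] s0 by auto
    have "L2_norm M r0 \<noteq> 0"
      using r0 s_le[of r0] s0 by auto
    then have pos: "0 < L2_norm M r0" by (simp add: less_le)
    let ?r = "\<lambda>x. complex_of_real (1 / L2_norm M r0) * r0 x"
    have "L2_norm N (T r0) \<le> L2_norm N (T r0) / L2_norm M r0"
      using r0 pos by (simp add: field_simps mult_left_le_one_le)
    also have "\<dots> = L2_norm N (T ?r)"
      unfolding L2_norm_bounded_ops_cmult[OF T r0(1)] using pos by (simp add: norm_divide)
    finally have Tr: "s \<le> 2 * L2_norm N (T ?r)" using r0(4) by simp
    show ?thesis
    proof (intro bexI[of _ ?r] conjI ballI impI)
      have "L2_norm M ?r = 1" using pos unfolding L2_norm_cmult by (simp add: norm_divide)
      then show "L2_norm M ?r = 0 \<or> L2_norm M ?r = 1" by blast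
      show "?r \<in> L2 M" by (rule L2_cmult[OF r0(1)])
      show "?E ?r" unfolding L2_inner_cmult_left using r0(2) by simp
    next
      fix u assume u: "u \<in> L2 M" "?E u"
      then have "L2_norm N (T u) \<le> s * L2_norm M u" using s_le[of u] by simp
      also have "\<dots> \<le> 2 * L2_norm N (T ?r) * L2_norm M u" by (intro mult_right_mono Tr) simp
      finally show "L2_norm N (T u) \<le> 2 * L2_norm N (T ?r) * L2_norm M u" .
    qed
  qed
qed

text \<open>The residual of \<open>u\<close> is orthogonal to the first \<open>n\<close> terms, so the next term controls its image.\<close>

lemma greedy_seq_residual:
  assumes T: "T \<in> bounded_ops M N" and f: "greedy_seq M N T c f" and u: "u \<in> L2 M" and c: "0 \<le> c"
  shows "L2_norm N (\<lambda>y. T u y - (\<Sum>i<n. L2_inner M u (f i) * T (f i) y)) \<le> c * L2_norm N (T (f n)) * L2_norm M u"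
proof -
  note o = greedy_seqD(1)[OF f]
  note fi = orthonormal_or_zero_L2[OF o]
  let ?p = "\<lambda>x. \<Sum>i<n. L2_inner M u (f i) * f i x"
  let ?r = "\<lambda>x. u x - (\<Sum>i<n. L2_inner M u (f i) * f i x)"
  have r: "?r \<in> L2 M" by (rule residual_L2[OF fi u])
  have p: "?p \<in> L2 M" by (intro L2_sum L2_cmult fi)
  have "L2_norm N (\<lambda>y. T u y - (\<Sum>i<n. L2_inner M u (f i) * T (f i) y)) = L2_norm N (T ?r)"
  proof (rule L2_norm_cong_AE)
    show "AE y in N. T u y - (\<Sum>i<n. L2_inner M u (f i) * T (f i) y) = T ?r y"
      using bounded_ops_diff[OF T u p] bounded_ops_sum[OF T, of "{..<n}" f "\<lambda>i. L2_inner M u (f i)", OF fi]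
      by eventually_elim simp
  qed (intro L2_measurable L2_diff L2_sum L2_cmult bounded_ops_L2[OF T] fi u r)+
  also have "\<dots> \<le> c * L2_norm N (T (f n)) * L2_norm M ?r"
    by (rule greedy_seqD(2)[OF f r residual_orthogonal[OF o u]])
  also have "\<dots> \<le> c * L2_norm N (T (f n)) * L2_norm M u"
    using c by (intro mult_left_mono residual_norm_le[OF o u]) auto
  finally show ?thesis .
qed

section \<open>Hilbert--Schmidt operators\<close>

definition tensor_kernel :: "nat \<Rightarrow> (nat \<Rightarrow> 'a \<Rightarrow> complex) \<Rightarrow> (nat \<Rightarrow> 'b \<Rightarrow> complex) \<Rightarrow> 'a \<times> 'b \<Rightarrow> complex" where
  "tensor_kernel n a b = (\<lambda>z. \<Sum>i<n. a i (fst z) * b i (snd z))"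

context pair_sigma_finite
begin

lemma L2_slice:
  assumes "k \<in> L2 (M1 \<Otimes>\<^sub>M M2)"
  shows "AE y in M2. (\<lambda>x. k (x, y)) \<in> L2 M1"
proof -
  have [measurable]: "k \<in> borel_measurable (M1 \<Otimes>\<^sub>M M2)" using assms by (rule L2_measurable)
  have "AE y in M2. integrable M1 (\<lambda>x. (norm (k (x, y)))\<^sup>2)"
    using L2_integrable[OF assms] by (intro AE_integrable_snd) (simp add: case_prod_unfold)
  then show ?thesis
    using AE_space by eventually_elim (rule L2_I, measurable)
qed

lemma L2_norm_slice:
  assumes "k \<in> L2 (M1 \<Otimes>\<^sub>M M2)"
  shows "(\<lambda>y. complex_of_real (L2_norm M1 (\<lambda>x. k (x, y)))) \<in> L2 M2"
    and "L2_norm M2 (\<lambda>y. complex_of_real (L2_norm M1 (\<lambda>x. k (x, y)))) = L2_norm (M1 \<Otimes>\<^sub>M M2) k"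
proof -
  have [measurable]: "k \<in> borel_measurable (M1 \<Otimes>\<^sub>M M2)" using assms by (rule L2_measurable)
  have i: "integrable (M1 \<Otimes>\<^sub>M M2) (case_prod (\<lambda>x y. (norm (k (x, y)))\<^sup>2))"
    using L2_integrable[OF assms] by (simp add: case_prod_unfold)
  show "(\<lambda>y. complex_of_real (L2_norm M1 (\<lambda>x. k (x, y)))) \<in> L2 M2"
  proof (rule L2_I)
    show "(\<lambda>y. complex_of_real (L2_norm M1 (\<lambda>x. k (x, y)))) \<in> borel_measurable M2"
      unfolding L2_norm_def by measurable
    show "integrable M2 (\<lambda>y. (norm (complex_of_real (L2_norm M1 (\<lambda>x. k (x, y)))))\<^sup>2)"
      using integrable_snd[OF i] by (simp add: L2_norm_power2)
  qed
  show "L2_norm M2 (\<lambda>y. complex_of_real (L2_norm M1 (\<lambda>x. k (x, y)))) = L2_norm (M1 \<Otimes>\<^sub>M M2) k"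
    unfolding L2_norm_def[of M2] L2_norm_def[of "M1 \<Otimes>\<^sub>M M2"]
    using integral_snd[OF i] by (simp add: L2_norm_power2 case_prod_unfold)
qed

lemma int_op_measurable:
  assumes [measurable]: "k \<in> borel_measurable (M1 \<Otimes>\<^sub>M M2)" "f \<in> borel_measurable M1"
  shows "int_op M1 k f \<in> borel_measurable M2"
  unfolding int_op_def by measurable

lemma int_op_AE_bound:
  assumes k: "k \<in> L2 (M1 \<Otimes>\<^sub>M M2)" and f: "f \<in> L2 M1"
  shows "AE y in M2. norm (int_op M1 k f y) \<le> L2_norm M1 (\<lambda>x. k (x, y)) * L2_norm M1 f"
  using L2_slice[OF k]
  by eventually_elim (unfold int_op_def, rule L2_cauchy_schwarz_mult[OF _ f])

lemma int_op_L2: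
  assumes k: "k \<in> L2 (M1 \<Otimes>\<^sub>M M2)" and f: "f \<in> L2 M1"
  shows "int_op M1 k f \<in> L2 M2" "L2_norm M2 (int_op M1 k f) \<le> L2_norm (M1 \<Otimes>\<^sub>M M2) k * L2_norm M1 f"
proof -
  let ?s = "\<lambda>y. complex_of_real (L2_norm M1 f) * complex_of_real (L2_norm M1 (\<lambda>x. k (x, y)))"
  have s: "?s \<in> L2 M2" by (rule L2_cmult[OF L2_norm_slice(1)[OF k]])
  have m: "int_op M1 k f \<in> borel_measurable M2"
    by (intro int_op_measurable L2_measurable k f)
  have b: "AE y in M2. norm (int_op M1 k f y) \<le> norm (?s y)"
    using int_op_AE_bound[OF k f] by eventually_elim (simp add: norm_mult mult.commute)
  show "int_op M1 k f \<in> L2 M2"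
    by (rule L2_dominated[OF m s, of 1]) (use b in simp)
  show "L2_norm M2 (int_op M1 k f) \<le> L2_norm (M1 \<Otimes>\<^sub>M M2) k * L2_norm M1 f"
    using L2_norm_mono[OF m s b] unfolding L2_norm_cmult L2_norm_slice(2)[OF k] by (simp add: mult.commute)
qed

lemma int_op_AE_diff:
  assumes k: "k \<in> L2 (M1 \<Otimes>\<^sub>M M2)" and k': "k' \<in> L2 (M1 \<Otimes>\<^sub>M M2)" and f: "f \<in> L2 M1"
  shows "AE y in M2. int_op M1 (\<lambda>z. k z - k' z) f y = int_op M1 k f y - int_op M1 k' f y"
  using L2_slice[OF k] L2_slice[OF k']
proof eventually_elim
  case (elim y)
  show ?case unfolding int_op_def
    using L2_mult_integrable[OF elim(1) f] L2_mult_integrable[OF elim(2) f] by (simp add: left_diff_distrib)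
qed

lemma int_op_AE_add:
  assumes k: "k \<in> L2 (M1 \<Otimes>\<^sub>M M2)" and k': "k' \<in> L2 (M1 \<Otimes>\<^sub>M M2)" and f: "f \<in> L2 M1"
  shows "AE y in M2. int_op M1 (\<lambda>z. k z + k' z) f y = int_op M1 k f y + int_op M1 k' f y"
  using L2_slice[OF k] L2_slice[OF k']
proof eventually_elim
  case (elim y)
  show ?case unfolding int_op_def
    using L2_mult_integrable[OF elim(1) f] L2_mult_integrable[OF elim(2) f] by (simp add: distrib_right)
qed

lemma int_op_cmult: "int_op M1 (\<lambda>z. c * k z) f = (\<lambda>y. c * int_op M1 k f y)"
  unfolding int_op_def by (simp add: mult.assoc)

lemma int_op_bounded [intro]:
  assumes k: "k \<in> L2 (M1 \<Otimes>\<^sub>M M2)"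
  shows "int_op M1 k \<in> bounded_ops M1 M2"
proof (rule bounded_opsI)
  fix f g c assume f: "f \<in> L2 M1"
  show "int_op M1 k f \<in> L2 M2" "L2_norm M2 (int_op M1 k f) \<le> L2_norm (M1 \<Otimes>\<^sub>M M2) k * L2_norm M1 f"
    using int_op_L2[OF k f] by auto
  show "AE y in M2. int_op M1 k (\<lambda>x. c * f x) y = c * int_op M1 k f y"
    by (simp add: int_op_def mult.left_commute)
  assume g: "g \<in> L2 M1"
  show "AE y in M2. int_op M1 k (\<lambda>x. f x + g x) y = int_op M1 k f y + int_op M1 k g y"
    using L2_slice[OF k]
  proof eventually_elim
    case (elim y)
    show ?case unfolding int_op_def
      using L2_mult_integrable[OF elim f] L2_mult_integrable[OF elim g] by (simp add: distrib_left)
  qed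
qed

lemma op_norm_int_op_le: "k \<in> L2 (M1 \<Otimes>\<^sub>M M2) \<Longrightarrow> op_norm M1 M2 (int_op M1 k) \<le> L2_norm (M1 \<Otimes>\<^sub>M M2) k"
  by (intro op_norm_le int_op_L2) auto

text \<open>Bessel's inequality for almost every slice of the kernel, integrated over the slices.\<close>

lemma hilbert_schmidt_bessel:
  assumes k: "k \<in> L2 (M1 \<Otimes>\<^sub>M M2)" and f: "orthonormal_or_zero M1 f"
  shows "(\<Sum>i<n. (L2_norm M2 (int_op M1 k (f i)))\<^sup>2) \<le> (L2_norm (M1 \<Otimes>\<^sub>M M2) k)\<^sup>2"
proof -
  note fi = orthonormal_or_zero_L2[OF f]
  note I = int_op_L2(1)[OF k fi]
  have "(\<Sum>i<n. (L2_norm M2 (int_op M1 k (f i)))\<^sup>2) = (\<integral>y. (\<Sum>i<n. (norm (int_op M1 k (f i) y))\<^sup>2) \<partial>M2)"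
    using L2_integrable[OF I] by (simp add: L2_norm_power2)
  also have "\<dots> \<le> (\<integral>y. (norm (complex_of_real (L2_norm M1 (\<lambda>x. k (x, y)))))\<^sup>2 \<partial>M2)"
  proof (rule integral_mono_AE)
    show "integrable M2 (\<lambda>y. \<Sum>i<n. (norm (int_op M1 k (f i) y))\<^sup>2)"
      using L2_integrable[OF I] by simp
    show "integrable M2 (\<lambda>y. (norm (complex_of_real (L2_norm M1 (\<lambda>x. k (x, y)))))\<^sup>2)"
      by (rule L2_integrable[OF L2_norm_slice(1)[OF k]])
    show "AE y in M2. (\<Sum>i<n. (norm (int_op M1 k (f i) y))\<^sup>2) \<le> (norm (complex_of_real (L2_norm M1 (\<lambda>x. k (x, y)))))\<^sup>2"
      using L2_slice[OF k]
    proof eventually_elim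
      case (elim y)
      show ?case
        using bessel_inequality[OF orthonormal_or_zero_cnj[OF f] elim, of n] by (simp add: L2_inner_def int_op_def)
    qed
  qed
  also have "\<dots> = (L2_norm (M1 \<Otimes>\<^sub>M M2) k)\<^sup>2"
    by (simp only: L2_norm_power2[symmetric] L2_norm_slice(2)[OF k])
  finally show ?thesis .
qed

lemma hilbert_schmidt_null:
  assumes k: "k \<in> L2 (M1 \<Otimes>\<^sub>M M2)" and f: "orthonormal_or_zero M1 f"
  shows "(\<lambda>n. L2_norm M2 (int_op M1 k (f n))) \<longlonglongrightarrow> 0"
proof -
  have "summable (\<lambda>n. (L2_norm M2 (int_op M1 k (f n)))\<^sup>2)"
    using hilbert_schmidt_bessel[OF k f] by (intro summableI_nonneg_bounded) auto
  then have "(\<lambda>n. sqrt ((L2_norm M2 (int_op M1 k (f n)))\<^sup>2)) \<longlonglongrightarrow> sqrt 0"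
    by (intro tendsto_real_sqrt summable_LIMSEQ_zero)
  then show ?thesis by simp
qed

lemma L2_tensor:
  assumes a: "a \<in> L2 M1" and b: "b \<in> L2 M2"
  shows "(\<lambda>z. a (fst z) * b (snd z)) \<in> L2 (M1 \<Otimes>\<^sub>M M2)"
proof (rule L2_I)
  have [measurable]: "a \<in> borel_measurable M1" "b \<in> borel_measurable M2"
    using a b by (auto dest: L2_measurable)
  show "(\<lambda>z. a (fst z) * b (snd z)) \<in> borel_measurable (M1 \<Otimes>\<^sub>M M2)" by measurable
  show "integrable (M1 \<Otimes>\<^sub>M M2) (\<lambda>z. (norm (a (fst z) * b (snd z)))\<^sup>2)"
  proof (rule Fubini_integrable)
    show "integrable M1 (\<lambda>x. \<integral>y. norm ((norm (a (fst (x, y)) * b (snd (x, y))))\<^sup>2) \<partial>M2)"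
      using L2_integrable[OF a] by (simp add: norm_mult power_mult_distrib)
    show "AE x in M1. integrable M2 (\<lambda>y. (norm (a (fst (x, y)) * b (snd (x, y))))\<^sup>2)"
      using L2_integrable[OF b] by (simp add: norm_mult power_mult_distrib)
  qed measurable
qed

lemma L2_tensor_kernel:
  assumes "\<And>i. a i \<in> L2 M1" "\<And>i. b i \<in> L2 M2"
  shows "tensor_kernel n a b \<in> L2 (M1 \<Otimes>\<^sub>M M2)"
  unfolding tensor_kernel_def by (intro L2_sum L2_tensor assms)

lemma int_op_tensor_kernel:
  assumes "\<And>i. a i \<in> L2 M1" "u \<in> L2 M1"
  shows "int_op M1 (tensor_kernel n a b) u = (\<lambda>y. \<Sum>i<n. (\<integral>x. a i x * u x \<partial>M1) * b i y)"
proof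
  fix y
  have "int_op M1 (tensor_kernel n a b) u y = (\<integral>x. (\<Sum>i<n. a i x * u x * b i y) \<partial>M1)"
    unfolding int_op_def tensor_kernel_def by (simp add: sum_distrib_right sum_distrib_left mult_ac)
  also have "\<dots> = (\<Sum>i<n. (\<integral>x. a i x * u x * b i y \<partial>M1))"
    using L2_mult_integrable[OF assms] by simp
  finally show "int_op M1 (tensor_kernel n a b) u y = (\<Sum>i<n. (\<integral>x. a i x * u x \<partial>M1) * b i y)" by simp
qed

lemma integral_tensor:
  assumes h: "h \<in> L2 (M1 \<Otimes>\<^sub>M M2)" and a: "a \<in> L2 M1" and b: "b \<in> L2 M2"
  shows "(\<integral>z. h z * (a (fst z) * b (snd z)) \<partial>(M1 \<Otimes>\<^sub>M M2)) = (\<integral>y. int_op M1 h a y * b y \<partial>M2)"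
proof -
  have i: "integrable (M1 \<Otimes>\<^sub>M M2) (case_prod (\<lambda>x y. h (x, y) * (a x * b y)))"
    using L2_mult_integrable[OF h L2_tensor[OF a b]] by (simp add: case_prod_unfold)
  have "(\<integral>z. h z * (a (fst z) * b (snd z)) \<partial>(M1 \<Otimes>\<^sub>M M2)) = (\<integral>y. (\<integral>x. h (x, y) * (a x * b y) \<partial>M1) \<partial>M2)"
    using integral_snd[OF i] by (simp add: case_prod_unfold)
  then show ?thesis by (simp add: int_op_def mult.assoc[symmetric])
qed

text \<open>An operator that tends to zero along orthonormal sequences is approximated by
  finite rank operators: compressing it to the span of the first terms of a greedy sequence leaves
  a remainder that the next term of the sequence controls.\<close>

lemma approx_by_tensor_kernel:
  assumes T: "T \<in> bounded_ops M1 M2"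
    and null: "\<And>f. orthonormal_or_zero M1 f \<Longrightarrow> (\<lambda>n. L2_norm M2 (T (f n))) \<longlonglongrightarrow> 0"
    and e: "0 < e"
  obtains n a b where "\<And>i. a i \<in> L2 M1" "\<And>i. b i \<in> L2 M2"
    "op_norm M1 M2 (\<lambda>f y. T f y - int_op M1 (tensor_kernel n a b) f y) < e"
proof -
  obtain f where f: "greedy_seq M1 M2 T 2 f" using half_greedy_seq_exists[OF T] by blast
  note o = greedy_seqD(1)[OF f]
  note fi = orthonormal_or_zero_L2[OF o]
  obtain n where n: "L2_norm M2 (T (f n)) < e / 4"
    using LIMSEQ_D[OF null[OF o], of "e / 4"] e by (auto simp: abs_less_iff)
  show thesis
  proof
    show ai: "(\<lambda>x. cnj (f i x)) \<in> L2 M1" for i using fi by blast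
    show "T (f i) \<in> L2 M2" for i by (rule bounded_ops_L2[OF T fi])
    have "op_norm M1 M2 (\<lambda>u y. T u y - int_op M1 (tensor_kernel n (\<lambda>i x. cnj (f i x)) (\<lambda>i. T (f i))) u y) \<le> e / 2"
    proof (rule op_norm_le)
      fix u assume u: "u \<in> L2 M1"
      have "(\<integral>x. cnj (f i x) * u x \<partial>M1) = L2_inner M1 u (f i)" for i
        by (simp add: L2_inner_def mult.commute)
      then have "L2_norm M2 (\<lambda>y. T u y - int_op M1 (tensor_kernel n (\<lambda>i x. cnj (f i x)) (\<lambda>i. T (f i))) u y)
          \<le> 2 * L2_norm M2 (T (f n)) * L2_norm M1 u"
        using greedy_seq_residual[OF T f u, of n] by (simp add: int_op_tensor_kernel[OF ai u])
      also have "\<dots> \<le> e / 2 * L2_norm M1 u" using n by (intro mult_right_mono) auto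
      finally show "L2_norm M2 (\<lambda>y. T u y - int_op M1 (tensor_kernel n (\<lambda>i x. cnj (f i x)) (\<lambda>i. T (f i))) u y)
          \<le> e / 2 * L2_norm M1 u" .
    qed (use e in simp)
    then show "op_norm M1 M2 (\<lambda>u y. T u y - int_op M1 (tensor_kernel n (\<lambda>i x. cnj (f i x)) (\<lambda>i. T (f i))) u y) < e"
      using e by simp
  qed
qed

end

section \<open>Compactness\<close>

lemma compact_ops_bounded: "T \<in> compact_ops M N \<Longrightarrow> T \<in> bounded_ops M N"
  by (simp add: compact_ops_def)

lemma compact_opsD:
  assumes T: "T \<in> compact_ops M N" and u: "\<And>n::nat. u n \<in> L2 M" "\<And>n. L2_norm M (u n) \<le> 1"
  obtains r :: "nat \<Rightarrow> nat" and g where "strict_mono r" "g \<in> L2 N" "(\<lambda>n. L2_norm N (\<lambda>y. T (u (r n)) y - g y)) \<longlonglongrightarrow> 0"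
proof -
  have "(\<forall>n. u n \<in> L2 M \<and> L2_norm M (u n) \<le> 1) \<longrightarrow> (\<exists>r g. strict_mono r \<and> g \<in> L2 N \<and>
      (\<lambda>n. L2_norm N (\<lambda>y. T (u (r n)) y - g y)) \<longlonglongrightarrow> 0)"
    using T unfolding compact_ops_def mem_Collect_eq by (elim conjE allE)
  then show thesis using u that by blast
qed

text \<open>Suppose that the images of an orthonormal sequence stay away from zero.  A subsequence of the
  images is nearly constant, so its averages stay away from zero as well, whereas the averages of
  \<open>J\<close> orthonormal vectors have norm \<open>1 / sqrt J\<close>.\<close>

lemma compact_ops_null:
  assumes T: "T \<in> compact_ops M N" and f: "orthonormal_or_zero M f"
  shows "(\<lambda>n. L2_norm N (T (f n))) \<longlonglongrightarrow> 0"
proof (rule ccontr)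
  note TB = compact_ops_bounded[OF T]
  assume "\<not> (\<lambda>n. L2_norm N (T (f n))) \<longlonglongrightarrow> 0"
  then obtain e where e: "0 < e" "\<And>K. \<exists>n\<ge>K. e \<le> L2_norm N (T (f n))"
    unfolding LIMSEQ_iff by (auto simp: not_less)
  then have "infinite {n. e \<le> L2_norm N (T (f n))}"
    unfolding infinite_nat_iff_unbounded_le by auto
  then obtain s :: "nat \<Rightarrow> nat" where s: "strict_mono s" "\<And>n. e \<le> L2_norm N (T (f (s n)))"
    using infinite_enumerate[of "{n. e \<le> L2_norm N (T (f n))}"] by auto
  obtain r g where r: "strict_mono r" "g \<in> L2 N" "(\<lambda>n. L2_norm N (\<lambda>y. T (f (s (r n))) y - g y)) \<longlonglongrightarrow> 0"
    by (rule compact_opsD[OF T orthonormal_or_zero_L2[OF f] orthonormal_or_zero_norm_le[OF f]])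
  define w where "w n = f (s (r n))" for n
  have w: "w n \<in> L2 M" for n unfolding w_def by (rule orthonormal_or_zero_L2[OF f])
  have Tw: "T (w n) \<in> L2 N" for n by (rule bounded_ops_L2[OF TB w])
  have wo: "L2_inner M (w i) (w j) = 0" if "i \<noteq> j" for i j
    unfolding w_def using orthonormal_or_zero_inner[OF f] that s(1) r(1) by (simp add: strict_mono_eq)
  have wn: "L2_norm M (w i) \<le> 1" for i unfolding w_def by (rule orthonormal_or_zero_norm_le[OF f])
  obtain K where K: "\<And>n. n \<ge> K \<Longrightarrow> L2_norm N (\<lambda>y. T (w n) y - g y) < e / 4"
    using LIMSEQ_D[OF r(3), of "e / 4"] e(1) by (auto simp: w_def)
  have close: "L2_norm N (\<lambda>y. T (w (K + j)) y - T (w K) y) \<le> e / 2" for j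
    using L2_norm_triangle_mid[OF Tw r(2) Tw, of "K + j" K] K[of "K + j"] K[of K]
      L2_norm_minus_commute[of N "T (w K)" g] by simp
  have bound: "(e / 2)\<^sup>2 * real J \<le> (op_norm M N T)\<^sup>2" if J: "0 < J" for J :: nat
  proof -
    \<comment> \<open>the average of \<open>J\<close> vectors, whose image is still close to the image of \<open>w K\<close>\<close>
    define c where "c = complex_of_real (1 / J)"
    let ?A = "\<lambda>x. \<Sum>j<J. c * w (K + j) x"
    have A: "?A \<in> L2 M" by (intro L2_sum L2_cmult w)
    have "(L2_norm M ?A)\<^sup>2 = (\<Sum>j<J. (norm c)\<^sup>2 * (L2_norm M (w (K + j)))\<^sup>2)"
      by (rule orthogonal_sum_norm) (auto simp: wo w)
    also have "\<dots> \<le> (\<Sum>j<J. (norm c)\<^sup>2 * 1)"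
      using wn by (intro sum_mono mult_left_mono power_le_one) auto
    also have "\<dots> = 1 / J" using J by (simp add: c_def norm_divide power2_eq_square)
    finally have An: "(L2_norm M ?A)\<^sup>2 \<le> 1 / J" .
    have c1: "of_nat J * c = 1" using J by (simp add: c_def)
    have TA: "T ?A \<in> L2 N" by (rule bounded_ops_L2[OF TB A])
    have "L2_norm N (\<lambda>y. T ?A y - T (w K) y) = L2_norm N (\<lambda>y. \<Sum>j<J. c * (T (w (K + j)) y - T (w K) y))"
    proof (rule L2_norm_cong_AE)
      show "AE y in N. T ?A y - T (w K) y = (\<Sum>j<J. c * (T (w (K + j)) y - T (w K) y))"
        using bounded_ops_sum[OF TB, of "{..<J}" "\<lambda>j. w (K + j)" "\<lambda>_. c", OF w]
        by eventually_elim (simp add: right_diff_distrib sum_subtractf c1 mult.assoc[symmetric])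
    qed (intro L2_measurable L2_diff L2_sum L2_cmult TA Tw)+
    also have "\<dots> \<le> (\<Sum>j<J. L2_norm N (\<lambda>y. c * (T (w (K + j)) y - T (w K) y)))"
      by (intro L2_norm_sum L2_cmult L2_diff Tw)
    also have "\<dots> \<le> (\<Sum>j<J. norm c * (e / 2))"
      unfolding L2_norm_cmult by (intro sum_mono mult_left_mono close) simp
    also have "\<dots> = e / 2" using J by (simp add: c_def norm_divide)
    finally have "L2_norm N (T (w K)) - e / 2 \<le> L2_norm N (T ?A)"
      using L2_norm_triangle_rev[OF TA Tw, of K] by simp
    moreover have "e \<le> L2_norm N (T (w K))" using s(2) by (simp add: w_def)
    ultimately have "e / 2 \<le> L2_norm N (T ?A)" by simp
    also have "\<dots> \<le> op_norm M N T * L2_norm M ?A" by (rule op_norm_bound[OF TB A])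
    finally have "(e / 2)\<^sup>2 \<le> (op_norm M N T * L2_norm M ?A)\<^sup>2" using e(1) by (intro power_mono) auto
    also have "\<dots> \<le> (op_norm M N T)\<^sup>2 * (1 / J)"
      unfolding power_mult_distrib using An by (intro mult_left_mono) auto
    finally show ?thesis using J by (simp add: field_simps)
  qed
  obtain J :: nat where "(op_norm M N T)\<^sup>2 / (e / 2)\<^sup>2 < J" using reals_Archimedean2 by blast
  then have "(op_norm M N T)\<^sup>2 < (e / 2)\<^sup>2 * J" using e(1) by (simp add: field_simps)
  moreover from this have "0 < J" using e(1) by (cases J) auto
  ultimately show False using bound[of J] by simp
qed

lemma diagonal_subsequence:
  fixes c :: "nat \<Rightarrow> nat \<Rightarrow> complex"
  assumes bdd: "\<And>i n. norm (c i n) \<le> 1"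
  obtains r :: "nat \<Rightarrow> nat" where "strict_mono r" "\<And>i. convergent (\<lambda>n. c i (r n))"
proof -
  interpret subseqs "\<lambda>i s. convergent (\<lambda>n. c i (s n))"
  proof
    fix i and s :: "nat \<Rightarrow> nat" assume "strict_mono s"
    have "bounded (range (\<lambda>n. c i (s n)))" using bdd by (auto simp: bounded_iff)
    then obtain l r where "strict_mono r" "((\<lambda>n. c i (s n)) \<circ> r) \<longlonglongrightarrow> l"
      using bounded_imp_convergent_subsequence by blast
    then show "\<exists>r. strict_mono r \<and> convergent (\<lambda>n. c i ((s \<circ> r) n))"
      by (auto simp: convergent_def comp_def)
  qed
  have "convergent (\<lambda>n. c i (diagseq n))" for i
  proof -
    have "convergent (\<lambda>n. c i ((diagseq \<circ> ((+) (Suc i))) n))"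
    proof (rule diagseq_holds)
      fix r s :: "nat \<Rightarrow> nat" and n
      assume "strict_mono r" "convergent (\<lambda>k. c n (s k))"
      then show "convergent (\<lambda>k. c n ((s \<circ> r) k))"
        using convergent_subseq_convergent[of "\<lambda>k. c n (s k)" r] by (simp add: comp_def)
    qed
    then show ?thesis using convergent_ignore_initial_segment[of "\<lambda>n. c i (diagseq n)" "Suc i"]
      by (simp add: comp_def add.commute)
  qed
  then show thesis using that subseq_diagseq by blast
qed

text \<open>A greedy sequence reduces the claim to finitely many coordinates at a time, up to a small error, and
  along a diagonal subsequence all coordinates converge.\<close>

lemma null_imp_precompact:
  assumes T: "T \<in> bounded_ops M N"
    and null: "\<And>f. orthonormal_or_zero M f \<Longrightarrow> (\<lambda>n. L2_norm N (T (f n))) \<longlonglongrightarrow> 0"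
    and u: "\<And>n::nat. u n \<in> L2 M" "\<And>n. L2_norm M (u n) \<le> 1"
  obtains r :: "nat \<Rightarrow> nat" where "strict_mono r"
    "\<And>e. 0 < e \<Longrightarrow> \<exists>K. \<forall>m\<ge>K. \<forall>n\<ge>K. L2_norm N (\<lambda>y. T (u (r m)) y - T (u (r n)) y) < e"
proof -
  obtain f where f: "greedy_seq M N T 2 f" using half_greedy_seq_exists[OF T] by blast
  note o = greedy_seqD(1)[OF f]
  note fi = orthonormal_or_zero_L2[OF o]
  have "norm (L2_inner M (u n) (f i)) \<le> 1" for i n
    using L2_cauchy_schwarz[OF u(1) fi, of n i] mult_le_one[OF u(2)[of n] L2_norm_nonneg orthonormal_or_zero_norm_le[OF o, of i]] by simp
  then obtain r :: "nat \<Rightarrow> nat" where r: "strict_mono r" "\<And>i. convergent (\<lambda>n. L2_inner M (u (r n)) (f i))"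
    by (rule diagonal_subsequence[where c="\<lambda>i n. L2_inner M (u n) (f i)"]) blast
  show thesis
  proof (rule that[OF r(1)])
    fix e :: real assume e: "0 < e"
    obtain p where p: "L2_norm N (T (f p)) < e / 8"
      using LIMSEQ_D[OF null[OF o], of "e / 8"] e by (auto simp: abs_less_iff)
    define B where "B = (\<Sum>i<p. L2_norm N (T (f i))) + 1"
    have B: "0 < B" unfolding B_def by (simp add: sum_nonneg add_nonneg_pos)
    have "\<exists>K. \<forall>m\<ge>K. \<forall>n\<ge>K. norm (L2_inner M (u (r m)) (f i) - L2_inner M (u (r n)) (f i)) < e / (4 * B)" for i
      using convergent_Cauchy[OF r(2)[of i], unfolded Cauchy_iff] e B by simp
    then obtain K where K: "\<And>i m n. m \<ge> K i \<Longrightarrow> n \<ge> K i \<Longrightarrow> norm (L2_inner M (u (r m)) (f i) - L2_inner M (u (r n)) (f i)) < e / (4 * B)"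
      by metis
    have "L2_norm N (\<lambda>y. T (u (r m)) y - T (u (r n)) y) < e" if mn: "m \<ge> (\<Sum>i<p. K i)" "n \<ge> (\<Sum>i<p. K i)" for m n
    proof -
      let ?v = "\<lambda>x. u (r m) x - u (r n) x"
      have v: "?v \<in> L2 M" using u(1) by blast
      have vn: "L2_norm M ?v \<le> 2" using L2_norm_triangle_diff[OF u(1) u(1), of "r m" "r n"] u(2)[of "r m"] u(2)[of "r n"] by simp
      let ?s = "\<lambda>y. \<Sum>i<p. L2_inner M ?v (f i) * T (f i) y"
      have s: "?s \<in> L2 N" by (intro L2_sum L2_cmult bounded_ops_L2[OF T fi])
      have "L2_norm N (\<lambda>y. T (u (r m)) y - T (u (r n)) y) = L2_norm N (T ?v)"
        by (rule L2_norm_bounded_ops_diff[OF T u(1) u(1)])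
      also have "\<dots> \<le> L2_norm N (\<lambda>y. T ?v y - ?s y) + L2_norm N ?s"
        using L2_norm_triangle[OF L2_diff[OF bounded_ops_L2[OF T v] s] s] by simp
      also have "L2_norm N (\<lambda>y. T ?v y - ?s y) \<le> 2 * L2_norm N (T (f p)) * L2_norm M ?v"
        by (rule greedy_seq_residual[OF T f v]) simp
      also have "\<dots> \<le> 2 * L2_norm N (T (f p)) * 2" by (intro mult_left_mono vn) simp
      also have "2 * L2_norm N (T (f p)) * 2 < e / 2" using p by simp
      also have "L2_norm N ?s \<le> (\<Sum>i<p. e / (4 * B) * L2_norm N (T (f i)))"
      proof (rule order_trans[OF L2_norm_sum sum_mono])
        fix i assume i: "i \<in> {..<p}"
        show "(\<lambda>y. L2_inner M ?v (f i) * T (f i) y) \<in> L2 N" by (intro L2_cmult bounded_ops_L2[OF T fi])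
        have "K i \<le> (\<Sum>i<p. K i)" using i by (intro member_le_sum) auto
        then have "norm (L2_inner M ?v (f i)) \<le> e / (4 * B)"
          using K[of i m n] mn by (simp add: L2_inner_diff_left[OF u(1) u(1) fi])
        then show "L2_norm N (\<lambda>y. L2_inner M ?v (f i) * T (f i) y) \<le> e / (4 * B) * L2_norm N (T (f i))"
          unfolding L2_norm_cmult by (intro mult_right_mono) auto
      qed
      also have "\<dots> = e / (4 * B) * (B - 1)" by (simp add: B_def sum_distrib_left)
      also have "\<dots> \<le> e / 4" using B e by (simp add: field_simps)
      finally show ?thesis using e by simp
    qed
    then show "\<exists>K. \<forall>m\<ge>K. \<forall>n\<ge>K. L2_norm N (\<lambda>y. T (u (r m)) y - T (u (r n)) y) < e" by blast
  qed
qed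

section \<open>The pairing with trace class operators\<close>

lemma trace_classD:
  assumes "\<tau> \<in> trace_class M N"
  shows "fst \<tau> i \<in> L2 M" "snd \<tau> i \<in> L2 N"
    "summable (\<lambda>i. (L2_norm M (fst \<tau> i))\<^sup>2)" "summable (\<lambda>i. (L2_norm N (snd \<tau> i))\<^sup>2)"
  using assms by (auto simp: trace_class_def case_prod_unfold)

text \<open>An upper bound of the trace norm, namely the one that the given representation as a series provides.\<close>

definition trace_bound :: "'a measure \<Rightarrow> 'b measure \<Rightarrow> (nat \<Rightarrow> 'a \<Rightarrow> complex) \<times> (nat \<Rightarrow> 'b \<Rightarrow> complex) \<Rightarrow> real" where
  "trace_bound M N \<tau> = (\<Sum>i. L2_norm M (fst \<tau> i) * L2_norm N (snd \<tau> i))"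

lemma trace_bound_summable:
  assumes "\<tau> \<in> trace_class M N"
  shows "summable (\<lambda>i. L2_norm M (fst \<tau> i) * L2_norm N (snd \<tau> i))"
proof (rule summable_comparison_test')
  show "summable (\<lambda>i. (L2_norm M (fst \<tau> i))\<^sup>2 + (L2_norm N (snd \<tau> i))\<^sup>2)"
    using trace_classD[OF assms] by (intro summable_add)
  fix i :: nat
  show "norm (L2_norm M (fst \<tau> i) * L2_norm N (snd \<tau> i)) \<le> (L2_norm M (fst \<tau> i))\<^sup>2 + (L2_norm N (snd \<tau> i))\<^sup>2"
    (is "norm (?a * ?b) \<le> _")
  proof -
    have "2 * (?a * ?b) \<le> ?a\<^sup>2 + ?b\<^sup>2" using sum_squares_bound[of ?a ?b] by (simp add: mult.assoc)
    moreover have "0 \<le> ?a * ?b" by simp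
    ultimately show ?thesis unfolding real_norm_def by linarith
  qed
qed

lemma trace_bound_nonneg: "\<tau> \<in> trace_class M N \<Longrightarrow> 0 \<le> trace_bound M N \<tau>"
  unfolding trace_bound_def by (intro suminf_nonneg trace_bound_summable) auto

lemma trace_pairing_term_bound:
  assumes T: "T \<in> bounded_ops M N" and \<tau>: "\<tau> \<in> trace_class M N"
  shows "norm (\<integral>y. T (fst \<tau> i) y * snd \<tau> i y \<partial>N) \<le> op_norm M N T * (L2_norm M (fst \<tau> i) * L2_norm N (snd \<tau> i))"
proof -
  have "norm (\<integral>y. T (fst \<tau> i) y * snd \<tau> i y \<partial>N) \<le> L2_norm N (T (fst \<tau> i)) * L2_norm N (snd \<tau> i)"
    by (intro L2_cauchy_schwarz_mult bounded_ops_L2[OF T] trace_classD[OF \<tau>])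
  also have "\<dots> \<le> op_norm M N T * L2_norm M (fst \<tau> i) * L2_norm N (snd \<tau> i)"
    by (intro mult_right_mono op_norm_bound[OF T] trace_classD[OF \<tau>]) simp
  finally show ?thesis by (simp add: mult.assoc)
qed

lemma trace_pairing_summable:
  assumes T: "T \<in> bounded_ops M N" and \<tau>: "\<tau> \<in> trace_class M N"
  shows "summable (\<lambda>i. norm (\<integral>y. T (fst \<tau> i) y * snd \<tau> i y \<partial>N))"
  by (rule summable_comparison_test'[OF summable_mult[OF trace_bound_summable[OF \<tau>]]])
    (use trace_pairing_term_bound[OF assms] in simp)

lemma trace_pairing_bound:
  assumes T: "T \<in> bounded_ops M N" and \<tau>: "\<tau> \<in> trace_class M N"
  shows "norm (trace_pairing N T \<tau>) \<le> op_norm M N T * trace_bound M N \<tau>"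
proof -
  have "norm (trace_pairing N T \<tau>) \<le> (\<Sum>i. norm (\<integral>y. T (fst \<tau> i) y * snd \<tau> i y \<partial>N))"
    unfolding trace_pairing_def by (rule summable_norm[OF trace_pairing_summable[OF assms]])
  also have "\<dots> \<le> (\<Sum>i. op_norm M N T * (L2_norm M (fst \<tau> i) * L2_norm N (snd \<tau> i)))"
    by (intro suminf_le trace_pairing_term_bound[OF assms] trace_pairing_summable[OF assms] summable_mult trace_bound_summable[OF \<tau>])
  also have "\<dots> = op_norm M N T * trace_bound M N \<tau>"
    unfolding trace_bound_def by (rule suminf_mult[OF trace_bound_summable[OF \<tau>]])
  finally show ?thesis .
qed

lemma trace_pairing_diff:
  assumes S: "S \<in> bounded_ops M N" and T: "T \<in> bounded_ops M N" and \<tau>: "\<tau> \<in> trace_class M N"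
  shows "trace_pairing N (\<lambda>f y. S f y - T f y) \<tau> = trace_pairing N S \<tau> - trace_pairing N T \<tau>"
proof -
  have "(\<integral>y. (S (fst \<tau> i) y - T (fst \<tau> i) y) * snd \<tau> i y \<partial>N) =
      (\<integral>y. S (fst \<tau> i) y * snd \<tau> i y \<partial>N) - (\<integral>y. T (fst \<tau> i) y * snd \<tau> i y \<partial>N)" for i
  proof -
    have "integrable N (\<lambda>y. S (fst \<tau> i) y * snd \<tau> i y)" "integrable N (\<lambda>y. T (fst \<tau> i) y * snd \<tau> i y)"
      by (intro L2_mult_integrable bounded_ops_L2[OF S] bounded_ops_L2[OF T] trace_classD[OF \<tau>])+
    then show ?thesis by (simp add: left_diff_distrib)
  qed
  then show ?thesis
    unfolding trace_pairing_def
    by (simp add: suminf_diff[OF summable_norm_cancel[OF trace_pairing_summable[OF S \<tau>]]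
          summable_norm_cancel[OF trace_pairing_summable[OF T \<tau>]]])
qed

lemma trace_pairing_diff_bound:
  assumes "S \<in> bounded_ops M N" "T \<in> bounded_ops M N" "\<tau> \<in> trace_class M N"
  shows "norm (trace_pairing N S \<tau> - trace_pairing N T \<tau>) \<le> op_norm M N (\<lambda>f y. S f y - T f y) * trace_bound M N \<tau>"
  using trace_pairing_bound[OF bounded_ops_op_diff[OF assms(1,2)] assms(3)] trace_pairing_diff[OF assms] by simp

lemma op_eq_trace_pairing:
  assumes S: "S \<in> bounded_ops M N" and T: "T \<in> bounded_ops M N" and \<tau>: "\<tau> \<in> trace_class M N" and eq: "op_eq M N S T"
  shows "trace_pairing N S \<tau> = trace_pairing N T \<tau>"
proof -
  have "(\<integral>y. S (fst \<tau> i) y * snd \<tau> i y \<partial>N) = (\<integral>y. T (fst \<tau> i) y * snd \<tau> i y \<partial>N)" for i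
  proof (rule integral_cong_AE)
    show "AE y in N. S (fst \<tau> i) y * snd \<tau> i y = T (fst \<tau> i) y * snd \<tau> i y"
      using eq trace_classD(1)[OF \<tau>, of i] unfolding op_eq_def by (auto elim: eventually_mono)
  qed (intro borel_measurable_times L2_measurable bounded_ops_L2[OF S] bounded_ops_L2[OF T] trace_classD[OF \<tau>])+
  then show ?thesis by (simp add: trace_pairing_def)
qed

lemma op_norm_cong:
  assumes S: "S \<in> bounded_ops M N" and T: "T \<in> bounded_ops M N" and eq: "op_eq M N S T"
  shows "op_norm M N S = op_norm M N T"
  unfolding op_norm_def
proof (rule SUP_cong)
  fix f assume "f \<in> {f \<in> L2 M. L2_norm M f \<le> 1}"
  then have f: "f \<in> L2 M" by simp
  show "L2_norm N (S f) = L2_norm N (T f)"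
    by (rule L2_norm_cong_AE) (use eq f bounded_ops_L2[OF S f] bounded_ops_L2[OF T f] in \<open>simp_all add: op_eq_def L2_measurable\<close>)
qed simp


section \<open>Singular values\<close>

text \<open>Along a maximising sequence whose images converge, sums of late terms have almost maximal images, hence
  almost maximal norm; by the parallelogram law the sequence itself converges.\<close>

lemma singular_vector_on_complement:
  assumes T: "T \<in> bounded_ops M N"
    and null: "\<And>f. orthonormal_or_zero M f \<Longrightarrow> (\<lambda>n. L2_norm N (T (f n))) \<longlonglongrightarrow> 0"
    and fi: "\<And>i. i < n \<Longrightarrow> f i \<in> L2 M"
  shows "\<exists>r\<in>L2 M. (L2_norm M r = 0 \<or> L2_norm M r = 1) \<and> (\<forall>i<(n::nat). L2_inner M r (f i) = 0) \<and>
      (\<forall>u\<in>L2 M. (\<forall>i<n. L2_inner M u (f i) = 0) \<longrightarrow> L2_norm N (T u) \<le> 1 * L2_norm N (T r) * L2_norm M u)"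
proof -
  let ?E = "\<lambda>u. \<forall>i<n. L2_inner M u (f i) = 0"
  obtain s where s0: "0 \<le> s" and s_le: "\<And>u. u \<in> L2 M \<Longrightarrow> ?E u \<Longrightarrow> L2_norm N (T u) \<le> s * L2_norm M u"
    and s_sup: "\<And>t. t < s \<Longrightarrow> \<exists>u\<in>L2 M. ?E u \<and> L2_norm M u \<le> 1 \<and> t < L2_norm N (T u)"
    by (rule norm_on_complement[OF T, of n f]) blast
  show ?thesis
  proof (cases "s = 0")
    case True
    show ?thesis
    proof (intro bexI conjI ballI impI)
      fix u assume "u \<in> L2 M" "?E u"
      then have "L2_norm N (T u) \<le> 0" using s_le[of u] True by simp
      then show "L2_norm N (T u) \<le> 1 * L2_norm N (T (\<lambda>x. 0)) * L2_norm M u"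
        by (rule order_trans) simp
    qed (auto simp: L2_inner_def)
  next
    case False
    then have s: "0 < s" using s0 by simp
    have "\<exists>u::nat \<Rightarrow> _. \<forall>m. u m \<in> L2 M \<and> ?E (u m) \<and> L2_norm M (u m) \<le> 1 \<and> s * (1 - 1 / (real m + 2)) < L2_norm N (T (u m))"
    proof (intro choice allI)
      fix m :: nat
      have "s * (1 - 1 / (real m + 2)) < s * 1" using s by (intro mult_strict_left_mono) auto
      then show "\<exists>u. u \<in> L2 M \<and> ?E u \<and> L2_norm M u \<le> 1 \<and> s * (1 - 1 / (real m + 2)) < L2_norm N (T u)"
        using s_sup[of "s * (1 - 1 / (real m + 2))"] by auto
    qed
    then obtain u where u: "\<And>m::nat. u m \<in> L2 M" "\<And>m. ?E (u m)" "\<And>m. L2_norm M (u m) \<le> 1"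
      "\<And>m. s * (1 - 1 / (real m + 2)) < L2_norm N (T (u m))" by blast
    obtain r :: "nat \<Rightarrow> nat" where r: "strict_mono r"
      "\<And>e. 0 < e \<Longrightarrow> \<exists>K. \<forall>i\<ge>K. \<forall>j\<ge>K. L2_norm N (\<lambda>y. T (u (r i)) y - T (u (r j)) y) < e"
      by (rule null_imp_precompact[where u = u, OF T null u(1,3)]) blast+
    define w where "w i = u (r i)" for i
    have w: "w i \<in> L2 M" and wE: "?E (w i)" and w1: "L2_norm M (w i) \<le> 1" for i
      using u unfolding w_def by blast+
    have Tw: "T (w i) \<in> L2 N" for i by (rule bounded_ops_L2[OF T w])
    have sw: "s * (1 - 1 / (real i + 2)) < L2_norm N (T (w i))" for i
    proof -
      have "1 / (real (r i) + 2) \<le> 1 / (real i + 2)"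
        using seq_suble[OF r(1), of i] by (intro divide_left_mono) auto
      then have "s * (1 - 1 / (real i + 2)) \<le> s * (1 - 1 / (real (r i) + 2))" using s by (intro mult_left_mono) auto
      then show ?thesis using u(4)[of "r i"] unfolding w_def by simp
    qed
    have "\<exists>K. \<forall>i\<ge>K. \<forall>j\<ge>K. L2_norm M (\<lambda>x. w i x - w j x) < e" if e: "0 < e" for e
    proof -
      define \<eta> where "\<eta> = min 1 (e\<^sup>2 / 8)"
      have \<eta>: "0 < \<eta>" "\<eta> \<le> 1" "4 * \<eta> < e\<^sup>2" using e by (auto simp: \<eta>_def min_def)
      obtain K1 where K1: "\<And>i j. i \<ge> K1 \<Longrightarrow> j \<ge> K1 \<Longrightarrow> L2_norm N (\<lambda>y. T (w i) y - T (w j) y) < s * \<eta> / 2"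
        using r(2)[of "s * \<eta> / 2"] s \<eta> unfolding w_def by auto
      obtain K2 :: nat where K2: "4 / \<eta> < K2" using reals_Archimedean2 by blast
      have "L2_norm M (\<lambda>x. w i x - w j x) < e" if ij: "i \<ge> max K1 K2" "j \<ge> max K1 K2" for i j
      proof -
        have "4 / \<eta> < real i + 2" using K2 ij(1) by simp
        then have i2: "2 / (real i + 2) \<le> \<eta> / 2" using \<eta> by (simp add: field_simps)
        let ?p = "\<lambda>x. w i x + w j x"
        have p: "?p \<in> L2 M" by (intro L2_add w)
        have "2 * L2_norm N (T (w i)) = L2_norm N (\<lambda>y. 2 * T (w i) y)" unfolding L2_norm_cmult by simp
        also have "\<dots> \<le> L2_norm N (\<lambda>y. T (w i) y + T (w j) y) + L2_norm N (\<lambda>y. T (w i) y - T (w j) y)"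
        proof -
          have "(\<lambda>y. 2 * T (w i) y) = (\<lambda>y. (T (w i) y + T (w j) y) + (T (w i) y - T (w j) y))" by auto
          then show ?thesis using L2_norm_triangle[OF L2_add[OF Tw Tw] L2_diff[OF Tw Tw], of i j i j] by simp
        qed
        also have "L2_norm N (\<lambda>y. T (w i) y + T (w j) y) = L2_norm N (T ?p)"
        proof (rule L2_norm_cong_AE)
          show "AE y in N. T (w i) y + T (w j) y = T ?p y"
            using bounded_ops_add[OF T w w, of i j] by eventually_elim simp
        qed (intro L2_measurable L2_add Tw bounded_ops_L2[OF T p])+
        also have "\<dots> \<le> s * L2_norm M ?p"
          by (rule s_le[OF p]) (use wE L2_inner_add_left[OF w w fi] in simp)
        finally have "2 * L2_norm N (T (w i)) - s * \<eta> / 2 \<le> s * L2_norm M ?p"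
          using K1[of i j] ij by simp
        moreover have "s * (2 - \<eta> / 2) \<le> 2 * L2_norm N (T (w i))"
        proof -
          have "s * (2 - \<eta> / 2) \<le> s * (2 - 2 / (real i + 2))" using i2 s by (intro mult_left_mono) auto
          also have "\<dots> = 2 * (s * (1 - 1 / (real i + 2)))" by (simp add: algebra_simps)
          also have "\<dots> \<le> 2 * L2_norm N (T (w i))" using sw[of i] by simp
          finally show ?thesis .
        qed
        ultimately have "s * (2 - \<eta>) \<le> s * L2_norm M ?p" by (simp add: algebra_simps)
        then have "2 - \<eta> \<le> L2_norm M ?p" using s by simp
        then have "(2 - \<eta>)\<^sup>2 \<le> (L2_norm M ?p)\<^sup>2" using \<eta> by (intro power_mono) auto
        moreover have "(L2_norm M (w i))\<^sup>2 \<le> 1" "(L2_norm M (w j))\<^sup>2 \<le> 1"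
          using w1 by (auto intro: power_le_one)
        ultimately have "(L2_norm M (\<lambda>x. w i x - w j x))\<^sup>2 \<le> 4 - (2 - \<eta>)\<^sup>2"
          using L2_parallelogram[OF w w, of i j] by simp
        also have "\<dots> \<le> 4 * \<eta>" by (simp add: power2_eq_square algebra_simps)
        also have "\<dots> < e\<^sup>2" by (rule \<eta>)
        finally show ?thesis using e by (auto intro: power2_less_imp_less)
      qed
      then show ?thesis by blast
    qed
    then obtain g where g: "g \<in> L2 M" "(\<lambda>i. L2_norm M (\<lambda>x. w i x - g x)) \<longlonglongrightarrow> 0"
      by (rule L2_complete[OF w])
    have gE: "?E g"
    proof (intro allI impI)
      fix l assume l: "l < n"
      have "(\<lambda>i. L2_inner M (w i) (f l)) \<longlonglongrightarrow> L2_inner M g (f l)"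
        by (rule L2_inner_tendsto[OF w g(1) fi[OF l] g(2)])
      then show "L2_inner M g (f l) = 0" using wE l by (simp add: LIMSEQ_const_iff)
    qed
    have g1: "L2_norm M g \<le> 1"
      by (rule LIMSEQ_le_const2[OF L2_norm_tendsto[OF w g]]) (use w1 in auto)
    have "(\<lambda>i. L2_norm N (T (w i))) \<longlonglongrightarrow> L2_norm N (T g)"
    proof (rule L2_norm_tendsto[OF Tw bounded_ops_L2[OF T g(1)]])
      have "(\<lambda>i. op_norm M N T * L2_norm M (\<lambda>x. w i x - g x)) \<longlonglongrightarrow> 0"
        using tendsto_mult_right_zero[OF g(2)] .
      then show "(\<lambda>i. L2_norm N (\<lambda>y. T (w i) y - T g y)) \<longlonglongrightarrow> 0"
        by (rule Lim_null_comparison[rotated])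
          (use op_norm_bound[OF T L2_diff[OF w g(1)]] L2_norm_bounded_ops_diff[OF T w g(1)] in simp)
    qed
    moreover have "(\<lambda>i. s * (1 - 1 / (real i + 2))) \<longlonglongrightarrow> s * (1 - 0)"
      using LIMSEQ_ignore_initial_segment[OF lim_1_over_n[where 'a=real], of 2]
      by (intro tendsto_intros) (simp add: add.commute)
    ultimately have sg: "s \<le> L2_norm N (T g)"
      using LIMSEQ_le[of "\<lambda>i. s * (1 - 1 / (real i + 2))" s] sw by (force intro: less_imp_le)
    then have "s \<le> s * L2_norm M g" using s_le[OF g(1) gE] by simp
    then have g2: "L2_norm M g = 1" using s g1 by simp
    show ?thesis
    proof (intro bexI[of _ g] conjI ballI impI)
      show "L2_norm M g = 0 \<or> L2_norm M g = 1" using g2 by simp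
      fix u assume "u \<in> L2 M" "?E u"
      then have "L2_norm N (T u) \<le> s * L2_norm M u" by (rule s_le)
      also have "\<dots> \<le> 1 * L2_norm N (T g) * L2_norm M u" using sg by (intro mult_right_mono) auto
      finally show "L2_norm N (T u) \<le> 1 * L2_norm N (T g) * L2_norm M u" .
    qed (use gE g in auto)
  qed
qed

lemma singular_vectors_exist:
  assumes "T \<in> bounded_ops M N"
    and "\<And>f. orthonormal_or_zero M f \<Longrightarrow> (\<lambda>n. L2_norm N (T (f n))) \<longlonglongrightarrow> 0"
  shows "\<exists>f. greedy_seq M N T 1 f"
  by (rule greedy_seq_exists) (rule singular_vector_on_complement[OF assms])

text \<open>A vector maximising the norm of \<open>T\<close> is a critical point: perturbing it in an orthogonal
  direction changes the norm of the image only to second order.\<close>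

lemma singular_vectors_orthogonal_images:
  assumes T: "T \<in> bounded_ops M N" and f: "greedy_seq M N T 1 f" and "i \<noteq> j"
  shows "L2_inner N (T (f i)) (T (f j)) = 0"
proof -
  note o = greedy_seqD(1)[OF f]
  note fi = orthonormal_or_zero_L2[OF o]
  note Tf = bounded_ops_L2[OF T fi]
  have less: "L2_inner N (T (f i)) (T (f j)) = 0" if "i < j" for i j
  proof (cases "L2_norm M (f i) = 0")
    case True
    then have "L2_norm N (T (f i)) \<le> 0" using op_norm_bound[OF T fi, of i] by simp
    then have "L2_norm N (T (f i)) = 0" by (rule order_antisym) simp
    then have "norm (L2_inner N (T (f i)) (T (f j))) \<le> 0"
      using L2_cauchy_schwarz[OF Tf Tf, of i j] by simp
    then show ?thesis by simp
  next
    case False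
    then have n1: "L2_norm M (f i) = 1" using orthonormal_or_zero_norm[OF o, of i] by simp
    define z where "z = L2_inner N (T (f i)) (T (f j))"
    define s where "s = L2_norm N (T (f i))"
    show ?thesis
    proof (rule ccontr)
      assume "L2_inner N (T (f i)) (T (f j)) \<noteq> 0"
      then have z: "0 < (norm z)\<^sup>2" by (simp add: z_def)
      \<comment> \<open>any \<open>t\<close> with \<open>s\<^sup>2 t < 2\<close> makes the first order gain exceed the second order loss\<close>
      define t where "t = 1 / (s\<^sup>2 + 1)"
      have t: "0 < t" unfolding t_def by (simp add: add_nonneg_pos)
      define c where "c = complex_of_real t * z"
      let ?u = "\<lambda>x. f i x + c * f j x"
      have u: "?u \<in> L2 M" by (intro L2_add L2_cmult fi)
      have cn: "(norm c)\<^sup>2 = t\<^sup>2 * (norm z)\<^sup>2" by (simp add: c_def norm_mult power_mult_distrib)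
      have "L2_inner M (f i) (\<lambda>x. c * f j x) = 0"
        unfolding L2_inner_cmult_right using orthonormal_or_zero_inner[OF o] \<open>i < j\<close> by simp
      then have "(L2_norm M ?u)\<^sup>2 = 1 + (norm c)\<^sup>2 * (L2_norm M (f j))\<^sup>2"
        using L2_norm_add_power2[OF fi L2_cmult[OF fi], of i c j] n1 by (simp add: L2_norm_cmult power_mult_distrib)
      also have "\<dots> \<le> 1 + (norm c)\<^sup>2 * 1"
        using orthonormal_or_zero_norm_le[OF o, of j] by (intro add_left_mono mult_left_mono power_le_one) auto
      finally have un: "(L2_norm M ?u)\<^sup>2 \<le> 1 + t\<^sup>2 * (norm z)\<^sup>2" by (simp add: cn)
      have "L2_inner M ?u (f l) = 0" if "l < i" for l
        using that \<open>i < j\<close> orthonormal_or_zero_inner[OF o]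
        by (simp add: L2_inner_add_left[OF fi L2_cmult[OF fi] fi] L2_inner_cmult_left)
      then have "L2_norm N (T ?u) \<le> s * L2_norm M ?u"
        using greedy_seqD(2)[OF f u, of i] by (simp add: s_def)
      then have "(L2_norm N (T ?u))\<^sup>2 \<le> (s * L2_norm M ?u)\<^sup>2" by (intro power_mono) auto
      also have "\<dots> \<le> s\<^sup>2 * (1 + t\<^sup>2 * (norm z)\<^sup>2)"
        unfolding power_mult_distrib by (intro mult_left_mono un) simp
      finally have upper: "(L2_norm N (T ?u))\<^sup>2 \<le> s\<^sup>2 + s\<^sup>2 * (t\<^sup>2 * (norm z)\<^sup>2)" by (simp add: algebra_simps)
      have "L2_norm N (T ?u) = L2_norm N (\<lambda>y. T (f i) y + c * T (f j) y)"
      proof (rule L2_norm_cong_AE)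
        show "AE y in N. T ?u y = T (f i) y + c * T (f j) y"
          using bounded_ops_add[OF T fi L2_cmult[OF fi], of i c j] bounded_ops_cmult[OF T fi, of c j]
          by eventually_elim simp
      qed (intro L2_measurable L2_add L2_cmult Tf bounded_ops_L2[OF T u])+
      then have "(L2_norm N (T ?u))\<^sup>2 = s\<^sup>2 + 2 * Re (L2_inner N (T (f i)) (\<lambda>y. c * T (f j) y)) + (L2_norm N (\<lambda>y. c * T (f j) y))\<^sup>2"
        using L2_norm_add_power2[OF Tf L2_cmult[OF Tf], of i c j] by (simp add: s_def)
      also have "Re (L2_inner N (T (f i)) (\<lambda>y. c * T (f j) y)) = t * (norm z)\<^sup>2"
        unfolding L2_inner_cmult_right z_def[symmetric] c_def
        by (simp add: cmod_power2) (simp add: power2_eq_square algebra_simps)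
      finally have "s\<^sup>2 + 2 * (t * (norm z)\<^sup>2) \<le> (L2_norm N (T ?u))\<^sup>2" by simp
      with upper have "2 * (t * (norm z)\<^sup>2) \<le> s\<^sup>2 * (t\<^sup>2 * (norm z)\<^sup>2)" by simp
      then have "2 * (t * (norm z)\<^sup>2) \<le> (s\<^sup>2 * t) * (t * (norm z)\<^sup>2)" by (simp add: power2_eq_square mult_ac)
      then have "2 \<le> s\<^sup>2 * t" by (rule mult_right_le_imp_le) (use t z in simp)
      moreover have "s\<^sup>2 * t \<le> 1" by (simp add: t_def divide_le_eq_1_pos add_nonneg_pos)
      ultimately show False by simp
    qed
  qed
  show ?thesis
  proof (cases "i < j")
    case False
    then have "L2_inner N (T (f j)) (T (f i)) = 0" using \<open>i \<noteq> j\<close> less by simp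
    then show ?thesis using L2_inner_commute[of N "T (f i)" "T (f j)"] by simp
  qed (rule less)
qed

section \<open>Functionals on the compact operators\<close>

context pair_sigma_finite
begin

lemma op_norm_int_op_diff:
  assumes "k \<in> L2 (M1 \<Otimes>\<^sub>M M2)" "k' \<in> L2 (M1 \<Otimes>\<^sub>M M2)"
  shows "op_norm M1 M2 (\<lambda>f y. int_op M1 k f y - int_op M1 k' f y) = op_norm M1 M2 (int_op M1 (\<lambda>z. k z - k' z))"
proof (rule op_norm_cong)
  show "op_eq M1 M2 (\<lambda>f y. int_op M1 k f y - int_op M1 k' f y) (int_op M1 (\<lambda>z. k z - k' z))"
    unfolding op_eq_def
  proof
    fix f assume "f \<in> L2 M1"
    from int_op_AE_diff[OF assms this]
    show "AE y in M2. int_op M1 k f y - int_op M1 k' f y = int_op M1 (\<lambda>z. k z - k' z) f y"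
      by eventually_elim simp
  qed
qed (use assms in blast)+

lemma op_norm_int_op_cmult:
  assumes k: "k \<in> L2 (M1 \<Otimes>\<^sub>M M2)"
  shows "op_norm M1 M2 (int_op M1 (\<lambda>z. c * k z)) \<le> norm c * op_norm M1 M2 (int_op M1 k)"
proof (rule op_norm_le)
  show "0 \<le> norm c * op_norm M1 M2 (int_op M1 k)" by (intro mult_nonneg_nonneg op_norm_nonneg int_op_bounded k) simp
  fix f assume "f \<in> L2 M1"
  then show "L2_norm M2 (int_op M1 (\<lambda>z. c * k z) f) \<le> norm c * op_norm M1 M2 (int_op M1 k) * L2_norm M1 f"
    unfolding int_op_cmult L2_norm_cmult mult.assoc by (intro mult_left_mono op_norm_bound int_op_bounded k) simp_all
qed

lemma op_norm_int_op_add: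
  assumes k: "k \<in> L2 (M1 \<Otimes>\<^sub>M M2)" and k': "k' \<in> L2 (M1 \<Otimes>\<^sub>M M2)"
  shows "op_norm M1 M2 (int_op M1 (\<lambda>z. k z + k' z)) \<le> op_norm M1 M2 (int_op M1 k) + op_norm M1 M2 (int_op M1 k')"
proof (rule op_norm_le)
  show "0 \<le> op_norm M1 M2 (int_op M1 k) + op_norm M1 M2 (int_op M1 k')"
    by (intro add_nonneg_nonneg op_norm_nonneg int_op_bounded k k')
  fix f assume f: "f \<in> L2 M1"
  have "L2_norm M2 (int_op M1 (\<lambda>z. k z + k' z) f) = L2_norm M2 (\<lambda>y. int_op M1 k f y + int_op M1 k' f y)"
    by (intro L2_norm_cong_AE int_op_AE_add L2_measurable L2_add int_op_L2 k k' f)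
  also have "\<dots> \<le> L2_norm M2 (int_op M1 k f) + L2_norm M2 (int_op M1 k' f)"
    by (intro L2_norm_triangle int_op_L2 k k' f)
  also have "\<dots> \<le> op_norm M1 M2 (int_op M1 k) * L2_norm M1 f + op_norm M1 M2 (int_op M1 k') * L2_norm M1 f"
    by (intro add_mono op_norm_bound int_op_bounded k k' f)
  finally show "L2_norm M2 (int_op M1 (\<lambda>z. k z + k' z) f) \<le> (op_norm M1 M2 (int_op M1 k) + op_norm M1 M2 (int_op M1 k')) * L2_norm M1 f"
    by (simp add: algebra_simps)
qed

text \<open>Testing a functional \<open>k \<mapsto> \<integral> k h\<close> that is bounded in the operator norm against the partial isometry
  that matches up the singular vectors of \<open>I\<^sub>h\<close> shows that the singular values are summable.\<close>

lemma singular_values_sum_le: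
  assumes h: "h \<in> L2 (M1 \<Otimes>\<^sub>M M2)" and C: "0 \<le> C"
    and bound: "\<And>k. k \<in> L2 (M1 \<Otimes>\<^sub>M M2) \<Longrightarrow>
      norm (\<integral>z. k z * h z \<partial>(M1 \<Otimes>\<^sub>M M2)) \<le> C * op_norm M1 M2 (int_op M1 k)"
    and f: "greedy_seq M1 M2 (int_op M1 h) 1 f"
  shows "(\<Sum>i<n. L2_norm M2 (int_op M1 h (f i))) \<le> C"
proof -
  note T = int_op_bounded[OF h]
  note o = greedy_seqD(1)[OF f]
  note fi = orthonormal_or_zero_L2[OF o]
  note Tf = bounded_ops_L2[OF T fi]
  define s where "s i = L2_norm M2 (int_op M1 h (f i))" for i
  \<comment> \<open>for \<open>s i = 0\<close> the factor \<open>1 / s i\<close> is zero, as the partial isometry requires\<close>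
  define b where "b i y = complex_of_real (1 / s i) * cnj (int_op M1 h (f i) y)" for i y
  have b: "b i \<in> L2 M2" for i unfolding b_def by (intro L2_cmult L2_cnj Tf)
  define k where "k = tensor_kernel n f b"
  have k: "k \<in> L2 (M1 \<Otimes>\<^sub>M M2)" unfolding k_def by (rule L2_tensor_kernel[OF fi b])
  have "(\<integral>z. k z * h z \<partial>(M1 \<Otimes>\<^sub>M M2)) = (\<integral>z. (\<Sum>i<n. h z * (f i (fst z) * b i (snd z))) \<partial>(M1 \<Otimes>\<^sub>M M2))"
    by (simp add: k_def tensor_kernel_def sum_distrib_left mult.commute)
  also have "\<dots> = (\<Sum>i<n. \<integral>z. h z * (f i (fst z) * b i (snd z)) \<partial>(M1 \<Otimes>\<^sub>M M2))"
    by (rule Bochner_Integration.integral_sum) (intro L2_mult_integrable L2_tensor h fi b)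
  also have "\<dots> = (\<Sum>i<n. complex_of_real (s i))"
  proof (rule sum.cong[OF refl])
    fix i
    have "(\<integral>z. h z * (f i (fst z) * b i (snd z)) \<partial>(M1 \<Otimes>\<^sub>M M2)) = (\<integral>y. int_op M1 h (f i) y * b i y \<partial>M2)"
      by (rule integral_tensor[OF h fi b])
    also have "\<dots> = (\<integral>y. complex_of_real (1 / s i) * (int_op M1 h (f i) y * cnj (int_op M1 h (f i) y)) \<partial>M2)"
      by (simp add: b_def mult_ac)
    also have "\<dots> = complex_of_real (1 / s i) * L2_inner M2 (int_op M1 h (f i)) (int_op M1 h (f i))"
      unfolding L2_inner_def by (rule integral_mult_right_zero)
    also have "\<dots> = complex_of_real (s i)"
      unfolding L2_inner_self s_def[symmetric] by (simp add: power2_eq_square)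
    finally show "(\<integral>z. h z * (f i (fst z) * b i (snd z)) \<partial>(M1 \<Otimes>\<^sub>M M2)) = complex_of_real (s i)" .
  qed
  finally have int: "(\<integral>z. k z * h z \<partial>(M1 \<Otimes>\<^sub>M M2)) = complex_of_real (\<Sum>i<n. s i)" by simp
  have bo: "L2_inner M2 (b i) (b j) = 0" if "i \<noteq> j" for i j
  proof -
    have "L2_inner M2 (\<lambda>y. cnj (int_op M1 h (f i) y)) (\<lambda>y. cnj (int_op M1 h (f j) y)) =
        cnj (L2_inner M2 (int_op M1 h (f i)) (int_op M1 h (f j)))"
      unfolding L2_inner_def by (subst Bochner_Integration.integral_cnj[symmetric]) simp
    then show ?thesis
      unfolding b_def L2_inner_cmult_left L2_inner_cmult_right singular_vectors_orthogonal_images[OF T f that] by simp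
  qed
  have bn: "L2_norm M2 (b i) \<le> 1" for i
    unfolding b_def L2_norm_cmult L2_norm_cnj s_def by (simp add: norm_divide)
  have "op_norm M1 M2 (int_op M1 k) \<le> 1"
  proof (rule op_norm_le)
    fix u assume u: "u \<in> L2 M1"
    let ?c = "\<lambda>i. \<integral>x. f i x * u x \<partial>M1"
    have "(L2_norm M2 (int_op M1 k u))\<^sup>2 = (\<Sum>i<n. (norm (?c i))\<^sup>2 * (L2_norm M2 (b i))\<^sup>2)"
      unfolding k_def int_op_tensor_kernel[OF fi u] by (rule orthogonal_sum_norm[OF b bo])
    also have "\<dots> \<le> (\<Sum>i<n. (norm (?c i))\<^sup>2 * 1)"
      using bn by (intro sum_mono mult_left_mono power_le_one) auto
    also have "\<dots> = (\<Sum>i<n. (norm (L2_inner M1 u (\<lambda>x. cnj (f i x))))\<^sup>2)"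
      by (simp add: L2_inner_def mult.commute)
    also have "\<dots> \<le> (L2_norm M1 u)\<^sup>2" by (rule bessel_inequality[OF orthonormal_or_zero_cnj[OF o] u])
    finally have "L2_norm M2 (int_op M1 k u) \<le> L2_norm M1 u"
      by (rule power2_le_imp_le) simp
    then show "L2_norm M2 (int_op M1 k u) \<le> 1 * L2_norm M1 u" by simp
  qed simp
  then have "C * op_norm M1 M2 (int_op M1 k) \<le> C * 1" using C by (rule mult_left_mono)
  moreover have "norm (complex_of_real (\<Sum>i<n. s i)) \<le> C * op_norm M1 M2 (int_op M1 k)"
    using bound[OF k] unfolding int .
  moreover have "(\<Sum>i<n. s i) \<le> norm (complex_of_real (\<Sum>i<n. s i))" by (simp only: norm_of_real abs_ge_self)
  ultimately have "(\<Sum>i<n. s i) \<le> C" by linarith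
  then show ?thesis by (simp only: s_def)
qed

text \<open>The singular value decomposition of \<open>I\<^sub>h\<close> exhibits a functional \<open>k \<mapsto> \<integral> k h\<close> that is bounded in the
  operator norm as a trace class operator.  The remainders of the decomposition are
  functionals that are uniformly bounded in the operator norm and tend to zero on kernels of finite
  rank, hence on all kernels.\<close>

lemma trace_class_representation:
  assumes h: "h \<in> L2 (M1 \<Otimes>\<^sub>M M2)" and C: "0 \<le> C"
    and bound: "\<And>k. k \<in> L2 (M1 \<Otimes>\<^sub>M M2) \<Longrightarrow>
      norm (\<integral>z. k z * h z \<partial>(M1 \<Otimes>\<^sub>M M2)) \<le> C * op_norm M1 M2 (int_op M1 k)"
  obtains \<tau> where "\<tau> \<in> trace_class M1 M2"
    "\<And>k. k \<in> L2 (M1 \<Otimes>\<^sub>M M2) \<Longrightarrow> trace_pairing M2 (int_op M1 k) \<tau> = (\<integral>z. k z * h z \<partial>(M1 \<Otimes>\<^sub>M M2))"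
proof -
  note T = int_op_bounded[OF h]
  obtain f where f: "greedy_seq M1 M2 (int_op M1 h) 1 f"
    using singular_vectors_exist[OF T hilbert_schmidt_null[OF h]] by auto
  note o = greedy_seqD(1)[OF f]
  note fi = orthonormal_or_zero_L2[OF o]
  define F where "F i x = cnj (f i x)" for i x
  define G where "G i = int_op M1 h (f i)" for i
  define s where "s i = L2_norm M2 (G i)" for i
  have F: "F i \<in> L2 M1" for i unfolding F_def by (rule L2_cnj[OF fi])
  have G: "G i \<in> L2 M2" for i unfolding G_def by (rule bounded_ops_L2[OF T fi])
  have F1: "L2_norm M1 (F i) \<le> 1" for i
    unfolding F_def L2_norm_cnj by (rule orthonormal_or_zero_norm_le[OF o])
  have s0: "0 \<le> s i" for i by (simp add: s_def)
  have sC: "(\<Sum>i<n. s i) \<le> C" for n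
    unfolding s_def G_def by (rule singular_values_sum_le[OF h C bound f])
  have ss: "summable s" using sC s0 by (intro summableI_nonneg_bounded)
  \<comment> \<open>splitting the singular value evenly makes both factors square-summable\<close>
  define \<tau> where "\<tau> = (\<lambda>i x. complex_of_real (sqrt (s i)) * F i x, \<lambda>i y. complex_of_real (1 / sqrt (s i)) * G i y)"
  have \<tau>: "\<tau> \<in> trace_class M1 M2"
  proof -
    have "(L2_norm M1 (\<lambda>x. complex_of_real (sqrt (s i)) * F i x))\<^sup>2 \<le> s i" for i
    proof -
      have "(L2_norm M1 (F i))\<^sup>2 \<le> 1" using F1 by (simp add: power_le_one)
      then show ?thesis unfolding L2_norm_cmult using s0[of i] by (simp add: power_mult_distrib mult_left_le)
    qed
    then have "summable (\<lambda>i. (L2_norm M1 (\<lambda>x. complex_of_real (sqrt (s i)) * F i x))\<^sup>2)"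
      by (intro summable_comparison_test'[OF ss, of 0]) simp
    moreover have "(L2_norm M2 (\<lambda>y. complex_of_real (1 / sqrt (s i)) * G i y))\<^sup>2 = s i" for i
      unfolding L2_norm_cmult s_def[symmetric] using s0[of i]
      by (simp add: power_mult_distrib power_divide norm_divide) (simp add: power2_eq_square)
    then have "summable (\<lambda>i. (L2_norm M2 (\<lambda>y. complex_of_real (1 / sqrt (s i)) * G i y))\<^sup>2)"
      using ss by simp
    moreover have "(\<lambda>x. complex_of_real (sqrt (s i)) * F i x) \<in> L2 M1"
        "(\<lambda>y. complex_of_real (1 / sqrt (s i)) * G i y) \<in> L2 M2" for i
      by (intro L2_cmult F G)+
    ultimately show ?thesis unfolding trace_class_def \<tau>_def by simp
  qed
  define R where "R n z = h z - tensor_kernel n F G z" for n z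
  have R: "R n \<in> L2 (M1 \<Otimes>\<^sub>M M2)" for n
    unfolding R_def by (intro L2_diff L2_tensor_kernel h F G)
  have term_eq: "(\<integral>y. int_op M1 k (F i) y * G i y \<partial>M2) = (\<integral>y. int_op M1 k (fst \<tau> i) y * snd \<tau> i y \<partial>M2)" if k: "k \<in> L2 (M1 \<Otimes>\<^sub>M M2)" for k i
  proof (cases "s i = 0")
    case True
    have "norm (\<integral>y. int_op M1 k (F i) y * G i y \<partial>M2) \<le> L2_norm M2 (int_op M1 k (F i)) * s i"
      unfolding s_def by (intro L2_cauchy_schwarz_mult G int_op_L2 k F)
    then show ?thesis using True by (simp add: \<tau>_def)
  next
    case False
    then have sq: "complex_of_real (sqrt (s i)) * complex_of_real (1 / sqrt (s i)) = 1" by simp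
    have "int_op M1 k (\<lambda>x. complex_of_real (sqrt (s i)) * F i x) = (\<lambda>y. complex_of_real (sqrt (s i)) * int_op M1 k (F i) y)"
      by (simp add: int_op_def mult.left_commute)
    then have "int_op M1 k (fst \<tau> i) y * snd \<tau> i y = int_op M1 k (F i) y * G i y" for y
      unfolding \<tau>_def using sq False by (simp add: mult_ac)
    then show ?thesis by simp
  qed
  have tensor_int: "(\<integral>z. k z * tensor_kernel n a b z \<partial>(M1 \<Otimes>\<^sub>M M2)) = (\<Sum>i<n. \<integral>y. int_op M1 k (a i) y * b i y \<partial>M2)"
    if k: "k \<in> L2 (M1 \<Otimes>\<^sub>M M2)" and a: "\<And>i. a i \<in> L2 M1" and b: "\<And>i. b i \<in> L2 M2" for k n a b
  proof -
    have "(\<integral>z. k z * tensor_kernel n a b z \<partial>(M1 \<Otimes>\<^sub>M M2)) = (\<integral>z. (\<Sum>i<n. k z * (a i (fst z) * b i (snd z))) \<partial>(M1 \<Otimes>\<^sub>M M2))"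
      by (simp add: tensor_kernel_def sum_distrib_left)
    also have "\<dots> = (\<Sum>i<n. \<integral>z. k z * (a i (fst z) * b i (snd z)) \<partial>(M1 \<Otimes>\<^sub>M M2))"
      by (rule Bochner_Integration.integral_sum) (intro L2_mult_integrable L2_tensor k a b)
    finally show ?thesis by (simp add: integral_tensor[OF k a b])
  qed
  have R_int: "(\<integral>z. k z * R n z \<partial>(M1 \<Otimes>\<^sub>M M2)) = (\<integral>z. k z * h z \<partial>(M1 \<Otimes>\<^sub>M M2)) - (\<Sum>i<n. \<integral>y. int_op M1 k (F i) y * G i y \<partial>M2)"
    if k: "k \<in> L2 (M1 \<Otimes>\<^sub>M M2)" for k n
    unfolding R_def tensor_int[OF k F G, symmetric]
    using L2_mult_integrable[OF k h] L2_mult_integrable[OF k L2_tensor_kernel[OF F G]] by (simp add: right_diff_distrib)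
  have R_bound: "norm (\<integral>z. k z * R n z \<partial>(M1 \<Otimes>\<^sub>M M2)) \<le> 2 * C * op_norm M1 M2 (int_op M1 k)" if k: "k \<in> L2 (M1 \<Otimes>\<^sub>M M2)" for k n
  proof -
    have nn: "0 \<le> op_norm M1 M2 (int_op M1 k)" by (intro op_norm_nonneg int_op_bounded k)
    have "norm (\<integral>y. int_op M1 k (F i) y * G i y \<partial>M2) \<le> op_norm M1 M2 (int_op M1 k) * s i" for i
    proof -
      have "norm (\<integral>y. int_op M1 k (F i) y * G i y \<partial>M2) \<le> L2_norm M2 (int_op M1 k (F i)) * s i"
        unfolding s_def by (intro L2_cauchy_schwarz_mult G int_op_L2 k F)
      also have "\<dots> \<le> (op_norm M1 M2 (int_op M1 k) * L2_norm M1 (F i)) * s i"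
        by (intro mult_right_mono op_norm_bound int_op_bounded k F s0)
      also have "\<dots> \<le> (op_norm M1 M2 (int_op M1 k) * 1) * s i"
        by (intro mult_right_mono mult_left_mono F1 nn s0)
      finally show ?thesis by simp
    qed
    then have "norm (\<Sum>i<n. \<integral>y. int_op M1 k (F i) y * G i y \<partial>M2) \<le> (\<Sum>i<n. op_norm M1 M2 (int_op M1 k) * s i)"
      by (intro sum_norm_le) auto
    also have "\<dots> \<le> op_norm M1 M2 (int_op M1 k) * C"
      unfolding sum_distrib_left[symmetric] by (rule mult_left_mono[OF sC nn])
    finally have "norm (\<Sum>i<n. \<integral>y. int_op M1 k (F i) y * G i y \<partial>M2) \<le> C * op_norm M1 M2 (int_op M1 k)"
      by (simp add: mult.commute)
    then show ?thesis
      unfolding R_int[OF k] using bound[OF k] norm_triangle_ineq4[of "\<integral>z. k z * h z \<partial>(M1 \<Otimes>\<^sub>M M2)" "\<Sum>i<n. \<integral>y. int_op M1 k (F i) y * G i y \<partial>M2"]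
      by simp
  qed
  have R_small: "L2_norm M2 (int_op M1 (R n) u) \<le> s n * L2_norm M1 u" if u: "u \<in> L2 M1" for n u
  proof -
    have "L2_norm M2 (int_op M1 (R n) u) = L2_norm M2 (\<lambda>y. int_op M1 h u y - (\<Sum>i<n. L2_inner M1 u (f i) * int_op M1 h (f i) y))"
    proof (rule L2_norm_cong_AE)
      show "AE y in M2. int_op M1 (R n) u y = int_op M1 h u y - (\<Sum>i<n. L2_inner M1 u (f i) * int_op M1 h (f i) y)"
        using int_op_AE_diff[OF h L2_tensor_kernel[where n = n and a = F and b = G, OF F G] u]
      proof eventually_elim
        case (elim y)
        have "(\<integral>x. F i x * u x \<partial>M1) = L2_inner M1 u (f i)" for i
          by (simp add: F_def L2_inner_def mult.commute)
        then show ?case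
          using elim unfolding R_def int_op_tensor_kernel[OF F u] by (simp add: G_def)
      qed
    qed (intro L2_measurable int_op_L2 L2_diff L2_sum L2_cmult R u h fi)+
    also have "\<dots> \<le> 1 * L2_norm M2 (int_op M1 h (f n)) * L2_norm M1 u"
      by (rule greedy_seq_residual[OF T f u]) simp
    finally show ?thesis by (simp add: s_def G_def)
  qed
  show thesis
  proof (rule that[OF \<tau>])
    fix k assume k: "k \<in> L2 (M1 \<Otimes>\<^sub>M M2)"
    have "(\<lambda>n. \<integral>z. k z * R n z \<partial>(M1 \<Otimes>\<^sub>M M2)) \<longlonglongrightarrow> 0"
    proof (rule LIMSEQ_I)
      fix e :: real assume e: "0 < e"
      have e': "0 < e / (4 * (C + 1))" using e C by simp
      obtain m a b where a: "\<And>i. a i \<in> L2 M1" and b: "\<And>i. b i \<in> L2 M2"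
        and ab: "op_norm M1 M2 (\<lambda>f y. int_op M1 k f y - int_op M1 (tensor_kernel m a b) f y) < e / (4 * (C + 1))"
        by (rule approx_by_tensor_kernel[OF int_op_bounded[OF k] hilbert_schmidt_null[OF k] e']) blast+
      let ?t = "tensor_kernel m a b"
      have t: "?t \<in> L2 (M1 \<Otimes>\<^sub>M M2)" by (rule L2_tensor_kernel[OF a b])
      have kt: "(\<lambda>z. k z - ?t z) \<in> L2 (M1 \<Otimes>\<^sub>M M2)" by (intro L2_diff k t)
      define B where "B = (\<Sum>i<m. L2_norm M1 (a i) * L2_norm M2 (b i))"
      have "(\<lambda>n. s n * B) \<longlonglongrightarrow> 0 * B" by (intro tendsto_intros summable_LIMSEQ_zero ss)
      then obtain n0 where n0: "\<And>n. n \<ge> n0 \<Longrightarrow> norm (s n * B) < e / 2"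
        using LIMSEQ_D[of "\<lambda>n. s n * B" 0 "e / 2"] e by auto
      have "norm (\<integral>z. k z * R n z \<partial>(M1 \<Otimes>\<^sub>M M2)) < e" if n: "n \<ge> n0" for n
      proof -
        have "(\<integral>z. ?t z * R n z \<partial>(M1 \<Otimes>\<^sub>M M2)) = (\<Sum>i<m. \<integral>y. int_op M1 (R n) (a i) y * b i y \<partial>M2)"
          using tensor_int[OF R a b] by (simp add: mult.commute)
        also have "norm \<dots> \<le> (\<Sum>i<m. s n * (L2_norm M1 (a i) * L2_norm M2 (b i)))"
        proof (rule sum_norm_le)
          fix i
          have "norm (\<integral>y. int_op M1 (R n) (a i) y * b i y \<partial>M2) \<le> L2_norm M2 (int_op M1 (R n) (a i)) * L2_norm M2 (b i)"
            by (intro L2_cauchy_schwarz_mult int_op_L2 R a b)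
          also have "\<dots> \<le> s n * L2_norm M1 (a i) * L2_norm M2 (b i)"
            by (intro mult_right_mono R_small a) simp
          finally show "norm (\<integral>y. int_op M1 (R n) (a i) y * b i y \<partial>M2) \<le> s n * (L2_norm M1 (a i) * L2_norm M2 (b i))"
            by (simp add: mult.assoc)
        qed
        also have "\<dots> = s n * B" by (simp add: B_def sum_distrib_left)
        also have "\<dots> < e / 2" using n0[OF n] by simp
        finally have 1: "norm (\<integral>z. ?t z * R n z \<partial>(M1 \<Otimes>\<^sub>M M2)) < e / 2" .
        have "norm (\<integral>z. (k z - ?t z) * R n z \<partial>(M1 \<Otimes>\<^sub>M M2)) \<le> 2 * C * op_norm M1 M2 (int_op M1 (\<lambda>z. k z - ?t z))"
          by (rule R_bound[OF kt])
        also have "\<dots> \<le> 2 * C * (e / (4 * (C + 1)))"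
          using ab C unfolding op_norm_int_op_diff[OF k t] by (intro mult_left_mono) auto
        also have "\<dots> \<le> e / 2" using C e by (simp add: field_simps)
        finally have 2: "norm (\<integral>z. (k z - ?t z) * R n z \<partial>(M1 \<Otimes>\<^sub>M M2)) \<le> e / 2" .
        have "(\<integral>z. (k z - ?t z) * R n z \<partial>(M1 \<Otimes>\<^sub>M M2)) + (\<integral>z. ?t z * R n z \<partial>(M1 \<Otimes>\<^sub>M M2)) = (\<integral>z. k z * R n z \<partial>(M1 \<Otimes>\<^sub>M M2))"
          using L2_mult_integrable[OF kt R] L2_mult_integrable[OF t R]
          by (simp add: Bochner_Integration.integral_add[symmetric] left_diff_distrib)
        then show ?thesis using 1 2 norm_triangle_ineq[of "\<integral>z. (k z - ?t z) * R n z \<partial>(M1 \<Otimes>\<^sub>M M2)" "\<integral>z. ?t z * R n z \<partial>(M1 \<Otimes>\<^sub>M M2)"]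
          by simp
      qed
      then show "\<exists>no. \<forall>n\<ge>no. norm ((\<integral>z. k z * R n z \<partial>(M1 \<Otimes>\<^sub>M M2)) - 0) < e" by auto
    qed
    then have "(\<lambda>n. \<Sum>i<n. \<integral>y. int_op M1 k (F i) y * G i y \<partial>M2) \<longlonglongrightarrow> (\<integral>z. k z * h z \<partial>(M1 \<Otimes>\<^sub>M M2))"
      using tendsto_diff[OF tendsto_const[of "\<integral>z. k z * h z \<partial>(M1 \<Otimes>\<^sub>M M2)"]] unfolding R_int[OF k] by fastforce
    then have "(\<lambda>i. \<integral>y. int_op M1 k (fst \<tau> i) y * snd \<tau> i y \<partial>M2) sums (\<integral>z. k z * h z \<partial>(M1 \<Otimes>\<^sub>M M2))"
      unfolding sums_def term_eq[OF k] .
    then show "trace_pairing M2 (int_op M1 k) \<tau> = (\<integral>z. k z * h z \<partial>(M1 \<Otimes>\<^sub>M M2))"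
      unfolding trace_pairing_def by (rule sums_unique[symmetric])
  qed
qed

end

section \<open>Norm closure versus weak* closure\<close>

lemma mult_domD:
  assumes "k \<in> mult_dom M N \<phi>"
  shows "k \<in> L2 (M \<Otimes>\<^sub>M N)" "(\<lambda>z. \<phi> z * k z) \<in> L2 (M \<Otimes>\<^sub>M N)"
  using assms by (auto simp: mult_dom_def)

lemma mult_dom_cmult:
  assumes "k \<in> mult_dom M N \<phi>" shows "(\<lambda>z. c * k z) \<in> mult_dom M N \<phi>"
  using L2_cmult[OF mult_domD(1)[OF assms], of c] L2_cmult[OF mult_domD(2)[OF assms], of c]
  by (simp add: mult_dom_def mult.left_commute)

lemma mult_dom_add:
  assumes "k \<in> mult_dom M N \<phi>" "k' \<in> mult_dom M N \<phi>" shows "(\<lambda>z. k z + k' z) \<in> mult_dom M N \<phi>"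
  using L2_add[OF mult_domD(1)[OF assms(1)] mult_domD(1)[OF assms(2)]]
    L2_add[OF mult_domD(2)[OF assms(1)] mult_domD(2)[OF assms(2)]]
  by (simp add: mult_dom_def distrib_left)

lemma mult_dom_diff:
  assumes "k \<in> mult_dom M N \<phi>" "k' \<in> mult_dom M N \<phi>" shows "(\<lambda>z. k z - k' z) \<in> mult_dom M N \<phi>"
  using L2_diff[OF mult_domD(1)[OF assms(1)] mult_domD(1)[OF assms(2)]]
    L2_diff[OF mult_domD(2)[OF assms(1)] mult_domD(2)[OF assms(2)]]
  by (simp add: mult_dom_def right_diff_distrib)

lemma mult_dom_zero: "(\<lambda>z. 0) \<in> mult_dom M N \<phi>"
  by (simp add: mult_dom_def)

lemma zero_op_compact: "zero_op \<in> compact_ops M N"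
proof -
  have "\<exists>r g. strict_mono r \<and> g \<in> L2 N \<and> (\<lambda>n. L2_norm N (\<lambda>y. zero_op (f (r n)) y - g y)) \<longlonglongrightarrow> 0"
    for f :: "nat \<Rightarrow> 'a \<Rightarrow> complex"
    by (rule exI[of _ id], rule exI[of _ "\<lambda>y. 0"]) (simp add: zero_op_def strict_mono_def)
  then show ?thesis unfolding compact_ops_def by simp
qed

context pair_sigma_finite
begin

text \<open>A functional that is bounded on one side on a ball is bounded in norm: rotate and rescale the argument.\<close>

lemma functional_bound_of_ball:
  assumes h: "h \<in> L2 (M1 \<Otimes>\<^sub>M M2)" and \<delta>: "0 < \<delta>"
    and ball: "\<And>r. r \<in> L2 (M1 \<Otimes>\<^sub>M M2) \<Longrightarrow> op_norm M1 M2 (int_op M1 r) \<le> \<delta> \<Longrightarrow>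
      - Re (\<integral>z. r z * h z \<partial>(M1 \<Otimes>\<^sub>M M2)) \<le> \<beta>"
    and r: "r \<in> L2 (M1 \<Otimes>\<^sub>M M2)"
  shows "norm (\<integral>z. r z * h z \<partial>(M1 \<Otimes>\<^sub>M M2)) \<le> \<beta> / \<delta> * op_norm M1 M2 (int_op M1 r)"
proof -
  define F where "F = (\<integral>z. r z * h z \<partial>(M1 \<Otimes>\<^sub>M M2))"
  have r0: "0 \<le> op_norm M1 M2 (int_op M1 r)" by (intro op_norm_nonneg int_op_bounded r)
  have "op_norm M1 M2 (int_op M1 (\<lambda>z. 0)) \<le> \<delta>"
    using op_norm_int_op_cmult[OF r, of 0] \<delta> by simp
  then have \<beta>: "0 \<le> \<beta>" using ball[of "\<lambda>z. 0"] by simp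
  have "norm F \<le> \<beta> / \<delta> * (op_norm M1 M2 (int_op M1 r) + \<eta>)" if \<eta>: "0 < \<eta>" for \<eta>
  proof (cases "F = 0")
    case True
    then show ?thesis using \<beta> \<delta> \<eta> r0 by simp
  next
    case False
    define q where "q = op_norm M1 M2 (int_op M1 r) + \<eta>"
    have q: "0 < q" using r0 \<eta> by (simp add: q_def)
    \<comment> \<open>moves \<open>r\<close> into the ball and its value to the negative real axis; \<open>\<eta>\<close> keeps \<open>q\<close> away from zero\<close>
    define c where "c = - complex_of_real (\<delta> / (q * norm F)) * cnj F"
    have nc: "norm c = \<delta> / q" unfolding c_def using False q \<delta> by (simp add: norm_mult norm_divide)
    have "op_norm M1 M2 (int_op M1 (\<lambda>z. c * r z)) \<le> norm c * op_norm M1 M2 (int_op M1 r)"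
      by (rule op_norm_int_op_cmult[OF r])
    also have "\<dots> \<le> \<delta> / q * q" unfolding nc using \<eta> \<delta> q by (intro mult_left_mono) (auto simp: q_def)
    finally have "op_norm M1 M2 (int_op M1 (\<lambda>z. c * r z)) \<le> \<delta>" using q by simp
    then have "- Re (\<integral>z. c * r z * h z \<partial>(M1 \<Otimes>\<^sub>M M2)) \<le> \<beta>" by (intro ball L2_cmult r)
    also have "(\<integral>z. c * r z * h z \<partial>(M1 \<Otimes>\<^sub>M M2)) = c * F" unfolding F_def by (simp add: mult.assoc)
    also have "c * F = - complex_of_real (\<delta> / q * norm F)"
    proof -
      have "cnj F * F = complex_of_real ((norm F)\<^sup>2)" by (simp add: complex_norm_square mult.commute del: of_real_power)
      then have "c * F = - complex_of_real (\<delta> / (q * norm F)) * complex_of_real ((norm F)\<^sup>2)"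
        by (simp only: c_def mult.assoc)
      then show ?thesis using False q by (simp add: power2_eq_square)
    qed
    finally have "\<delta> / q * norm F \<le> \<beta>" by simp
    then show ?thesis using q \<delta> unfolding q_def[symmetric] by (simp add: field_simps)
  qed
  then have "norm F \<le> \<beta> / \<delta> * op_norm M1 M2 (int_op M1 r) + e" if "0 < e" for e
  proof -
    have "\<beta> / \<delta> * (e / (\<beta> / \<delta> + 1)) \<le> e" using \<beta> \<delta> that by (simp add: field_simps)
    moreover have "norm F \<le> \<beta> / \<delta> * (op_norm M1 M2 (int_op M1 r) + e / (\<beta> / \<delta> + 1))"
      using \<open>\<And>\<eta>. 0 < \<eta> \<Longrightarrow> norm F \<le> \<beta> / \<delta> * (op_norm M1 M2 (int_op M1 r) + \<eta>)\<close> \<beta> \<delta> that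
      by (simp add: add_nonneg_pos)
    ultimately show ?thesis by (simp add: distrib_left)
  qed
  then show ?thesis unfolding F_def[symmetric] by (rule field_le_epsilon)
qed

text \<open>The graph of \<open>S\<^sub>\<phi>\<close>, translated by an approximation of \<open>(0, B)\<close> and thickened by a ball in the operator
  norm, is a convex set of pairs of kernels.  If \<open>(0, B)\<close> is not in the norm closure of the graph,
  this set stays away from zero in \<open>L\<^sup>2\<close>, and the separating functional is bounded in the operator
  norm, hence given by trace class operators; it annihilates the graph but not \<open>(0, B)\<close>.\<close>

lemma norm_closure_of_annihilator:
  assumes B: "B \<in> compact_ops M1 M2"
    and ann: "\<And>\<sigma> \<tau>. \<sigma> \<in> trace_class M1 M2 \<Longrightarrow> \<tau> \<in> trace_class M1 M2 \<Longrightarrow>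
      (\<And>k. k \<in> mult_dom M1 M2 \<phi> \<Longrightarrow>
        trace_pairing M2 (int_op M1 k) \<sigma> + trace_pairing M2 (int_op M1 (\<lambda>z. \<phi> z * k z)) \<tau> = 0) \<Longrightarrow>
      trace_pairing M2 B \<tau> = 0"
  shows "(zero_op, B) \<in> norm_closure M1 M2 (mult_graph M1 M2 \<phi>)"
proof (rule ccontr)
  let ?P = "M1 \<Otimes>\<^sub>M M2" and ?I = "int_op M1" and ?n = "op_norm M1 M2"
  note BB = compact_ops_bounded[OF B]
  have zero_compact: "zero_op \<in> compact_ops M1 M2" by (rule zero_op_compact)
  assume "(zero_op, B) \<notin> norm_closure M1 M2 (mult_graph M1 M2 \<phi>)"
  then obtain \<epsilon> where \<epsilon>: "0 < \<epsilon>" and far: "\<And>k. k \<in> mult_dom M1 M2 \<phi> \<Longrightarrow>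
      \<not> (?n (\<lambda>f y. zero_op f y - ?I k f y) < \<epsilon> \<and> ?n (\<lambda>f y. B f y - ?I (\<lambda>z. \<phi> z * k z) f y) < \<epsilon>)"
    unfolding norm_closure_def mult_graph_def using B zero_compact by (auto simp: not_less)
  \<comment> \<open>the distance \<open>\<epsilon>\<close> has to exceed the sum of the thickening, the \<open>L\<^sup>2\<close> norm and the error of \<open>b\<close>\<close>
  define \<delta> where "\<delta> = \<epsilon> / 4"
  have \<delta>: "0 < \<delta>" using \<epsilon> by (simp add: \<delta>_def)
  have approx: "\<exists>b\<in>L2 ?P. ?n (\<lambda>f y. B f y - ?I b f y) < e" if e: "0 < e" for e
  proof -
    obtain n a b where "\<And>i. a i \<in> L2 M1" "\<And>i. b i \<in> L2 M2" "?n (\<lambda>f y. B f y - ?I (tensor_kernel n a b) f y) < e"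
      by (rule approx_by_tensor_kernel[OF BB compact_ops_null[OF B] e]) blast+
    then show ?thesis using L2_tensor_kernel by blast
  qed
  obtain b where b: "b \<in> L2 ?P" and Bb: "?n (\<lambda>f y. B f y - ?I b f y) < \<delta> / 2"
    using approx[of "\<delta> / 2"] \<delta> by auto
  define Q where "Q = {(\<lambda>z. k z + r1 z, \<lambda>z. b z + \<phi> z * k z + r2 z) | k r1 r2.
     k \<in> mult_dom M1 M2 \<phi> \<and> r1 \<in> L2 ?P \<and> r2 \<in> L2 ?P \<and> ?n (?I r1) \<le> \<delta> \<and> ?n (?I r2) \<le> \<delta>}"
  have QI: "(\<lambda>z. k z + r1 z, \<lambda>z. b z + \<phi> z * k z + r2 z) \<in> Q"
    if "k \<in> mult_dom M1 M2 \<phi>" "r1 \<in> L2 ?P" "r2 \<in> L2 ?P" "?n (?I r1) \<le> \<delta>" "?n (?I r2) \<le> \<delta>" for k r1 r2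
    unfolding Q_def using that by blast
  have n0: "?n (?I (\<lambda>z. 0)) \<le> \<delta>"
    using op_norm_int_op_cmult[OF b, of 0] \<delta> by simp
  have Qsub: "Q \<subseteq> L2 ?P \<times> L2 ?P"
    unfolding Q_def by (auto intro!: L2_add b dest: mult_domD)
  have Qconv: "((\<lambda>x. u1 x + of_real t * (v1 x - u1 x)), (\<lambda>x. u2 x + of_real t * (v2 x - u2 x))) \<in> Q"
    if u: "(u1, u2) \<in> Q" and v: "(v1, v2) \<in> Q" and t: "0 < t" "t < 1" for u1 u2 v1 v2 t
  proof -
    obtain k r1 r2 where k: "k \<in> mult_dom M1 M2 \<phi>" "r1 \<in> L2 ?P" "r2 \<in> L2 ?P" "?n (?I r1) \<le> \<delta>" "?n (?I r2) \<le> \<delta>"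
      and u12: "u1 = (\<lambda>z. k z + r1 z)" "u2 = (\<lambda>z. b z + \<phi> z * k z + r2 z)"
      using u unfolding Q_def by blast
    obtain k' r1' r2' where k': "k' \<in> mult_dom M1 M2 \<phi>" "r1' \<in> L2 ?P" "r2' \<in> L2 ?P" "?n (?I r1') \<le> \<delta>" "?n (?I r2') \<le> \<delta>"
      and v12: "v1 = (\<lambda>z. k' z + r1' z)" "v2 = (\<lambda>z. b z + \<phi> z * k' z + r2' z)"
      using v unfolding Q_def by blast
    let ?t = "complex_of_real t" and ?s = "complex_of_real (1 - t)"
    have cn: "?n (?I (\<lambda>z. ?s * r z + ?t * r' z)) \<le> \<delta>"
      if r: "r \<in> L2 ?P" "?n (?I r) \<le> \<delta>" and r': "r' \<in> L2 ?P" "?n (?I r') \<le> \<delta>" for r r'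
    proof -
      have "?n (?I (\<lambda>z. ?s * r z + ?t * r' z)) \<le> ?n (?I (\<lambda>z. ?s * r z)) + ?n (?I (\<lambda>z. ?t * r' z))"
        by (intro op_norm_int_op_add L2_cmult r r')
      also have "\<dots> \<le> norm ?s * ?n (?I r) + norm ?t * ?n (?I r')"
        by (intro add_mono op_norm_int_op_cmult r r')
      also have "\<dots> \<le> norm ?s * \<delta> + norm ?t * \<delta>"
        by (intro add_mono mult_left_mono r r') auto
      also have "\<dots> = \<delta>" using t unfolding norm_of_real by (simp add: algebra_simps)
      finally show ?thesis .
    qed
    have "(\<lambda>z. (?s * k z + ?t * k' z) + (?s * r1 z + ?t * r1' z),
        \<lambda>z. b z + \<phi> z * (?s * k z + ?t * k' z) + (?s * r2 z + ?t * r2' z)) \<in> Q"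
      by (intro QI mult_dom_add mult_dom_cmult L2_add L2_cmult cn k k')
    then show ?thesis unfolding u12 v12 by (simp add: algebra_simps)
  qed
  have Qfar: "\<delta>\<^sup>2 \<le> (L2_norm ?P u1)\<^sup>2 + (L2_norm ?P u2)\<^sup>2" if "(u1, u2) \<in> Q" for u1 u2
  proof (rule ccontr)
    obtain k r1 r2 where k: "k \<in> mult_dom M1 M2 \<phi>" and r1: "r1 \<in> L2 ?P" "?n (?I r1) \<le> \<delta>" and r2: "r2 \<in> L2 ?P" "?n (?I r2) \<le> \<delta>"
      and u12: "u1 = (\<lambda>z. k z + r1 z)" "u2 = (\<lambda>z. b z + \<phi> z * k z + r2 z)"
      using \<open>(u1, u2) \<in> Q\<close> unfolding Q_def by blast
    have u: "u1 \<in> L2 ?P" "u2 \<in> L2 ?P" using Qsub \<open>(u1, u2) \<in> Q\<close> by auto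
    assume "\<not> \<delta>\<^sup>2 \<le> (L2_norm ?P u1)\<^sup>2 + (L2_norm ?P u2)\<^sup>2"
    then have "(L2_norm ?P u1)\<^sup>2 < \<delta>\<^sup>2" "(L2_norm ?P u2)\<^sup>2 < \<delta>\<^sup>2"
      using zero_le_power2[of "L2_norm ?P u1"] zero_le_power2[of "L2_norm ?P u2"] by linarith+
    then have un: "L2_norm ?P u1 < \<delta>" "L2_norm ?P u2 < \<delta>" using \<delta> by (auto intro: power2_less_imp_less)
    have diff: "?n (?I (\<lambda>z. u z - r z)) < 2 * \<delta>" if "u \<in> L2 ?P" "L2_norm ?P u < \<delta>" "r \<in> L2 ?P" "?n (?I r) \<le> \<delta>" for u r
      using op_norm_int_op_add[OF that(1) L2_cmult[OF that(3), of "-1"]] op_norm_int_op_cmult[OF that(3), of "-1"]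
        op_norm_int_op_le[OF that(1)] that by simp
    \<comment> \<open>the sign turns a small element of the translated graph into a good approximation of \<open>(0, B)\<close>\<close>
    let ?k = "\<lambda>z. -1 * k z"
    have k': "?k \<in> mult_dom M1 M2 \<phi>" by (rule mult_dom_cmult[OF k])
    have "(\<lambda>f y. zero_op f y - ?I ?k f y) = ?I (\<lambda>z. u1 z - r1 z)"
      by (simp add: zero_op_def u12 int_op_def fun_eq_iff)
    then have "?n (\<lambda>f y. zero_op f y - ?I ?k f y) < \<epsilon>"
      using diff[OF u(1) un(1) r1] \<epsilon> by (simp add: \<delta>_def)
    moreover have "?n (\<lambda>f y. B f y - ?I (\<lambda>z. \<phi> z * ?k z) f y) < \<epsilon>"
    proof -
      have \<phi>k: "(\<lambda>z. \<phi> z * ?k z) \<in> L2 ?P" by (rule mult_domD(2)[OF k'])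
      have "?n (\<lambda>f y. B f y - ?I (\<lambda>z. \<phi> z * ?k z) f y) \<le> ?n (\<lambda>f y. B f y - ?I b f y) + ?n (\<lambda>f y. ?I b f y - ?I (\<lambda>z. \<phi> z * ?k z) f y)"
        by (intro op_norm_diff_triangle BB int_op_bounded b \<phi>k)
      also have "?n (\<lambda>f y. ?I b f y - ?I (\<lambda>z. \<phi> z * ?k z) f y) = ?n (?I (\<lambda>z. u2 z - r2 z))"
        unfolding op_norm_int_op_diff[OF b \<phi>k] by (simp add: u12)
      also have "\<dots> < 2 * \<delta>" by (rule diff[OF u(2) un(2) r2])
      finally show ?thesis using Bb \<epsilon> by (simp add: \<delta>_def)
    qed
    ultimately show False using far[OF k'] by blast
  qed
  have Qne: "Q \<noteq> {}" using QI[OF mult_dom_zero L2_zero L2_zero n0 n0] by blast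
  have \<delta>2: "0 < \<delta>\<^sup>2" using \<delta> by simp
  obtain h1' h2' m where h': "h1' \<in> L2 ?P" "h2' \<in> L2 ?P" and m: "0 < m"
    and sep': "\<And>u1 u2. (u1, u2) \<in> Q \<Longrightarrow> m \<le> Re (L2_inner ?P u1 h1' + L2_inner ?P u2 h2')"
    by (rule L2_pair_separation[OF Qsub Qne Qconv Qfar \<delta>2]) blast+
  define h1 h2 where "h1 z = cnj (h1' z)" and "h2 z = cnj (h2' z)" for z
  have h1: "h1 \<in> L2 ?P" and h2: "h2 \<in> L2 ?P" unfolding h1_def h2_def by (intro L2_cnj h')+
  define F1 F2 where "F1 u = (\<integral>z. u z * h1 z \<partial>?P)" and "F2 u = (\<integral>z. u z * h2 z \<partial>?P)" for u
  have F1_add: "F1 (\<lambda>z. u z + v z) = F1 u + F1 v" if "u \<in> L2 ?P" "v \<in> L2 ?P" for u v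
    unfolding F1_def using L2_mult_integrable[OF that(1) h1] L2_mult_integrable[OF that(2) h1] by (simp add: distrib_right)
  have F2_add: "F2 (\<lambda>z. u z + v z) = F2 u + F2 v" if "u \<in> L2 ?P" "v \<in> L2 ?P" for u v
    unfolding F2_def using L2_mult_integrable[OF that(1) h2] L2_mult_integrable[OF that(2) h2] by (simp add: distrib_right)
  have F_cmult: "F1 (\<lambda>z. c * u z) = c * F1 u" "F2 (\<lambda>z. c * u z) = c * F2 u" for c u
    unfolding F1_def F2_def by (simp_all add: mult.assoc)
  have sep: "m \<le> Re (F1 k + F1 r1 + (F2 b + F2 (\<lambda>z. \<phi> z * k z) + F2 r2))"
    if k: "k \<in> mult_dom M1 M2 \<phi>" and r: "r1 \<in> L2 ?P" "r2 \<in> L2 ?P" "?n (?I r1) \<le> \<delta>" "?n (?I r2) \<le> \<delta>" for k r1 r2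
  proof -
    have "L2_inner ?P (\<lambda>z. k z + r1 z) h1' = F1 k + F1 r1"
      using F1_add[OF mult_domD(1)[OF k] r(1)] by (simp add: L2_inner_def F1_def h1_def)
    moreover have "L2_inner ?P (\<lambda>z. b z + \<phi> z * k z + r2 z) h2' = F2 b + F2 (\<lambda>z. \<phi> z * k z) + F2 r2"
      using F2_add[OF L2_add[OF b mult_domD(2)[OF k]] r(2)] F2_add[OF b mult_domD(2)[OF k]]
      by (simp add: L2_inner_def F2_def h2_def)
    ultimately show ?thesis using sep'[OF QI[OF k r]] by simp
  qed
  have F0: "F1 (\<lambda>z. 0) = 0" "F2 (\<lambda>z. 0) = 0" by (simp_all add: F1_def F2_def)
  \<comment> \<open>a functional that is bounded below on a linear subspace vanishes there\<close>
  have graph0: "F1 k + F2 (\<lambda>z. \<phi> z * k z) = 0" if k: "k \<in> mult_dom M1 M2 \<phi>" for k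
  proof (rule ccontr)
    define L where "L = F1 k + F2 (\<lambda>z. \<phi> z * k z)"
    assume "F1 k + F2 (\<lambda>z. \<phi> z * k z) \<noteq> 0"
    then have L: "0 < (norm L)\<^sup>2" by (simp add: L_def)
    define t where "t = (\<bar>Re (F2 b)\<bar> + 1) / (norm L)\<^sup>2"
    define c where "c = - complex_of_real t * cnj L"
    have "m \<le> Re (F1 (\<lambda>z. c * k z) + F1 (\<lambda>z. 0) + (F2 b + F2 (\<lambda>z. \<phi> z * (c * k z)) + F2 (\<lambda>z. 0)))"
      by (rule sep[OF mult_dom_cmult[OF k] L2_zero L2_zero n0 n0])
    also have "(\<lambda>z. \<phi> z * (c * k z)) = (\<lambda>z. c * (\<phi> z * k z))" by (simp add: mult.left_commute)
    also have "F1 (\<lambda>z. c * k z) + F1 (\<lambda>z. 0) + (F2 b + F2 (\<lambda>z. c * (\<phi> z * k z)) + F2 (\<lambda>z. 0)) = F2 b + c * L"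
      unfolding F_cmult F0 L_def by (simp add: algebra_simps)
    also have "c * L = - complex_of_real (t * (norm L)\<^sup>2)"
    proof -
      have "cnj L * L = complex_of_real ((norm L)\<^sup>2)" by (simp only: complex_norm_square mult.commute)
      then show ?thesis by (simp only: c_def mult.assoc) simp
    qed
    also have "t * (norm L)\<^sup>2 = \<bar>Re (F2 b)\<bar> + 1" using L by (simp add: t_def)
    finally have "m \<le> Re (F2 b) - (\<bar>Re (F2 b)\<bar> + 1)" by simp
    then show False using m by simp
  qed
  define \<beta> where "\<beta> = Re (F2 b)"
  have b1: "- Re (\<integral>z. r z * h1 z \<partial>?P) \<le> \<beta>" if "r \<in> L2 ?P" "?n (?I r) \<le> \<delta>" for r
    using sep[OF mult_dom_zero that(1) L2_zero that(2) n0] m F0 unfolding F1_def[symmetric] \<beta>_def by simp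
  have b2: "- Re (\<integral>z. r z * h2 z \<partial>?P) \<le> \<beta>" if "r \<in> L2 ?P" "?n (?I r) \<le> \<delta>" for r
    using sep[OF mult_dom_zero L2_zero that(1) n0 that(2)] m F0 unfolding F2_def[symmetric] \<beta>_def by simp
  have "0 \<le> \<beta>" using b1[OF L2_zero n0] by simp
  then have \<beta>\<delta>: "0 \<le> \<beta> / \<delta>" using \<delta> by simp
  obtain \<sigma> where \<sigma>: "\<sigma> \<in> trace_class M1 M2" "\<And>k. k \<in> L2 ?P \<Longrightarrow> trace_pairing M2 (?I k) \<sigma> = F1 k"
    unfolding F1_def by (rule trace_class_representation[OF h1 \<beta>\<delta> functional_bound_of_ball[OF h1 \<delta> b1]]) blast+
  obtain \<tau> where \<tau>: "\<tau> \<in> trace_class M1 M2" "\<And>k. k \<in> L2 ?P \<Longrightarrow> trace_pairing M2 (?I k) \<tau> = F2 k"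
    unfolding F2_def by (rule trace_class_representation[OF h2 \<beta>\<delta> functional_bound_of_ball[OF h2 \<delta> b2]]) blast+
  have B0: "trace_pairing M2 B \<tau> = 0"
    by (rule ann[OF \<sigma>(1) \<tau>(1)]) (simp add: \<sigma>(2) \<tau>(2) mult_domD graph0)
  \<comment> \<open>\<open>B\<close> itself has no kernel, so its pairing is estimated through a better approximation \<open>b'\<close> than \<open>b\<close>\<close>
  define K where "K = trace_bound M1 M2 \<tau> + 1"
  have K: "0 < K" unfolding K_def using trace_bound_nonneg[OF \<tau>(1)] by simp
  obtain b' where b': "b' \<in> L2 ?P" and Bb': "?n (\<lambda>f y. B f y - ?I b' f y) < min (\<delta> / 2) (m / K)"
    using approx[of "min (\<delta> / 2) (m / K)"] \<delta> m K by auto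
  have "?n (?I (\<lambda>z. b' z - b z)) \<le> ?n (\<lambda>f y. ?I b' f y - B f y) + ?n (\<lambda>f y. B f y - ?I b f y)"
    unfolding op_norm_int_op_diff[OF b' b, symmetric] by (intro op_norm_diff_triangle BB int_op_bounded b b')
  also have "\<dots> \<le> \<delta>" using Bb Bb' by (simp add: op_norm_minus_commute[of _ _ _ B])
  finally have "m \<le> Re (F2 b + F2 (\<lambda>z. b' z - b z))"
    using sep[OF mult_dom_zero L2_zero L2_diff[OF b' b] n0] F0 by simp
  then have "m \<le> Re (F2 b')" using F2_add[OF b L2_diff[OF b' b]] by simp
  also have "\<dots> \<le> norm (trace_pairing M2 (?I b') \<tau>)" unfolding \<tau>(2)[OF b'] by (rule complex_Re_le_cmod)
  also have "\<dots> \<le> ?n (\<lambda>f y. B f y - ?I b' f y) * trace_bound M1 M2 \<tau>"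
    using trace_pairing_diff_bound[OF BB int_op_bounded[OF b'] \<tau>(1)] B0 by simp
  also have "\<dots> \<le> m / K * trace_bound M1 M2 \<tau>"
    using Bb' by (intro mult_right_mono trace_bound_nonneg[OF \<tau>(1)]) simp
  also have "\<dots> < m" using m K by (simp add: field_simps K_def)
  finally show False by simp
qed

end

section \<open>The weak* closure of the graph\<close>

lemma topspace_weak_star [simp]: "topspace (weak_star M N) = bounded_ops M N"
  by (auto simp: weak_star_def topspace_pullback_topology)

lemma continuous_map_trace_pairing:
  assumes "\<tau> \<in> trace_class M N"
  shows "continuous_map (weak_star M N) euclidean (\<lambda>T. trace_pairing N T \<tau>)"
proof -
  have "continuous_map (weak_star M N) euclidean ((\<lambda>x. x \<tau>) \<circ> (\<lambda>T. restrict (trace_pairing N T) (trace_class M N)))"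
    unfolding weak_star_def
    by (intro continuous_map_pullback continuous_map_product_projection assms)
  then show ?thesis using assms by (simp add: comp_def)
qed

lemma openin_weak_star_basis:
  assumes U: "openin (weak_star M N) U" and A: "A \<in> U"
  obtains H e where "finite H" "H \<subseteq> trace_class M N" "0 < e"
    "\<And>T. T \<in> bounded_ops M N \<Longrightarrow> (\<And>\<tau>. \<tau> \<in> H \<Longrightarrow> norm (trace_pairing N A \<tau> - trace_pairing N T \<tau>) < e) \<Longrightarrow> T \<in> U"
proof -
  let ?r = "\<lambda>T. restrict (trace_pairing N T) (trace_class M N)"
  obtain V where V: "openin (product_topology (\<lambda>_. euclidean) (trace_class M N)) V" "U = ?r -` V \<inter> bounded_ops M N"
    using U unfolding weak_star_def openin_pullback_topology by blast
  have "?r A \<in> V" using A V by simp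
  then obtain W :: "_ \<Rightarrow> complex set" where W: "finite {\<tau> \<in> trace_class M N. W \<tau> \<noteq> UNIV}" "\<And>\<tau>. \<tau> \<in> trace_class M N \<Longrightarrow> open (W \<tau>)"
      "?r A \<in> PiE (trace_class M N) W" "PiE (trace_class M N) W \<subseteq> V"
    using V(1) unfolding openin_product_topology_alt by auto
  define H where "H = {\<tau> \<in> trace_class M N. W \<tau> \<noteq> UNIV}"
  have "\<exists>e>0. ball (trace_pairing N A \<tau>) e \<subseteq> W \<tau>" if "\<tau> \<in> H" for \<tau>
  proof -
    have "trace_pairing N A \<tau> \<in> W \<tau>" using W(3) that by (auto simp: H_def PiE_iff)
    then show ?thesis using W(2)[of \<tau>] that by (auto simp: H_def open_contains_ball)
  qed
  then obtain d where d: "\<And>\<tau>. \<tau> \<in> H \<Longrightarrow> 0 < d \<tau>" "\<And>\<tau>. \<tau> \<in> H \<Longrightarrow> ball (trace_pairing N A \<tau>) (d \<tau>) \<subseteq> W \<tau>"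
    by metis
  define e where "e = Min (insert 1 (d ` H))"
  have fin: "finite H" using W(1) by (simp add: H_def)
  show thesis
  proof (rule that[OF fin, of e])
    show "H \<subseteq> trace_class M N" by (auto simp: H_def)
    show "0 < e" unfolding e_def using fin d(1) by (subst Min_gr_iff) auto
    fix T assume T: "T \<in> bounded_ops M N" and close: "\<And>\<tau>. \<tau> \<in> H \<Longrightarrow> norm (trace_pairing N A \<tau> - trace_pairing N T \<tau>) < e"
    have "trace_pairing N T \<tau> \<in> W \<tau>" if \<tau>: "\<tau> \<in> trace_class M N" for \<tau>
    proof (cases "\<tau> \<in> H")
      case True
      have "e \<le> d \<tau>" unfolding e_def using fin True by (intro Min_le) auto
      then show ?thesis using close[OF True] d(2)[OF True] by (auto simp: dist_norm)
    next
      case False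
      then show ?thesis using \<tau> by (simp add: H_def)
    qed
    then have "?r T \<in> PiE (trace_class M N) W" by auto
    then have "?r T \<in> V" by (rule subsetD[OF W(4)])
    then show "T \<in> U" using V(2) T by simp
  qed
qed

abbreviation wstar_graph :: "'a measure \<Rightarrow> 'b measure \<Rightarrow> ('a \<times> 'b \<Rightarrow> complex) \<Rightarrow> (('a, 'b) oper \<times> ('a, 'b) oper) set" where
  "wstar_graph M N \<phi> \<equiv> prod_topology (weak_star M N) (weak_star M N) closure_of mult_graph M N \<phi>"

lemma wstar_graph_bounded:
  assumes "(A, B) \<in> wstar_graph M N \<phi>"
  shows "A \<in> bounded_ops M N" "B \<in> bounded_ops M N"
  using assms closure_of_subset_topspace[of "prod_topology (weak_star M N) (weak_star M N)" "mult_graph M N \<phi>"]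
  by auto

lemma wstar_graphD:
  assumes AB: "(A, B) \<in> wstar_graph M N \<phi>" and H: "finite H" "H \<subseteq> trace_class M N" and e: "0 < e"
  obtains k where "k \<in> mult_dom M N \<phi>"
    "\<And>\<tau>. \<tau> \<in> H \<Longrightarrow> norm (trace_pairing N A \<tau> - trace_pairing N (int_op M k) \<tau>) < e"
    "\<And>\<tau>. \<tau> \<in> H \<Longrightarrow> norm (trace_pairing N B \<tau> - trace_pairing N (int_op M (\<lambda>z. \<phi> z * k z)) \<tau>) < e"
proof -
  let ?X = "prod_topology (weak_star M N) (weak_star M N)"
  have top: "topspace ?X = bounded_ops M N \<times> bounded_ops M N" by simp
  define U where "U = (\<Inter>\<tau>\<in>H. {p \<in> topspace ?X. trace_pairing N (fst p) \<tau> \<in> ball (trace_pairing N A \<tau>) e} \<inter>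
      {p \<in> topspace ?X. trace_pairing N (snd p) \<tau> \<in> ball (trace_pairing N B \<tau>) e}) \<inter> topspace ?X"
  have "openin ?X U"
    unfolding U_def
  proof (intro openin_INT H openin_Int openin_continuous_map_preimage[where Y=euclidean])
    fix \<tau> assume "\<tau> \<in> H"
    then have \<tau>: "\<tau> \<in> trace_class M N" using H by blast
    show "continuous_map ?X euclidean (\<lambda>p. trace_pairing N (fst p) \<tau>)"
      using continuous_map_compose[OF continuous_map_fst continuous_map_trace_pairing[OF \<tau>]] by (simp add: comp_def)
    show "continuous_map ?X euclidean (\<lambda>p. trace_pairing N (snd p) \<tau>)"
      using continuous_map_compose[OF continuous_map_snd continuous_map_trace_pairing[OF \<tau>]] by (simp add: comp_def)
  qed auto
  moreover have "(A, B) \<in> U" using wstar_graph_bounded[OF AB] e by (simp add: U_def)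
  ultimately obtain p where "p \<in> mult_graph M N \<phi>" "p \<in> U"
    using AB unfolding in_closure_of by blast
  then show thesis using that unfolding mult_graph_def U_def by (auto simp: dist_norm)
qed

context pair_sigma_finite
begin

lemma wstar_graphI:
  assumes A: "A \<in> bounded_ops M1 M2" and B: "B \<in> bounded_ops M1 M2"
    and approx: "\<And>H e. finite H \<Longrightarrow> H \<subseteq> trace_class M1 M2 \<Longrightarrow> 0 < e \<Longrightarrow> \<exists>k\<in>mult_dom M1 M2 \<phi>. \<forall>\<tau>\<in>H.
      norm (trace_pairing M2 A \<tau> - trace_pairing M2 (int_op M1 k) \<tau>) < e \<and>
      norm (trace_pairing M2 B \<tau> - trace_pairing M2 (int_op M1 (\<lambda>z. \<phi> z * k z)) \<tau>) < e"
  shows "(A, B) \<in> wstar_graph M1 M2 \<phi>"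
  unfolding in_closure_of
proof (intro conjI allI impI)
  show "(A, B) \<in> topspace (prod_topology (weak_star M1 M2) (weak_star M1 M2))" using A B by simp
  fix S assume "(A, B) \<in> S \<and> openin (prod_topology (weak_star M1 M2) (weak_star M1 M2)) S"
  then obtain U V where U: "openin (weak_star M1 M2) U" "A \<in> U" and V: "openin (weak_star M1 M2) V" "B \<in> V" and UV: "U \<times> V \<subseteq> S"
    unfolding openin_prod_topology_alt by blast
  obtain H e where H: "finite H" "H \<subseteq> trace_class M1 M2" "0 < e"
    "\<And>T. T \<in> bounded_ops M1 M2 \<Longrightarrow> (\<And>\<tau>. \<tau> \<in> H \<Longrightarrow> norm (trace_pairing M2 A \<tau> - trace_pairing M2 T \<tau>) < e) \<Longrightarrow> T \<in> U"
    by (rule openin_weak_star_basis[OF U]) blast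
  obtain H' e' where H': "finite H'" "H' \<subseteq> trace_class M1 M2" "0 < e'"
    "\<And>T. T \<in> bounded_ops M1 M2 \<Longrightarrow> (\<And>\<tau>. \<tau> \<in> H' \<Longrightarrow> norm (trace_pairing M2 B \<tau> - trace_pairing M2 T \<tau>) < e') \<Longrightarrow> T \<in> V"
    by (rule openin_weak_star_basis[OF V]) blast
  obtain k where k: "k \<in> mult_dom M1 M2 \<phi>" "\<And>\<tau>. \<tau> \<in> H \<union> H' \<Longrightarrow>
      norm (trace_pairing M2 A \<tau> - trace_pairing M2 (int_op M1 k) \<tau>) < min e e' \<and>
      norm (trace_pairing M2 B \<tau> - trace_pairing M2 (int_op M1 (\<lambda>z. \<phi> z * k z)) \<tau>) < min e e'"
    using approx[of "H \<union> H'" "min e e'"] H(1-3) H'(1-3) by auto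
  have "int_op M1 k \<in> U"
    by (rule H(4)) (use k mult_domD[OF k(1)] in auto)
  moreover have "int_op M1 (\<lambda>z. \<phi> z * k z) \<in> V"
    by (rule H'(4)) (use k mult_domD[OF k(1)] in auto)
  ultimately show "\<exists>y. y \<in> mult_graph M1 M2 \<phi> \<and> y \<in> S"
    using UV k(1) unfolding mult_graph_def by blast
qed

lemma norm_closure_subset_wstar_graph: "norm_closure M1 M2 (mult_graph M1 M2 \<phi>) \<subseteq> wstar_graph M1 M2 \<phi>"
proof safe
  fix A B assume AB: "(A, B) \<in> norm_closure M1 M2 (mult_graph M1 M2 \<phi>)"
  then have bd: "A \<in> bounded_ops M1 M2" "B \<in> bounded_ops M1 M2"
    by (auto simp: norm_closure_def dest: compact_ops_bounded)
  show "(A, B) \<in> wstar_graph M1 M2 \<phi>"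
  proof (rule wstar_graphI[OF bd])
    fix H e assume H: "finite H" "H \<subseteq> trace_class M1 M2" and e: "0 < (e::real)"
    define K where "K = (\<Sum>\<tau>\<in>H. trace_bound M1 M2 \<tau>) + 1"
    have nn: "0 \<le> (\<Sum>\<tau>\<in>H. trace_bound M1 M2 \<tau>)" using H by (intro sum_nonneg trace_bound_nonneg) auto
    then have K: "0 < K" by (simp add: K_def)
    have "\<exists>(S, T)\<in>mult_graph M1 M2 \<phi>. op_norm M1 M2 (\<lambda>f y. A f y - S f y) < e / K \<and> op_norm M1 M2 (\<lambda>f y. B f y - T f y) < e / K"
      using AB e K unfolding norm_closure_def by simp
    then obtain k where k: "k \<in> mult_dom M1 M2 \<phi>" "op_norm M1 M2 (\<lambda>f y. A f y - int_op M1 k f y) < e / K"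
        "op_norm M1 M2 (\<lambda>f y. B f y - int_op M1 (\<lambda>z. \<phi> z * k z) f y) < e / K"
      unfolding mult_graph_def by auto
    have small: "norm (trace_pairing M2 R \<tau> - trace_pairing M2 (int_op M1 l) \<tau>) < e"
      if \<tau>: "\<tau> \<in> H" and R: "R \<in> bounded_ops M1 M2" and l: "l \<in> L2 (M1 \<Otimes>\<^sub>M M2)"
        and Rl: "op_norm M1 M2 (\<lambda>f y. R f y - int_op M1 l f y) < e / K" for R l \<tau>
    proof -
      have tb: "trace_bound M1 M2 \<tau> \<le> (\<Sum>\<tau>\<in>H. trace_bound M1 M2 \<tau>)"
        using H \<tau> by (intro member_le_sum trace_bound_nonneg) auto
      have \<tau>t: "\<tau> \<in> trace_class M1 M2" using \<tau> H by blast
      have "norm (trace_pairing M2 R \<tau> - trace_pairing M2 (int_op M1 l) \<tau>) \<le>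
          op_norm M1 M2 (\<lambda>f y. R f y - int_op M1 l f y) * trace_bound M1 M2 \<tau>"
        by (rule trace_pairing_diff_bound[OF R int_op_bounded[OF l] \<tau>t])
      also have "\<dots> \<le> e / K * (\<Sum>\<tau>\<in>H. trace_bound M1 M2 \<tau>)"
        using Rl e K by (intro mult_mono tb trace_bound_nonneg[OF \<tau>t]) auto
      also have "\<dots> < e" using K e by (simp add: field_simps K_def)
      finally show ?thesis .
    qed
    show "\<exists>k\<in>mult_dom M1 M2 \<phi>. \<forall>\<tau>\<in>H. norm (trace_pairing M2 A \<tau> - trace_pairing M2 (int_op M1 k) \<tau>) < e \<and>
        norm (trace_pairing M2 B \<tau> - trace_pairing M2 (int_op M1 (\<lambda>z. \<phi> z * k z)) \<tau>) < e"
      using k small bd mult_domD[OF k(1)] by blast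
  qed
qed

lemma trace_pairing_int_op_diff:
  assumes k: "k \<in> L2 (M1 \<Otimes>\<^sub>M M2)" and k': "k' \<in> L2 (M1 \<Otimes>\<^sub>M M2)" and \<tau>: "\<tau> \<in> trace_class M1 M2"
  shows "trace_pairing M2 (int_op M1 (\<lambda>z. k z - k' z)) \<tau> = trace_pairing M2 (int_op M1 k) \<tau> - trace_pairing M2 (int_op M1 k') \<tau>"
proof -
  have "op_eq M1 M2 (int_op M1 (\<lambda>z. k z - k' z)) (\<lambda>f y. int_op M1 k f y - int_op M1 k' f y)"
    unfolding op_eq_def using int_op_AE_diff[OF k k'] by blast
  then show ?thesis
    using op_eq_trace_pairing[OF int_op_bounded[OF L2_diff[OF k k']] bounded_ops_op_diff[OF int_op_bounded[OF k] int_op_bounded[OF k']] \<tau>]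
      trace_pairing_diff[OF int_op_bounded[OF k] int_op_bounded[OF k'] \<tau>] by simp
qed

text \<open>Linearity of the closure, in the form that reduces single-valuedness to the fibre over zero.\<close>

lemma wstar_graph_diff:
  assumes AB: "(A, B) \<in> wstar_graph M1 M2 \<phi>" and AB': "(A', B') \<in> wstar_graph M1 M2 \<phi>" and eq: "op_eq M1 M2 A A'"
  shows "(zero_op, \<lambda>f y. B f y - B' f y) \<in> wstar_graph M1 M2 \<phi>"
proof (rule wstar_graphI)
  note b = wstar_graph_bounded[OF AB] and b' = wstar_graph_bounded[OF AB']
  show "zero_op \<in> bounded_ops M1 M2" by simp
  show "(\<lambda>f y. B f y - B' f y) \<in> bounded_ops M1 M2" by (intro bounded_ops_op_diff b b')
  fix H e assume H: "finite H" "H \<subseteq> trace_class M1 M2" and e: "0 < (e::real)"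
  then have e2: "0 < e / 2" by simp
  obtain k where k: "k \<in> mult_dom M1 M2 \<phi>"
    "\<And>\<tau>. \<tau> \<in> H \<Longrightarrow> norm (trace_pairing M2 A \<tau> - trace_pairing M2 (int_op M1 k) \<tau>) < e / 2"
    "\<And>\<tau>. \<tau> \<in> H \<Longrightarrow> norm (trace_pairing M2 B \<tau> - trace_pairing M2 (int_op M1 (\<lambda>z. \<phi> z * k z)) \<tau>) < e / 2"
    by (rule wstar_graphD[OF AB H e2]) blast
  obtain k' where k': "k' \<in> mult_dom M1 M2 \<phi>"
    "\<And>\<tau>. \<tau> \<in> H \<Longrightarrow> norm (trace_pairing M2 A' \<tau> - trace_pairing M2 (int_op M1 k') \<tau>) < e / 2"
    "\<And>\<tau>. \<tau> \<in> H \<Longrightarrow> norm (trace_pairing M2 B' \<tau> - trace_pairing M2 (int_op M1 (\<lambda>z. \<phi> z * k' z)) \<tau>) < e / 2"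
    by (rule wstar_graphD[OF AB' H e2]) blast
  note d = mult_domD[OF k(1)] and d' = mult_domD[OF k'(1)]
  show "\<exists>k\<in>mult_dom M1 M2 \<phi>. \<forall>\<tau>\<in>H. norm (trace_pairing M2 zero_op \<tau> - trace_pairing M2 (int_op M1 k) \<tau>) < e \<and>
      norm (trace_pairing M2 (\<lambda>f y. B f y - B' f y) \<tau> - trace_pairing M2 (int_op M1 (\<lambda>z. \<phi> z * k z)) \<tau>) < e"
  proof (intro bexI[OF _ mult_dom_diff[OF k(1) k'(1)]] ballI conjI)
    fix \<tau> assume \<tau>H: "\<tau> \<in> H"
    then have \<tau>: "\<tau> \<in> trace_class M1 M2" using H by blast
    have tri: "norm (a - b - (c - d)) < e" if "norm (a - c) < e / 2" "norm (b - d) < e / 2" for a b c d :: complex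
    proof -
      have eq: "a - b - (c - d) = (a - c) - (b - d)" by simp
      show ?thesis unfolding eq using norm_triangle_ineq4[of "a - c" "b - d"] that by simp
    qed
    have "trace_pairing M2 zero_op \<tau> = trace_pairing M2 A \<tau> - trace_pairing M2 A' \<tau>"
      using op_eq_trace_pairing[OF b(1) b'(1) \<tau> eq] by (simp add: trace_pairing_def zero_op_def)
    then show "norm (trace_pairing M2 zero_op \<tau> - trace_pairing M2 (int_op M1 (\<lambda>z. k z - k' z)) \<tau>) < e"
      unfolding trace_pairing_int_op_diff[OF d(1) d'(1) \<tau>] using tri[OF k(2) k'(2), OF \<tau>H \<tau>H] by simp
    have "(\<lambda>z. \<phi> z * (k z - k' z)) = (\<lambda>z. \<phi> z * k z - \<phi> z * k' z)" by (simp add: right_diff_distrib)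
    then show "norm (trace_pairing M2 (\<lambda>f y. B f y - B' f y) \<tau> - trace_pairing M2 (int_op M1 (\<lambda>z. \<phi> z * (k z - k' z))) \<tau>) < e"
      using trace_pairing_int_op_diff[OF d(2) d'(2) \<tau>] trace_pairing_diff[OF b(2) b'(2) \<tau>]
        tri[OF k(3) k'(3), OF \<tau>H \<tau>H] by simp
  qed
qed

end

text \<open>The fibre over zero of the weak* closure of the graph, which is trivial iff the closure is the graph
  of an operator.\<close>

definition wstar_multivalued_part :: "'a measure \<Rightarrow> 'b measure \<Rightarrow> ('a \<times> 'b \<Rightarrow> complex) \<Rightarrow> ('a, 'b) oper set" where
  "wstar_multivalued_part M N \<phi> = {B. (zero_op, B) \<in> wstar_graph M N \<phi>}"

lemma LinftyD:
  assumes "a \<in> Linfty M"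
  obtains C where "0 \<le> C" "AE x in M. norm (a x) \<le> C" "a \<in> borel_measurable M"
proof -
  obtain C where C: "AE x in M. norm (a x) \<le> C" and m: "a \<in> borel_measurable M"
    using assms unfolding Linfty_def by blast
  have "AE x in M. norm (a x) \<le> max 0 C" using C by eventually_elim simp
  then show thesis using that[of "max 0 C"] m by simp
qed

lemma mult_op_L2:
  assumes a: "a \<in> Linfty M" and f: "f \<in> L2 M"
  shows "mult_op a f \<in> L2 M"
proof -
  obtain C where C: "0 \<le> C" "AE x in M. norm (a x) \<le> C" "a \<in> borel_measurable M" by (rule LinftyD[OF a])
  have "AE x in M. norm (a x * f x) \<le> C * norm (f x)"
    using C(2) by eventually_elim (simp add: norm_mult mult_right_mono)
  then show ?thesis unfolding mult_op_def
    by (intro L2_dominated[OF _ f] borel_measurable_times C L2_measurable[OF f])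
qed

lemma mult_op_norm_bound:
  assumes a: "a \<in> Linfty M"
  obtains C where "0 \<le> C" "\<And>f. f \<in> L2 M \<Longrightarrow> L2_norm M (mult_op a f) \<le> C * L2_norm M f"
proof -
  obtain C where C: "0 \<le> C" "AE x in M. norm (a x) \<le> C" "a \<in> borel_measurable M" by (rule LinftyD[OF a])
  have "L2_norm M (mult_op a f) \<le> C * L2_norm M f" if f: "f \<in> L2 M" for f
  proof -
    have "AE x in M. norm (mult_op a f x) \<le> norm (complex_of_real C * f x)"
      using C(2) by eventually_elim (simp add: mult_op_def norm_mult C(1) mult_right_mono)
    then have "L2_norm M (mult_op a f) \<le> L2_norm M (\<lambda>x. complex_of_real C * f x)"
      by (intro L2_norm_mono L2_measurable[OF mult_op_L2[OF a f]] L2_cmult f)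
    then show ?thesis using C(1) by (simp add: L2_norm_cmult)
  qed
  then show thesis using that C(1) by blast
qed

lemma mult_op_bounded [intro]:
  assumes a: "a \<in> Linfty M" shows "mult_op a \<in> bounded_ops M M"
proof -
  obtain C where C: "\<And>f. f \<in> L2 M \<Longrightarrow> L2_norm M (mult_op a f) \<le> C * L2_norm M f"
    by (rule mult_op_norm_bound[OF a]) blast
  show ?thesis
    by (rule bounded_opsI[OF mult_op_L2[OF a] _ _ C]) (auto simp: mult_op_def distrib_left mult.left_commute)
qed

lemma bounded_ops_comp:
  assumes S: "S \<in> bounded_ops N K" and T: "T \<in> bounded_ops M N"
  shows "S \<circ> T \<in> bounded_ops M K"
proof (rule bounded_opsI)
  fix f g c assume f: "f \<in> L2 M"
  note Tf = bounded_ops_L2[OF T f]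
  show "(S \<circ> T) f \<in> L2 K" using bounded_ops_L2[OF S Tf] by simp
  have "AE y in K. S (T (\<lambda>x. c * f x)) y = S (\<lambda>x. c * T f x) y"
    by (intro bounded_ops_cong_AE[OF S] bounded_ops_L2[OF T] L2_cmult f Tf bounded_ops_cmult[OF T f])
  then show "AE y in K. (S \<circ> T) (\<lambda>x. c * f x) y = c * (S \<circ> T) f y"
    using bounded_ops_cmult[OF S Tf, of c] by eventually_elim simp
  have "L2_norm K (S (T f)) \<le> op_norm N K S * L2_norm N (T f)" by (rule op_norm_bound[OF S Tf])
  also have "\<dots> \<le> op_norm N K S * (op_norm M N T * L2_norm M f)"
    by (intro mult_left_mono op_norm_bound[OF T f] op_norm_nonneg[OF S])
  finally show "L2_norm K ((S \<circ> T) f) \<le> (op_norm N K S * op_norm M N T) * L2_norm M f" by (simp add: mult.assoc)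
  assume g: "g \<in> L2 M"
  note Tg = bounded_ops_L2[OF T g]
  have "AE y in K. S (T (\<lambda>x. f x + g x)) y = S (\<lambda>x. T f x + T g x) y"
    by (intro bounded_ops_cong_AE[OF S] bounded_ops_L2[OF T] L2_add f g Tf Tg bounded_ops_add[OF T f g])
  then show "AE y in K. (S \<circ> T) (\<lambda>x. f x + g x) y = (S \<circ> T) f y + (S \<circ> T) g y"
    using bounded_ops_add[OF S Tf Tg] by eventually_elim simp
qed

lemma trace_class_mult:
  assumes \<tau>: "\<tau> \<in> trace_class M N" and a: "a \<in> Linfty M" and b: "b \<in> Linfty N"
  shows "(\<lambda>i. mult_op a (fst \<tau> i), \<lambda>i. mult_op b (snd \<tau> i)) \<in> trace_class M N"
proof -
  have *: "summable (\<lambda>i. (L2_norm K (mult_op c (f i)))\<^sup>2)"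
    if c: "c \<in> Linfty K" and f: "\<And>i. f i \<in> L2 K" "summable (\<lambda>i. (L2_norm K (f i))\<^sup>2)"
    for K :: "'c measure" and c and f :: "nat \<Rightarrow> 'c \<Rightarrow> complex"
  proof -
    obtain C where C: "0 \<le> C" "\<And>f. f \<in> L2 K \<Longrightarrow> L2_norm K (mult_op c f) \<le> C * L2_norm K f"
      by (rule mult_op_norm_bound[OF c]) blast
    have "(L2_norm K (mult_op c (f i)))\<^sup>2 \<le> C\<^sup>2 * (L2_norm K (f i))\<^sup>2" for i
      using power_mono[OF C(2)[OF f(1)] L2_norm_nonneg, of i 2] by (simp add: power_mult_distrib)
    then show ?thesis by (intro summable_comparison_test'[OF summable_mult[OF f(2), of "C\<^sup>2"], of 0]) simp
  qed
  show ?thesis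
    using mult_op_L2[OF a] mult_op_L2[OF b] *[OF a] *[OF b] trace_classD[OF \<tau>] unfolding trace_class_def by simp
qed

lemma trace_pairing_mult:
  "trace_pairing N (mult_op b \<circ> T \<circ> mult_op a) \<tau> = trace_pairing N T (\<lambda>i. mult_op a (fst \<tau> i), \<lambda>i. mult_op b (snd \<tau> i))"
  unfolding trace_pairing_def by (simp add: mult_op_def mult_ac)

lemma trace_pairing_zero_op [simp]: "trace_pairing N zero_op \<tau> = 0"
  by (simp add: trace_pairing_def zero_op_def)

context pair_sigma_finite
begin

lemma L2_mult_rectangular:
  assumes a: "a \<in> Linfty M1" and b: "b \<in> Linfty M2" and k: "k \<in> L2 (M1 \<Otimes>\<^sub>M M2)"
  shows "(\<lambda>z. a (fst z) * b (snd z) * k z) \<in> L2 (M1 \<Otimes>\<^sub>M M2)"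
proof -
  obtain C where C: "0 \<le> C" "AE x in M1. norm (a x) \<le> C" and [measurable]: "a \<in> borel_measurable M1" by (rule LinftyD[OF a])
  obtain D where D: "0 \<le> D" "AE x in M2. norm (b x) \<le> D" and [measurable]: "b \<in> borel_measurable M2" by (rule LinftyD[OF b])
  have [measurable]: "k \<in> borel_measurable (M1 \<Otimes>\<^sub>M M2)" by (rule L2_measurable[OF k])
  have "AE z in M1 \<Otimes>\<^sub>M M2. norm (a (fst z) * b (snd z)) \<le> C * D"
  proof (rule AE_pair_measure)
    show "{z \<in> space (M1 \<Otimes>\<^sub>M M2). norm (a (fst z) * b (snd z)) \<le> C * D} \<in> sets (M1 \<Otimes>\<^sub>M M2)" by measurable
    show "AE x in M1. AE y in M2. norm (a (fst (x, y)) * b (snd (x, y))) \<le> C * D"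
      using C(2)
    proof eventually_elim
      case (elim x)
      show ?case using D(2) by eventually_elim (use elim C(1) in \<open>simp add: norm_mult mult_mono\<close>)
    qed
  qed
  then have "AE z in M1 \<Otimes>\<^sub>M M2. norm (a (fst z) * b (snd z) * k z) \<le> C * D * norm (k z)"
  proof eventually_elim
    case (elim z)
    then show ?case using mult_right_mono[OF elim norm_ge_zero[of "k z"]] by (simp only: norm_mult)
  qed
  then show ?thesis by (intro L2_dominated[OF _ k]) measurable
qed

text \<open>All closure properties hold for the graph, with the same operation applied to the kernels, and the pairing
  with finitely many trace class operators transfers them to the weak* closure.\<close>

lemma wstar_multivalued_part_bimodule: "bimodule M1 M2 (wstar_multivalued_part M1 M2 \<phi>)"
proof -
  let ?W = "wstar_multivalued_part M1 M2 \<phi>"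
  have WI: "B \<in> ?W" if "B \<in> bounded_ops M1 M2" "\<And>H e. finite H \<Longrightarrow> H \<subseteq> trace_class M1 M2 \<Longrightarrow> 0 < e \<Longrightarrow>
      \<exists>k\<in>mult_dom M1 M2 \<phi>. \<forall>\<tau>\<in>H. norm (trace_pairing M2 (int_op M1 k) \<tau>) < e \<and>
      norm (trace_pairing M2 B \<tau> - trace_pairing M2 (int_op M1 (\<lambda>z. \<phi> z * k z)) \<tau>) < e" for B
    unfolding wstar_multivalued_part_def mem_Collect_eq using that by (intro wstar_graphI) simp_all
  have WD: "\<exists>k\<in>mult_dom M1 M2 \<phi>. \<forall>\<tau>\<in>H. norm (trace_pairing M2 (int_op M1 k) \<tau>) < e \<and>
      norm (trace_pairing M2 B \<tau> - trace_pairing M2 (int_op M1 (\<lambda>z. \<phi> z * k z)) \<tau>) < e"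
    if "B \<in> ?W" and H: "finite H" "H \<subseteq> trace_class M1 M2" and e: "0 < e" for B H e
  proof -
    have "(zero_op, B) \<in> wstar_graph M1 M2 \<phi>" using that by (simp add: wstar_multivalued_part_def)
    then obtain k where k: "k \<in> mult_dom M1 M2 \<phi>"
      "\<And>\<tau>. \<tau> \<in> H \<Longrightarrow> norm (trace_pairing M2 zero_op \<tau> - trace_pairing M2 (int_op M1 k) \<tau>) < e"
      "\<And>\<tau>. \<tau> \<in> H \<Longrightarrow> norm (trace_pairing M2 B \<tau> - trace_pairing M2 (int_op M1 (\<lambda>z. \<phi> z * k z)) \<tau>) < e"
      by (rule wstar_graphD[OF _ H e]) blast
    show ?thesis
    proof (intro bexI[OF _ k(1)] ballI conjI)
      fix \<tau> assume "\<tau> \<in> H"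
      then show "norm (trace_pairing M2 (int_op M1 k) \<tau>) < e"
        "norm (trace_pairing M2 B \<tau> - trace_pairing M2 (int_op M1 (\<lambda>z. \<phi> z * k z)) \<tau>) < e"
        using k(2)[of \<tau>] k(3)[of \<tau>] by simp_all
    qed
  qed
  have Wb: "?W \<subseteq> bounded_ops M1 M2" by (auto simp: wstar_multivalued_part_def dest: wstar_graph_bounded)
  have zero: "zero_op \<in> ?W"
  proof (rule WI)
    fix H :: "((nat \<Rightarrow> 'a \<Rightarrow> complex) \<times> (nat \<Rightarrow> 'b \<Rightarrow> complex)) set" and e :: real assume "0 < e"
    have "int_op M1 (\<lambda>z. 0) = (zero_op :: ('a, 'b) oper)" by (simp add: int_op_def zero_op_def fun_eq_iff)
    then show "\<exists>k\<in>mult_dom M1 M2 \<phi>. \<forall>\<tau>\<in>H. norm (trace_pairing M2 (int_op M1 k) \<tau>) < e \<and>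
      norm (trace_pairing M2 zero_op \<tau> - trace_pairing M2 (int_op M1 (\<lambda>z. \<phi> z * k z)) \<tau>) < e"
      using \<open>0 < e\<close> by (intro bexI[OF _ mult_dom_zero]) simp
  qed simp
  have diff: "(\<lambda>f y. S f y - T f y) \<in> ?W" if "S \<in> ?W" "T \<in> ?W" for S T
    using wstar_graph_diff[of zero_op S \<phi> zero_op T] that by (simp add: wstar_multivalued_part_def op_eq_def)
  have scale: "(\<lambda>f y. c * T f y) \<in> ?W" if T: "T \<in> ?W" for c T
  proof (rule WI)
    have Tb: "T \<in> bounded_ops M1 M2" using T Wb by blast
    show "(\<lambda>f y. c * T f y) \<in> bounded_ops M1 M2"
    proof (rule bounded_opsI)
      fix f g d assume f: "f \<in> L2 M1"
      show "(\<lambda>y. c * T f y) \<in> L2 M2" by (intro L2_cmult bounded_ops_L2[OF Tb f])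
      show "AE y in M2. c * T (\<lambda>x. d * f x) y = d * (c * T f y)"
        using bounded_ops_cmult[OF Tb f, of d] by eventually_elim simp
      show "L2_norm M2 (\<lambda>y. c * T f y) \<le> (norm c * op_norm M1 M2 T) * L2_norm M1 f"
        unfolding L2_norm_cmult mult.assoc by (intro mult_left_mono op_norm_bound[OF Tb f]) simp
      assume g: "g \<in> L2 M1"
      show "AE y in M2. c * T (\<lambda>x. f x + g x) y = c * T f y + c * T g y"
        using bounded_ops_add[OF Tb f g] by eventually_elim (simp add: distrib_left)
    qed
    fix H e assume H: "finite H" "H \<subseteq> trace_class M1 M2" and e: "0 < (e::real)"
    have c1: "0 < norm c + 1" by (simp add: add_nonneg_pos)
    obtain k where k: "k \<in> mult_dom M1 M2 \<phi>" "\<And>\<tau>. \<tau> \<in> H \<Longrightarrow> norm (trace_pairing M2 (int_op M1 k) \<tau>) < e / (norm c + 1) \<and>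
      norm (trace_pairing M2 T \<tau> - trace_pairing M2 (int_op M1 (\<lambda>z. \<phi> z * k z)) \<tau>) < e / (norm c + 1)"
      using WD[OF T H, of "e / (norm c + 1)"] e c1 by auto
    have pc: "trace_pairing M2 (\<lambda>f y. c * R f y) \<tau> = c * trace_pairing M2 R \<tau>" if "R \<in> bounded_ops M1 M2" "\<tau> \<in> trace_class M1 M2" for R \<tau>
      unfolding trace_pairing_def using suminf_mult[OF summable_norm_cancel[OF trace_pairing_summable[OF that]], of c]
      by (simp add: mult.assoc)
    have small: "norm (c * w) < e" if "norm w < e / (norm c + 1)" for w :: complex
    proof -
      have "norm (c * w) \<le> norm c * (e / (norm c + 1))"
        unfolding norm_mult using that by (intro mult_left_mono) auto
      also have "\<dots> < e" using e c1 by (simp add: field_simps)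
      finally show ?thesis .
    qed
    show "\<exists>k\<in>mult_dom M1 M2 \<phi>. \<forall>\<tau>\<in>H. norm (trace_pairing M2 (int_op M1 k) \<tau>) < e \<and>
      norm (trace_pairing M2 (\<lambda>f y. c * T f y) \<tau> - trace_pairing M2 (int_op M1 (\<lambda>z. \<phi> z * k z)) \<tau>) < e"
    proof (intro bexI[OF _ mult_dom_cmult[OF k(1), of c]] ballI conjI)
      fix \<tau> assume \<tau>H: "\<tau> \<in> H"
      then have \<tau>: "\<tau> \<in> trace_class M1 M2" using H by blast
      have I: "int_op M1 (\<lambda>z. c * l z) = (\<lambda>f y. c * int_op M1 l f y)" for l :: "'a \<times> 'b \<Rightarrow> complex"
        by (rule ext) (rule int_op_cmult)
      have "(\<lambda>z. \<phi> z * (c * k z)) = (\<lambda>z. c * (\<phi> z * k z))" by (simp add: mult.left_commute)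
      then have "trace_pairing M2 (\<lambda>f y. c * T f y) \<tau> - trace_pairing M2 (int_op M1 (\<lambda>z. \<phi> z * (c * k z))) \<tau> =
          c * (trace_pairing M2 T \<tau> - trace_pairing M2 (int_op M1 (\<lambda>z. \<phi> z * k z)) \<tau>)"
        by (simp add: I pc Tb \<tau> int_op_bounded mult_domD[OF k(1)] right_diff_distrib)
      then show "norm (trace_pairing M2 (\<lambda>f y. c * T f y) \<tau> - trace_pairing M2 (int_op M1 (\<lambda>z. \<phi> z * (c * k z))) \<tau>) < e"
        using small k(2)[OF \<tau>H] by simp
      show "norm (trace_pairing M2 (int_op M1 (\<lambda>z. c * k z)) \<tau>) < e"
        unfolding I pc[OF int_op_bounded[OF mult_domD(1)[OF k(1)]] \<tau>] using small k(2)[OF \<tau>H] by simp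
    qed
  qed
  have add: "(\<lambda>f y. S f y + T f y) \<in> ?W" if "S \<in> ?W" "T \<in> ?W" for S T
    using diff[OF that(1) scale[OF that(2), of "-1"]] by simp
  have module: "mult_op b \<circ> T \<circ> mult_op a \<in> ?W" if T: "T \<in> ?W" and a: "a \<in> Linfty M1" and b: "b \<in> Linfty M2" for T a b
  proof (rule WI)
    have Tb: "T \<in> bounded_ops M1 M2" using T Wb by blast
    show "mult_op b \<circ> T \<circ> mult_op a \<in> bounded_ops M1 M2"
      by (rule bounded_ops_comp[OF bounded_ops_comp[OF mult_op_bounded[OF b] Tb] mult_op_bounded[OF a]])
    fix H e assume H: "finite H" "H \<subseteq> trace_class M1 M2" and e: "0 < (e::real)"
    let ?m = "\<lambda>\<tau>. (\<lambda>i. mult_op a (fst \<tau> i), \<lambda>i. mult_op b (snd \<tau> i))"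
    have H': "finite (?m ` H)" "?m ` H \<subseteq> trace_class M1 M2" using H trace_class_mult[OF _ a b] by auto
    obtain k where k: "k \<in> mult_dom M1 M2 \<phi>" "\<And>\<tau>. \<tau> \<in> H \<Longrightarrow> norm (trace_pairing M2 (int_op M1 k) (?m \<tau>)) < e \<and>
      norm (trace_pairing M2 T (?m \<tau>) - trace_pairing M2 (int_op M1 (\<lambda>z. \<phi> z * k z)) (?m \<tau>)) < e"
      using WD[OF T H' e] by auto
    let ?k = "\<lambda>z. a (fst z) * b (snd z) * k z"
    have I: "int_op M1 (\<lambda>z. a (fst z) * b (snd z) * l z) = mult_op b \<circ> int_op M1 l \<circ> mult_op a" for l
    proof (intro ext)
      fix f y
      have "(\<integral>x. a x * b y * l (x, y) * f x \<partial>M1) = (\<integral>x. b y * (l (x, y) * (a x * f x)) \<partial>M1)" by (simp add: mult_ac)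
      then show "int_op M1 (\<lambda>z. a (fst z) * b (snd z) * l z) f y = (mult_op b \<circ> int_op M1 l \<circ> mult_op a) f y"
        by (simp add: int_op_def mult_op_def)
    qed
    have \<phi>k: "(\<lambda>z. \<phi> z * ?k z) = (\<lambda>z. a (fst z) * b (snd z) * (\<phi> z * k z))" by (simp add: mult_ac)
    have "?k \<in> mult_dom M1 M2 \<phi>"
      unfolding mult_dom_def mem_Collect_eq \<phi>k by (intro conjI L2_mult_rectangular a b mult_domD[OF k(1)])
    then show "\<exists>k\<in>mult_dom M1 M2 \<phi>. \<forall>\<tau>\<in>H. norm (trace_pairing M2 (int_op M1 k) \<tau>) < e \<and>
      norm (trace_pairing M2 (mult_op b \<circ> T \<circ> mult_op a) \<tau> - trace_pairing M2 (int_op M1 (\<lambda>z. \<phi> z * k z)) \<tau>) < e"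
      by (intro bexI[of _ ?k] ballI) (use k(2) in \<open>simp_all only: \<phi>k I trace_pairing_mult\<close>)
  qed
  have eq: "S \<in> ?W" if T: "T \<in> ?W" and S: "S \<in> bounded_ops M1 M2" and ST: "op_eq M1 M2 S T" for S T
  proof (rule WI[OF S])
    fix H e assume H: "finite H" "H \<subseteq> trace_class M1 M2" and e: "0 < (e::real)"
    have "T \<in> bounded_ops M1 M2" using T Wb by blast
    then have "trace_pairing M2 S \<tau> = trace_pairing M2 T \<tau>" if "\<tau> \<in> H" for \<tau>
      using op_eq_trace_pairing[OF S _ _ ST] H that by blast
    then show "\<exists>k\<in>mult_dom M1 M2 \<phi>. \<forall>\<tau>\<in>H. norm (trace_pairing M2 (int_op M1 k) \<tau>) < e \<and>
      norm (trace_pairing M2 S \<tau> - trace_pairing M2 (int_op M1 (\<lambda>z. \<phi> z * k z)) \<tau>) < e"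
      using WD[OF T H e] by (metis (no_types, lifting))
  qed
  show ?thesis unfolding bimodule_def using Wb zero add scale module eq by blast
qed

lemma wstar_multivalued_part_closed: "closedin (weak_star M1 M2) (wstar_multivalued_part M1 M2 \<phi>)"
proof -
  let ?X = "weak_star M1 M2"
  have "continuous_map ?X (prod_topology ?X ?X) (\<lambda>B. (zero_op, B))"
    by (intro continuous_map_pairedI continuous_map_id[unfolded id_def]) simp
  then have "closedin ?X {B \<in> topspace ?X. (zero_op, B) \<in> wstar_graph M1 M2 \<phi>}"
    by (rule closedin_continuous_map_preimage) simp
  also have "{B \<in> topspace ?X. (zero_op, B) \<in> wstar_graph M1 M2 \<phi>} = wstar_multivalued_part M1 M2 \<phi>"
    by (auto simp: wstar_multivalued_part_def dest: wstar_graph_bounded)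
  finally show ?thesis .
qed

text \<open>A pair of trace class operators that annihilates the graph annihilates its weak* closure, because
  pairing with it is weak* continuous.\<close>

lemma compact_wstar_multivalued_part:
  assumes B: "B \<in> compact_ops M1 M2" and W: "B \<in> wstar_multivalued_part M1 M2 \<phi>"
  shows "(zero_op, B) \<in> norm_closure M1 M2 (mult_graph M1 M2 \<phi>)"
proof (rule norm_closure_of_annihilator[OF B])
  fix \<sigma> \<tau> assume \<sigma>: "\<sigma> \<in> trace_class M1 M2" and \<tau>: "\<tau> \<in> trace_class M1 M2"
    and ann: "\<And>k. k \<in> mult_dom M1 M2 \<phi> \<Longrightarrow>
        trace_pairing M2 (int_op M1 k) \<sigma> + trace_pairing M2 (int_op M1 (\<lambda>z. \<phi> z * k z)) \<tau> = 0"
  have cl: "(zero_op, B) \<in> wstar_graph M1 M2 \<phi>" using W by (simp add: wstar_multivalued_part_def)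
  show "trace_pairing M2 B \<tau> = 0"
  proof (rule ccontr)
    assume "trace_pairing M2 B \<tau> \<noteq> 0"
    then have e: "0 < norm (trace_pairing M2 B \<tau>) / 2" by simp
    have H: "finite {\<sigma>, \<tau>}" "{\<sigma>, \<tau>} \<subseteq> trace_class M1 M2" using \<sigma> \<tau> by auto
    obtain k where k: "k \<in> mult_dom M1 M2 \<phi>"
      "\<And>\<tau>'. \<tau>' \<in> {\<sigma>, \<tau>} \<Longrightarrow> norm (trace_pairing M2 zero_op \<tau>' - trace_pairing M2 (int_op M1 k) \<tau>') < norm (trace_pairing M2 B \<tau>) / 2"
      "\<And>\<tau>'. \<tau>' \<in> {\<sigma>, \<tau>} \<Longrightarrow> norm (trace_pairing M2 B \<tau>' - trace_pairing M2 (int_op M1 (\<lambda>z. \<phi> z * k z)) \<tau>') < norm (trace_pairing M2 B \<tau>) / 2"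
      by (rule wstar_graphD[OF cl H e]) blast
    have "trace_pairing M2 (int_op M1 (\<lambda>z. \<phi> z * k z)) \<tau> = - trace_pairing M2 (int_op M1 k) \<sigma>"
      using ann[OF k(1)] by (simp add: add_eq_0_iff)
    then show False
      using k(2)[of \<sigma>] k(3)[of \<tau>] norm_triangle_ineq2[of "trace_pairing M2 B \<tau>" "- trace_pairing M2 (int_op M1 k) \<sigma>"] by simp
  qed
qed

end

section \<open>Localisation to rectangles\<close>

lemma proj_op_apply: "proj_op \<alpha> f = (\<lambda>x. indicator \<alpha> x * f x)"
  by (simp add: mult_op_def)

lemma scaleR_indicator_complex: "(indicator \<alpha> x :: real) *\<^sub>R (z :: complex) = indicator \<alpha> x * z"
  by (simp add: indicator_def)

lemma indicator_Linfty: "\<alpha> \<in> sets M \<Longrightarrow> indicator \<alpha> \<in> Linfty M"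
  unfolding Linfty_def by (auto intro!: exI[of _ 1] simp: indicator_def)

lemma L2_restrict_space_iff:
  assumes "\<alpha> \<in> sets M"
  shows "f \<in> L2 (restrict_space M \<alpha>) \<longleftrightarrow> proj_op \<alpha> f \<in> L2 M"
proof -
  have *: "\<alpha> \<inter> space M \<in> sets M" using assms by simp
  have "(\<lambda>x. (indicator \<alpha> x :: real) *\<^sub>R (norm (f x))\<^sup>2) = (\<lambda>x. (norm (indicator \<alpha> x * f x))\<^sup>2)"
    by (auto simp: indicator_def)
  then show ?thesis
    unfolding L2_def proj_op_apply mem_Collect_eq borel_measurable_restrict_space_iff[OF *]
      integrable_restrict_space[OF *] scaleR_indicator_complex by simp
qed

lemma L2_norm_restrict_space:
  assumes "\<alpha> \<in> sets M"
  shows "L2_norm (restrict_space M \<alpha>) f = L2_norm M (proj_op \<alpha> f)"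
proof -
  have *: "\<alpha> \<inter> space M \<in> sets M" using assms by simp
  have "(\<lambda>x. (indicator \<alpha> x :: real) *\<^sub>R (norm (f x))\<^sup>2) = (\<lambda>x. (norm (indicator \<alpha> x * f x))\<^sup>2)"
    by (auto simp: indicator_def)
  then show ?thesis unfolding L2_norm_def proj_op_apply integral_restrict_space[OF *] by simp
qed

lemma proj_op_idem: "proj_op \<alpha> (proj_op \<alpha> f) = proj_op \<alpha> f"
  by (auto simp: proj_op_apply indicator_def)

lemma proj_op_L2: "\<alpha> \<in> sets M \<Longrightarrow> f \<in> L2 M \<Longrightarrow> proj_op \<alpha> f \<in> L2 M"
  by (rule mult_op_L2[OF indicator_Linfty])

lemma L2_restrict_spaceI: "\<alpha> \<in> sets M \<Longrightarrow> f \<in> L2 M \<Longrightarrow> f \<in> L2 (restrict_space M \<alpha>)"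
  using L2_restrict_space_iff proj_op_L2 by blast

lemma L2_norm_proj_op_le: "\<alpha> \<in> sets M \<Longrightarrow> f \<in> L2 M \<Longrightarrow> L2_norm M (proj_op \<alpha> f) \<le> L2_norm M f"
  by (rule L2_norm_mono) (auto intro!: L2_measurable proj_op_L2 simp: proj_op_apply indicator_def)

lemma pair_measure_restrict_space:
  assumes M: "sigma_finite_measure M" and N: "sigma_finite_measure N"
    and \<alpha>: "\<alpha> \<in> sets M" and \<beta>: "\<beta> \<in> sets N"
  shows "restrict_space M \<alpha> \<Otimes>\<^sub>M restrict_space N \<beta> = restrict_space (M \<Otimes>\<^sub>M N) (\<alpha> \<times> \<beta>)"
proof (rule pair_measure_eqI)
  let ?M = "restrict_space M \<alpha>" and ?N = "restrict_space N \<beta>" and ?R = "restrict_space (M \<Otimes>\<^sub>M N) (\<alpha> \<times> \<beta>)"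
  interpret N: sigma_finite_measure N by (rule N)
  show "sigma_finite_measure ?M" "sigma_finite_measure ?N"
    by (intro sigma_finite_measure_restrict_space assms)+
  have M_sets: "A \<in> sets ?M \<longleftrightarrow> A \<subseteq> \<alpha> \<and> A \<in> sets M" for A using \<alpha> by (simp add: sets_restrict_space_iff)
  have N_sets: "A \<in> sets ?N \<longleftrightarrow> A \<subseteq> \<beta> \<and> A \<in> sets N" for A using \<beta> by (simp add: sets_restrict_space_iff)
  have R_sets: "A \<in> sets ?R \<longleftrightarrow> A \<subseteq> \<alpha> \<times> \<beta> \<and> A \<in> sets (M \<Otimes>\<^sub>M N)" for A
    using \<alpha> \<beta> by (simp add: sets_restrict_space_iff)
  show "sets (?M \<Otimes>\<^sub>M ?N) = sets ?R"
  proof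
    show "sets (?M \<Otimes>\<^sub>M ?N) \<subseteq> sets ?R"
      by (rule sets_pair_in_sets) (auto simp: M_sets N_sets R_sets)
    have id: "(\<lambda>z. (fst z, snd z)) \<in> measurable (?M \<Otimes>\<^sub>M ?N) (M \<Otimes>\<^sub>M N)"
    proof (rule measurable_Pair)
      show "fst \<in> measurable (?M \<Otimes>\<^sub>M ?N) M"
        by (rule measurable_compose[OF measurable_fst measurable_restrict_space1[OF measurable_ident_sets[OF refl]]])
      show "snd \<in> measurable (?M \<Otimes>\<^sub>M ?N) N"
        by (rule measurable_compose[OF measurable_snd measurable_restrict_space1[OF measurable_ident_sets[OF refl]]])
    qed
    show "sets ?R \<subseteq> sets (?M \<Otimes>\<^sub>M ?N)"
    proof
      fix S assume "S \<in> sets ?R"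
      then have S: "S \<subseteq> \<alpha> \<times> \<beta>" "S \<in> sets (M \<Otimes>\<^sub>M N)" by (auto simp: R_sets)
      have "(\<lambda>z. (fst z, snd z)) -` S \<inter> space (?M \<Otimes>\<^sub>M ?N) = S"
        using S(1) \<alpha> \<beta> by (auto simp: space_pair_measure)
      then show "S \<in> sets (?M \<Otimes>\<^sub>M ?N)" using measurable_sets[OF id S(2)] by simp
    qed
  qed
  fix A B assume "A \<in> sets ?M" "B \<in> sets ?N"
  then have A: "A \<subseteq> \<alpha>" "A \<in> sets M" and B: "B \<subseteq> \<beta>" "B \<in> sets N" by (auto simp: M_sets N_sets)
  have AB: "A \<times> B \<subseteq> \<alpha> \<times> \<beta>" using A B by blast
  have "\<alpha> \<times> \<beta> \<inter> space (M \<Otimes>\<^sub>M N) \<in> sets (M \<Otimes>\<^sub>M N)" using \<alpha> \<beta> by simp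
  then have "emeasure ?R (A \<times> B) = emeasure (M \<Otimes>\<^sub>M N) (A \<times> B)"
    using AB by (rule emeasure_restrict_space)
  also have "\<dots> = emeasure M A * emeasure N B" using A B by (intro N.emeasure_pair_measure_Times)
  finally show "emeasure ?M A * emeasure ?N B = emeasure ?R (A \<times> B)"
    using emeasure_restrict_space[of \<alpha> M A] emeasure_restrict_space[of \<beta> N B] A B \<alpha> \<beta> by simp
qed

context pair_sigma_finite
begin

context
  fixes \<alpha> :: "'a set" and \<beta> :: "'b set"
  assumes \<alpha>: "\<alpha> \<in> sets M1" and \<beta>: "\<beta> \<in> sets M2"
begin

abbreviation (input) "M\<alpha> \<equiv> restrict_space M1 \<alpha>"
abbreviation (input) "M\<beta> \<equiv> restrict_space M2 \<beta>"

lemma pair_sigma_finite_restrict_space: "pair_sigma_finite M\<alpha> M\<beta>"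
  unfolding pair_sigma_finite_def
  by (intro conjI sigma_finite_measure_restrict_space \<alpha> \<beta> M1.sigma_finite_measure_axioms M2.sigma_finite_measure_axioms)

lemma mult_dom_restrict_space_iff:
  "k \<in> mult_dom M\<alpha> M\<beta> \<phi> \<longleftrightarrow> proj_op (\<alpha> \<times> \<beta>) k \<in> mult_dom M1 M2 \<phi>"
proof -
  have "\<alpha> \<times> \<beta> \<in> sets (M1 \<Otimes>\<^sub>M M2)" using \<alpha> \<beta> by simp
  moreover have "proj_op (\<alpha> \<times> \<beta>) (\<lambda>z. \<phi> z * k z) = (\<lambda>z. \<phi> z * proj_op (\<alpha> \<times> \<beta>) k z)"
    by (simp add: proj_op_apply mult.left_commute)
  ultimately show ?thesis
    unfolding mult_dom_def pair_measure_restrict_space[OF M1.sigma_finite_measure_axioms M2.sigma_finite_measure_axioms \<alpha> \<beta>]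
    by (simp add: L2_restrict_space_iff)
qed

lemma mult_dom_restrict_space:
  assumes k: "k \<in> mult_dom M1 M2 \<phi>"
  shows "k \<in> mult_dom M\<alpha> M\<beta> \<phi>"
proof -
  have "\<alpha> \<times> \<beta> \<in> sets (M1 \<Otimes>\<^sub>M M2)" using \<alpha> \<beta> by simp
  then show ?thesis
    using mult_domD[OF k]
    unfolding mult_dom_def pair_measure_restrict_space[OF M1.sigma_finite_measure_axioms M2.sigma_finite_measure_axioms \<alpha> \<beta>]
    by (simp add: L2_restrict_spaceI)
qed

lemma int_op_restrict_space: "int_op M\<alpha> k = int_op M1 k \<circ> proj_op \<alpha>"
proof (intro ext)
  fix f y
  have "int_op M\<alpha> k f y = (\<integral>x. indicator \<alpha> x *\<^sub>R (k (x, y) * f x) \<partial>M1)"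
    unfolding int_op_def using \<alpha> by (intro integral_restrict_space) simp
  also have "\<dots> = (\<integral>x. k (x, y) * (indicator \<alpha> x * f x) \<partial>M1)"
    unfolding scaleR_indicator_complex by (simp add: mult.left_commute)
  finally show "int_op M\<alpha> k f y = (int_op M1 k \<circ> proj_op \<alpha>) f y"
    by (simp add: int_op_def proj_op_apply)
qed

lemma int_op_proj_rectangle: "int_op M1 (proj_op (\<alpha> \<times> \<beta>) k) = proj_op \<beta> \<circ> int_op M\<alpha> k"
proof (intro ext)
  fix f y
  have "(\<integral>x. indicator (\<alpha> \<times> \<beta>) (x, y) * k (x, y) * f x \<partial>M1) = (\<integral>x. indicator \<beta> y * (k (x, y) * (indicator \<alpha> x * f x)) \<partial>M1)"
    by (rule Bochner_Integration.integral_cong) (auto simp: indicator_def)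
  then show "int_op M1 (proj_op (\<alpha> \<times> \<beta>) k) f y = (proj_op \<beta> \<circ> int_op M\<alpha> k) f y"
    unfolding int_op_restrict_space by (simp add: int_op_def proj_op_apply)
qed

lemma integral_restrict_mult: "(\<integral>y. u y * v y \<partial>M\<beta>) = (\<integral>y. u y * proj_op \<beta> v y \<partial>M2)" for u v :: "'b \<Rightarrow> complex"
proof -
  have "\<beta> \<inter> space M2 \<in> sets M2" using \<beta> by simp
  then have "(\<integral>y. u y * v y \<partial>M\<beta>) = (\<integral>y. indicator \<beta> y *\<^sub>R (u y * v y) \<partial>M2)" by (rule integral_restrict_space)
  then show ?thesis unfolding scaleR_indicator_complex by (simp add: proj_op_apply mult.left_commute)
qed

lemma trace_pairing_compress:
  "trace_pairing M\<beta> (T \<circ> proj_op \<alpha>) \<tau> = trace_pairing M2 T (\<lambda>i. proj_op \<alpha> (fst \<tau> i), \<lambda>i. proj_op \<beta> (snd \<tau> i))"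
  unfolding trace_pairing_def integral_restrict_mult by simp

lemma trace_pairing_extend: "trace_pairing M2 (proj_op \<beta> \<circ> T) \<tau> = trace_pairing M\<beta> T \<tau>"
  unfolding trace_pairing_def integral_restrict_mult by (simp add: proj_op_apply mult_ac)

lemma trace_class_extend:
  assumes "\<tau> \<in> trace_class M\<alpha> M\<beta>"
  shows "(\<lambda>i. proj_op \<alpha> (fst \<tau> i), \<lambda>i. proj_op \<beta> (snd \<tau> i)) \<in> trace_class M1 M2"
  using trace_classD[OF assms] L2_restrict_space_iff[OF \<alpha>] L2_restrict_space_iff[OF \<beta>]
  unfolding trace_class_def L2_norm_restrict_space[OF \<alpha>] L2_norm_restrict_space[OF \<beta>] by simp

lemma trace_class_restrict:
  assumes "\<tau> \<in> trace_class M1 M2"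
  shows "\<tau> \<in> trace_class M\<alpha> M\<beta>"
proof -
  note \<tau> = trace_classD[OF assms]
  have "summable (\<lambda>i. (L2_norm M1 (proj_op \<alpha> (fst \<tau> i)))\<^sup>2)"
    by (rule summable_comparison_test'[OF \<tau>(3), of 0]) (simp add: power_mono L2_norm_proj_op_le[OF \<alpha> \<tau>(1)])
  moreover have "summable (\<lambda>i. (L2_norm M2 (proj_op \<beta> (snd \<tau> i)))\<^sup>2)"
    by (rule summable_comparison_test'[OF \<tau>(4), of 0]) (simp add: power_mono L2_norm_proj_op_le[OF \<beta> \<tau>(2)])
  ultimately show ?thesis
    using L2_restrict_spaceI[OF \<alpha> \<tau>(1)] L2_restrict_spaceI[OF \<beta> \<tau>(2)]
    unfolding trace_class_def L2_norm_restrict_space[OF \<alpha>, symmetric] L2_norm_restrict_space[OF \<beta>, symmetric]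
    by (simp add: case_prod_unfold)
qed

lemma AE_restrict_\<beta>: "(AE y in M\<beta>. P y) \<longleftrightarrow> (AE y in M2. y \<in> \<beta> \<longrightarrow> P y)"
  using \<beta> by (intro AE_restrict_space_iff) simp

lemma bounded_ops_compress:
  assumes T: "T \<in> bounded_ops M1 M2"
  shows "T \<circ> proj_op \<alpha> \<in> bounded_ops M\<alpha> M\<beta>"
proof (rule bounded_opsI)
  fix f g :: "'a \<Rightarrow> complex" and c assume "f \<in> L2 M\<alpha>"
  then have f: "proj_op \<alpha> f \<in> L2 M1" using L2_restrict_space_iff[OF \<alpha>] by blast
  note Tf = bounded_ops_L2[OF T f]
  show "(T \<circ> proj_op \<alpha>) f \<in> L2 M\<beta>" using L2_restrict_spaceI[OF \<beta> Tf] by simp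
  have "proj_op \<alpha> (\<lambda>x. c * f x) = (\<lambda>x. c * proj_op \<alpha> f x)" by (simp add: proj_op_apply mult.left_commute)
  then show "AE y in M\<beta>. (T \<circ> proj_op \<alpha>) (\<lambda>x. c * f x) y = c * (T \<circ> proj_op \<alpha>) f y"
    unfolding AE_restrict_\<beta> using bounded_ops_cmult[OF T f, of c] by (auto elim: eventually_mono)
  have "L2_norm M2 (proj_op \<beta> (T (proj_op \<alpha> f))) \<le> L2_norm M2 (T (proj_op \<alpha> f))"
    by (rule L2_norm_proj_op_le[OF \<beta> Tf])
  also have "\<dots> \<le> op_norm M1 M2 T * L2_norm M1 (proj_op \<alpha> f)" by (rule op_norm_bound[OF T f])
  finally show "L2_norm M\<beta> ((T \<circ> proj_op \<alpha>) f) \<le> op_norm M1 M2 T * L2_norm M\<alpha> f"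
    unfolding L2_norm_restrict_space[OF \<alpha>] L2_norm_restrict_space[OF \<beta>] by simp
  assume "g \<in> L2 M\<alpha>"
  then have g: "proj_op \<alpha> g \<in> L2 M1" using L2_restrict_space_iff[OF \<alpha>] by blast
  have "proj_op \<alpha> (\<lambda>x. f x + g x) = (\<lambda>x. proj_op \<alpha> f x + proj_op \<alpha> g x)" by (simp add: proj_op_apply distrib_left)
  then show "AE y in M\<beta>. (T \<circ> proj_op \<alpha>) (\<lambda>x. f x + g x) y = (T \<circ> proj_op \<alpha>) f y + (T \<circ> proj_op \<alpha>) g y"
    unfolding AE_restrict_\<beta> using bounded_ops_add[OF T f g] by (auto elim: eventually_mono)
qed

lemma bounded_ops_extend:
  assumes T: "T \<in> bounded_ops M\<alpha> M\<beta>"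
  shows "proj_op \<beta> \<circ> T \<in> bounded_ops M1 M2"
proof (rule bounded_opsI)
  fix f g :: "'a \<Rightarrow> complex" and c assume fL: "f \<in> L2 M1"
  then have f: "f \<in> L2 M\<alpha>" by (rule L2_restrict_spaceI[OF \<alpha>])
  note Tf = bounded_ops_L2[OF T f]
  show "(proj_op \<beta> \<circ> T) f \<in> L2 M2" using Tf L2_restrict_space_iff[OF \<beta>] by simp
  show "AE y in M2. (proj_op \<beta> \<circ> T) (\<lambda>x. c * f x) y = c * (proj_op \<beta> \<circ> T) f y"
    using bounded_ops_cmult[OF T f, of c] unfolding AE_restrict_\<beta>
    by eventually_elim (auto simp: proj_op_apply indicator_def)
  have "L2_norm M2 (proj_op \<beta> (T f)) \<le> op_norm M\<alpha> M\<beta> T * L2_norm M\<alpha> f"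
    using op_norm_bound[OF T f] unfolding L2_norm_restrict_space[OF \<beta>] .
  also have "\<dots> \<le> op_norm M\<alpha> M\<beta> T * L2_norm M1 f"
    unfolding L2_norm_restrict_space[OF \<alpha>] by (intro mult_left_mono L2_norm_proj_op_le \<alpha> fL op_norm_nonneg T)
  finally show "L2_norm M2 ((proj_op \<beta> \<circ> T) f) \<le> op_norm M\<alpha> M\<beta> T * L2_norm M1 f" by simp
  assume "g \<in> L2 M1"
  then have g: "g \<in> L2 M\<alpha>" by (rule L2_restrict_spaceI[OF \<alpha>])
  show "AE y in M2. (proj_op \<beta> \<circ> T) (\<lambda>x. f x + g x) y = (proj_op \<beta> \<circ> T) f y + (proj_op \<beta> \<circ> T) g y"
    using bounded_ops_add[OF T f g] unfolding AE_restrict_\<beta>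
    by eventually_elim (auto simp: proj_op_apply indicator_def)
qed

text \<open>Compressing an operator to the rectangle and extending it by zero both respect the graph of the
  multiplier, its kernels being restricted and extended by zero.\<close>

lemma wstar_multivalued_part_compress:
  assumes B: "B \<in> wstar_multivalued_part M1 M2 \<phi>"
  shows "B \<circ> proj_op \<alpha> \<in> wstar_multivalued_part M\<alpha> M\<beta> \<phi>"
proof -
  interpret R: pair_sigma_finite M\<alpha> M\<beta> by (rule pair_sigma_finite_restrict_space)
  have cl: "(zero_op, B) \<in> wstar_graph M1 M2 \<phi>" using B by (simp add: wstar_multivalued_part_def)
  have "(zero_op, B \<circ> proj_op \<alpha>) \<in> wstar_graph M\<alpha> M\<beta> \<phi>"
  proof (rule R.wstar_graphI)
    show "B \<circ> proj_op \<alpha> \<in> bounded_ops M\<alpha> M\<beta>" by (rule bounded_ops_compress[OF wstar_graph_bounded(2)[OF cl]])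
    fix H e assume H: "finite H" "H \<subseteq> trace_class M\<alpha> M\<beta>" and e: "0 < (e::real)"
    let ?m = "\<lambda>\<tau>. (\<lambda>i. proj_op \<alpha> (fst \<tau> i), \<lambda>i. proj_op \<beta> (snd \<tau> i))"
    have H': "finite (?m ` H)" "?m ` H \<subseteq> trace_class M1 M2" using H trace_class_extend by auto
    obtain k where k: "k \<in> mult_dom M1 M2 \<phi>"
      "\<And>\<tau>. \<tau> \<in> ?m ` H \<Longrightarrow> norm (trace_pairing M2 zero_op \<tau> - trace_pairing M2 (int_op M1 k) \<tau>) < e"
      "\<And>\<tau>. \<tau> \<in> ?m ` H \<Longrightarrow> norm (trace_pairing M2 B \<tau> - trace_pairing M2 (int_op M1 (\<lambda>z. \<phi> z * k z)) \<tau>) < e"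
      by (rule wstar_graphD[OF cl H' e]) blast
    show "\<exists>k\<in>mult_dom M\<alpha> M\<beta> \<phi>. \<forall>\<tau>\<in>H. norm (trace_pairing M\<beta> zero_op \<tau> - trace_pairing M\<beta> (int_op M\<alpha> k) \<tau>) < e \<and>
      norm (trace_pairing M\<beta> (B \<circ> proj_op \<alpha>) \<tau> - trace_pairing M\<beta> (int_op M\<alpha> (\<lambda>z. \<phi> z * k z)) \<tau>) < e"
    proof (intro bexI[OF _ mult_dom_restrict_space[OF k(1)]] ballI conjI)
      fix \<tau> assume "\<tau> \<in> H"
      then show "norm (trace_pairing M\<beta> zero_op \<tau> - trace_pairing M\<beta> (int_op M\<alpha> k) \<tau>) < e"
        "norm (trace_pairing M\<beta> (B \<circ> proj_op \<alpha>) \<tau> - trace_pairing M\<beta> (int_op M\<alpha> (\<lambda>z. \<phi> z * k z)) \<tau>) < e"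
        using k(2)[of "?m \<tau>"] k(3)[of "?m \<tau>"] unfolding int_op_restrict_space trace_pairing_compress by simp_all
    qed
  qed simp
  then show ?thesis by (simp add: wstar_multivalued_part_def)
qed

lemma wstar_multivalued_part_extend:
  assumes B: "B \<in> wstar_multivalued_part M\<alpha> M\<beta> \<phi>"
  shows "proj_op \<beta> \<circ> B \<in> wstar_multivalued_part M1 M2 \<phi>"
proof -
  have cl: "(zero_op, B) \<in> wstar_graph M\<alpha> M\<beta> \<phi>" using B by (simp add: wstar_multivalued_part_def)
  have "(zero_op, proj_op \<beta> \<circ> B) \<in> wstar_graph M1 M2 \<phi>"
  proof (rule wstar_graphI)
    show "proj_op \<beta> \<circ> B \<in> bounded_ops M1 M2" by (rule bounded_ops_extend[OF wstar_graph_bounded(2)[OF cl]])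
    fix H e assume H: "finite H" "H \<subseteq> trace_class M1 M2" and e: "0 < (e::real)"
    have H': "H \<subseteq> trace_class M\<alpha> M\<beta>" using H trace_class_restrict by blast
    obtain k where k: "k \<in> mult_dom M\<alpha> M\<beta> \<phi>"
      "\<And>\<tau>. \<tau> \<in> H \<Longrightarrow> norm (trace_pairing M\<beta> zero_op \<tau> - trace_pairing M\<beta> (int_op M\<alpha> k) \<tau>) < e"
      "\<And>\<tau>. \<tau> \<in> H \<Longrightarrow> norm (trace_pairing M\<beta> B \<tau> - trace_pairing M\<beta> (int_op M\<alpha> (\<lambda>z. \<phi> z * k z)) \<tau>) < e"
      by (rule wstar_graphD[OF cl H(1) H' e]) blast
    let ?k = "proj_op (\<alpha> \<times> \<beta>) k"
    have k': "?k \<in> mult_dom M1 M2 \<phi>" using k(1) by (simp add: mult_dom_restrict_space_iff)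
    have \<phi>k: "(\<lambda>z. \<phi> z * ?k z) = proj_op (\<alpha> \<times> \<beta>) (\<lambda>z. \<phi> z * k z)"
      by (simp add: proj_op_apply mult.left_commute)
    show "\<exists>k\<in>mult_dom M1 M2 \<phi>. \<forall>\<tau>\<in>H. norm (trace_pairing M2 zero_op \<tau> - trace_pairing M2 (int_op M1 k) \<tau>) < e \<and>
      norm (trace_pairing M2 (proj_op \<beta> \<circ> B) \<tau> - trace_pairing M2 (int_op M1 (\<lambda>z. \<phi> z * k z)) \<tau>) < e"
    proof (intro bexI[OF _ k'] ballI conjI)
      fix \<tau> assume "\<tau> \<in> H"
      then show "norm (trace_pairing M2 zero_op \<tau> - trace_pairing M2 (int_op M1 ?k) \<tau>) < e"
        "norm (trace_pairing M2 (proj_op \<beta> \<circ> B) \<tau> - trace_pairing M2 (int_op M1 (\<lambda>z. \<phi> z * ?k z)) \<tau>) < e"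
        unfolding \<phi>k int_op_proj_rectangle trace_pairing_extend using k(2)[of \<tau>] k(3)[of \<tau>] by simp_all
    qed
  qed simp
  then show ?thesis by (simp add: wstar_multivalued_part_def)
qed

text \<open>Compression carries the multivalued part of \<open>\<phi>\<close> into that of its restriction, and extension by zero
  carries the latter back, without changing the compression.\<close>

lemma wstar_closable_on_rectangle_iff:
  "wstar_closable_multiplier M\<alpha> M\<beta> \<phi> \<longleftrightarrow>
    (\<forall>B\<in>wstar_multivalued_part M1 M2 \<phi>. op_eq M1 M2 (proj_op \<beta> \<circ> B \<circ> proj_op \<alpha>) zero_op)"
proof
  interpret R: pair_sigma_finite M\<alpha> M\<beta> by (rule pair_sigma_finite_restrict_space)
  show "\<forall>B\<in>wstar_multivalued_part M1 M2 \<phi>. op_eq M1 M2 (proj_op \<beta> \<circ> B \<circ> proj_op \<alpha>) zero_op"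
    if cl: "wstar_closable_multiplier M\<alpha> M\<beta> \<phi>"
  proof
    fix B assume "B \<in> wstar_multivalued_part M1 M2 \<phi>"
    then have "(zero_op, B \<circ> proj_op \<alpha>) \<in> wstar_graph M\<alpha> M\<beta> \<phi>"
      using wstar_multivalued_part_compress by (simp add: wstar_multivalued_part_def)
    moreover have "(zero_op, zero_op) \<in> wstar_graph M\<alpha> M\<beta> \<phi>"
      using R.wstar_multivalued_part_bimodule[of \<phi>] by (simp add: bimodule_def wstar_multivalued_part_def)
    moreover have "op_eq M\<alpha> M\<beta> zero_op zero_op" by (simp add: op_eq_def)
    ultimately have eq: "op_eq M\<alpha> M\<beta> (B \<circ> proj_op \<alpha>) zero_op"
      using cl unfolding wstar_closable_multiplier_def is_op_graph_def by blast
    show "op_eq M1 M2 (proj_op \<beta> \<circ> B \<circ> proj_op \<alpha>) zero_op"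
      unfolding op_eq_def
    proof
      fix f assume "f \<in> L2 M1"
      then have "AE y in M\<beta>. B (proj_op \<alpha> f) y = 0"
        using eq L2_restrict_spaceI[OF \<alpha>] by (simp add: op_eq_def zero_op_def)
      then show "AE y in M2. (proj_op \<beta> \<circ> B \<circ> proj_op \<alpha>) f y = zero_op f y"
        unfolding AE_restrict_\<beta> by eventually_elim (auto simp: proj_op_apply zero_op_def indicator_def)
    qed
  qed
  show "wstar_closable_multiplier M\<alpha> M\<beta> \<phi>"
    if null: "\<forall>B\<in>wstar_multivalued_part M1 M2 \<phi>. op_eq M1 M2 (proj_op \<beta> \<circ> B \<circ> proj_op \<alpha>) zero_op"
    unfolding wstar_closable_multiplier_def is_op_graph_def
  proof (intro allI impI)
    fix A B A' B' assume AB: "(A, B) \<in> wstar_graph M\<alpha> M\<beta> \<phi>" and AB': "(A', B') \<in> wstar_graph M\<alpha> M\<beta> \<phi>" and eq: "op_eq M\<alpha> M\<beta> A A'"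
    define C where "C = (\<lambda>f y. B f y - B' f y)"
    have C: "C \<in> wstar_multivalued_part M\<alpha> M\<beta> \<phi>"
      using R.wstar_graph_diff[OF AB AB' eq] by (simp add: C_def wstar_multivalued_part_def)
    then have Cb: "C \<in> bounded_ops M\<alpha> M\<beta>" by (auto simp: wstar_multivalued_part_def dest: wstar_graph_bounded)
    have zero: "op_eq M1 M2 (proj_op \<beta> \<circ> (proj_op \<beta> \<circ> C) \<circ> proj_op \<alpha>) zero_op"
      using null wstar_multivalued_part_extend[OF C] by blast
    show "op_eq M\<alpha> M\<beta> B B'"
      unfolding op_eq_def
    proof
      fix f assume f: "f \<in> L2 M\<alpha>"
      then have pf: "proj_op \<alpha> f \<in> L2 M1" using L2_restrict_space_iff[OF \<alpha>] by blast
      have "AE y in M2. (proj_op \<beta> \<circ> (proj_op \<beta> \<circ> C) \<circ> proj_op \<alpha>) (proj_op \<alpha> f) y = 0"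
        using zero pf by (simp add: op_eq_def zero_op_def)
      then have 1: "AE y in M\<beta>. C (proj_op \<alpha> f) y = 0"
        unfolding AE_restrict_\<beta> by eventually_elim (auto simp: proj_op_idem, auto simp: proj_op_apply)
      have "AE x in M\<alpha>. proj_op \<alpha> f x = f x"
        using AE_space by eventually_elim (use \<alpha> in \<open>auto simp: proj_op_apply\<close>)
      then have "AE y in M\<beta>. C (proj_op \<alpha> f) y = C f y"
        by (intro bounded_ops_cong_AE[OF Cb] L2_restrict_spaceI[OF \<alpha> pf] f)
      with 1 show "AE y in M\<beta>. B f y = B' f y" by eventually_elim (simp add: C_def)
    qed
  qed
qed

end

end

section \<open>Regularity of measures on standard Borel spaces\<close>

definition polish_topology_for :: "'a measure \<Rightarrow> 'a topology \<Rightarrow> bool" where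
  "polish_topology_for M T \<longleftrightarrow> completely_metrizable_space T \<and> second_countable T \<and> topspace T = space M \<and>
     sets M = sigma_sets (topspace T) {U. openin T U}"

lemma polish_topology_forD:
  assumes "polish_topology_for M T"
  shows "completely_metrizable_space T" "second_countable T" "topspace T = space M" "metrizable_space T"
    "openin T U \<Longrightarrow> U \<in> sets M" "closedin T U \<Longrightarrow> U \<in> sets M"
proof -
  show 1: "completely_metrizable_space T" "second_countable T" and top: "topspace T = space M"
    using assms by (auto simp: polish_topology_for_def)
  show "metrizable_space T" by (rule completely_metrizable_imp_metrizable_space[OF 1(1)])
  have op: "U \<in> sets M" if "openin T U" for U
    using assms that by (auto simp: polish_topology_for_def)
  show "openin T U \<Longrightarrow> U \<in> sets M" by (rule op)
  assume U: "closedin T U"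
  then have "space M - (topspace T - U) \<in> sets M" by (intro sets.compl_sets op) auto
  moreover have "space M - (topspace T - U) = U" using closedin_subset[OF U] top by auto
  ultimately show "U \<in> sets M" by simp
qed

lemma (in finite_measure) measure_incseq_remainder:
  assumes A: "\<And>n::nat. A n \<in> sets M" and inc: "\<And>n. A n \<subseteq> A (Suc n)" and e: "0 < e"
  obtains n where "measure M ((\<Union>n. A n) - A n) < e"
proof -
  have U: "(\<Union>n. A n) \<in> sets M" using A by blast
  have "decseq (\<lambda>n. (\<Union>n. A n) - A n)" using inc by (intro decseq_SucI) auto
  moreover have "range (\<lambda>n. (\<Union>n. A n) - A n) \<subseteq> sets M" using A U by blast
  ultimately have "(\<lambda>n. measure M ((\<Union>n. A n) - A n)) \<longlonglongrightarrow> measure M (\<Inter>n. (\<Union>n. A n) - A n)"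
    by (intro finite_Lim_measure_decseq)
  moreover have "(\<Inter>n. (\<Union>n. A n) - A n) = {}" by auto
  ultimately have "(\<lambda>n. measure M ((\<Union>n. A n) - A n)) \<longlonglongrightarrow> 0" by simp
  from LIMSEQ_D[OF this e] show thesis using that by auto
qed

lemma (in finite_measure) measure_UN_geometric:
  assumes A: "\<And>i::nat. A i \<in> sets M" and e: "\<And>i. measure M (A i) \<le> e * (1/2)^i / 4"
  shows "measure M (\<Union>i. A i) \<le> e / 2"
proof -
  have g: "summable (\<lambda>i. e * (1/2)^i / 4)" "(\<Sum>i. e * (1/2)^i / 4) = e / 2"
    by (simp_all add: summable_divide summable_mult summable_geometric suminf_divide suminf_mult suminf_geometric)
  have s: "summable (\<lambda>i. measure M (A i))"
    by (rule summable_comparison_test'[OF g(1), of 0]) (simp only: real_norm_def abs_of_nonneg measure_nonneg e)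
  have "measure M (\<Union>i. A i) \<le> (\<Sum>i. measure M (A i))"
    using A s by (intro finite_measure_subadditive_countably) auto
  also have "\<dots> \<le> e / 2" unfolding g(2)[symmetric] by (rule suminf_le[OF e s g(1)])
  finally show ?thesis .
qed

context finite_measure
begin

text \<open>Open sets are increasing unions of closed sets, and the sets with the stated property form a
  \<open>\<sigma>\<close>-algebra.\<close>

lemma polish_regular:
  assumes T: "polish_topology_for M T" and A: "A \<in> sets M" and e: "0 < e"
  obtains F U where "closedin T F" "openin T U" "F \<subseteq> A" "A \<subseteq> U" "measure M (U - F) < e"
proof -
  note op = polish_topology_forD(5)[OF T] and cl = polish_topology_forD(6)[OF T]
  have "A \<in> sigma_sets (topspace T) {U. openin T U}" using A T by (simp add: polish_topology_for_def)
  then have "\<forall>e>0. \<exists>F U. closedin T F \<and> openin T U \<and> F \<subseteq> A \<and> A \<subseteq> U \<and> measure M (U - F) < e"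
  proof induction
    case (Basic U)
    then have U: "openin T U" by simp
    obtain C where C: "\<And>n::nat. closedin T (C n)" "\<And>n. C n \<subseteq> C (Suc n)" "\<Union>(range C) = U"
      using open_imp_fsigma_in[OF polish_topology_forD(4)[OF T] U] unfolding fsigma_in_ascending by blast
    show ?case
    proof (intro allI impI)
      fix e :: real assume "0 < e"
      obtain n where "measure M ((\<Union>n. C n) - C n) < e"
        by (rule measure_incseq_remainder[of C, OF cl[OF C(1)] C(2) \<open>0 < e\<close>])
      then show "\<exists>F U'. closedin T F \<and> openin T U' \<and> F \<subseteq> U \<and> U \<subseteq> U' \<and> measure M (U' - F) < e"
        using C U by (intro exI[of _ "C n"] exI[of _ U]) auto
    qed
  next
    case Empty
    then show ?case by (intro allI impI exI[of _ "{}"]) simp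
  next
    case (Compl A)
    show ?case
    proof (intro allI impI)
      fix e :: real assume "0 < e"
      from Compl.IH[THEN spec, THEN mp, OF this]
      obtain F U where FU: "closedin T F" "openin T U" "F \<subseteq> A" "A \<subseteq> U" "measure M (U - F) < e"
        by (elim exE conjE)
      have "(topspace T - F) - (topspace T - U) = U - F" using openin_subset[OF FU(2)] by auto
      then show "\<exists>F U. closedin T F \<and> openin T U \<and> F \<subseteq> topspace T - A \<and> topspace T - A \<subseteq> U \<and> measure M (U - F) < e"
        using FU by (intro exI[of _ "topspace T - U"] exI[of _ "topspace T - F"]) auto
    qed
  next
    case (Union A)
    show ?case
    proof (intro allI impI)
      fix e :: real assume e: "0 < e"
      have "\<exists>F U. closedin T F \<and> openin T U \<and> F \<subseteq> A i \<and> A i \<subseteq> U \<and> measure M (U - F) < e * (1/2)^i / 4" for i :: nat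
        by (rule Union.IH[of i, THEN spec, THEN mp]) (use e in simp)
      then obtain F U where F: "\<And>i. closedin T (F i)" and U: "\<And>i. openin T (U i)"
        and FU: "\<And>i. F i \<subseteq> A i" "\<And>i. A i \<subseteq> U i" "\<And>i. measure M (U i - F i) < e * (1/2)^i / 4" by metis
      define G where "G n = (\<Union>i<n. F i)" for n
      have G: "closedin T (G n)" for n unfolding G_def by (intro closedin_Union) (use F in auto)
      have e2: "0 < e / 2" using e by simp
      have inc: "G n \<subseteq> G (Suc n)" for n unfolding G_def by (intro UN_mono) auto
      obtain n where n: "measure M ((\<Union>n. G n) - G n) < e / 2"
        by (rule measure_incseq_remainder[of G, OF cl[OF G] inc e2])
      have UF: "measure M (\<Union>i. U i - F i) \<le> e / 2"
        using op[OF U] cl[OF F] FU(3) by (intro measure_UN_geometric) (auto intro: less_imp_le)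
      have GF: "(\<Union>n. G n) = (\<Union>i. F i)" by (auto simp: G_def)
      have m: "(\<Union>i. U i - F i) \<in> sets M" "(\<Union>n. G n) - G n \<in> sets M"
        using op[OF U] cl[OF F] cl[OF G] by auto
      have "measure M ((\<Union>i. U i) - G n) \<le> measure M ((\<Union>i. U i - F i) \<union> ((\<Union>n. G n) - G n))"
        by (rule finite_measure_mono) (use m GF in auto)
      also have "\<dots> \<le> measure M (\<Union>i. U i - F i) + measure M ((\<Union>n. G n) - G n)"
        by (rule measure_Un_le[OF m])
      also have "\<dots> < e" using n UF by simp
      finally have small: "measure M ((\<Union>i. U i) - G n) < e" .
      have "openin T (\<Union>i. U i)" using U by (intro openin_Union) auto
      moreover have "G n \<subseteq> (\<Union>i. A i)" "(\<Union>i. A i) \<subseteq> (\<Union>i. U i)"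
        using FU(1,2) unfolding G_def by blast+
      ultimately show "\<exists>F U. closedin T F \<and> openin T U \<and> F \<subseteq> (\<Union>i. A i) \<and> (\<Union>i. A i) \<subseteq> U \<and> measure M (U - F) < e"
        by (intro exI[of _ "G n"] exI[of _ "\<Union>i. U i"] conjI G small)
    qed
  qed
  from this[THEN spec, THEN mp, OF e] show thesis using that by (elim exE conjE)
qed

text \<open>For each \<open>k\<close>, finitely many balls of radius \<open>1 / Suc k\<close> cover the space up to a small set.  The
  intersection of these finite unions is closed and totally bounded, hence compact by completeness.\<close>

lemma polish_tight:
  assumes T: "polish_topology_for M T" and e: "0 < e"
  obtains K where "compactin T K" "measure M (space M - K) < e"
proof -
  obtain S d where "Metric_space S d" and complete: "Metric_space.mcomplete S d" and Td: "T = Metric_space.mtopology S d"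
    using polish_topology_forD(1)[OF T] unfolding completely_metrizable_space_def by blast
  then interpret Metric_space S d by simp
  have S: "S = space M" using polish_topology_forD(3)[OF T] Td by simp
  show thesis
  proof (cases "S = {}")
    case True
    then show thesis using that[of "{}"] e S by simp
  next
    case False
    obtain C where C: "countable C" "C \<subseteq> S" "mtopology closure_of C = S"
      using second_countable_imp_separable_space[OF polish_topology_forD(2)[OF T]] unfolding separable_space_def Td by auto
    have "C \<noteq> {}" using C(3) False by auto
    define c where "c = from_nat_into C"
    have c: "c i \<in> S" for i unfolding c_def using from_nat_into[OF \<open>C \<noteq> {}\<close>] C(2) by blast
    define G where "G k n = (\<Union>i<n. mcball (c i) (1 / real (Suc k)))" for k n
    have G: "closedin T (G k n)" for k n unfolding G_def Td by (intro closedin_Union) auto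
    have GS: "(\<Union>n. G k n) = S" for k
    proof
      show "(\<Union>n. G k n) \<subseteq> S" unfolding G_def by auto
      show "S \<subseteq> (\<Union>n. G k n)"
      proof
        fix x assume "x \<in> S"
        then have "x \<in> mtopology closure_of C" using C(3) by simp
        moreover have "0 < 1 / real (Suc k)" by simp
        ultimately obtain y where y: "y \<in> C" "y \<in> mball x (1 / real (Suc k))"
          unfolding metric_closure_of by blast
        obtain i where "y = c i" using from_nat_into_surj[OF C(1) y(1)] unfolding c_def by blast
        then have "x \<in> mcball (c i) (1 / real (Suc k))" using y(2) by (auto simp: commute)
        then show "x \<in> (\<Union>n. G k n)" unfolding G_def by blast
      qed
    qed
    have "\<exists>n. measure M (S - G k n) < e * (1/2)^k / 4" for k
    proof -
      have ek: "0 < e * (1/2)^k / 4" using e by simp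
      have inc: "G k n \<subseteq> G k (Suc n)" for n unfolding G_def by (intro UN_mono) auto
      obtain n where "measure M ((\<Union>n. G k n) - G k n) < e * (1/2)^k / 4"
        by (rule measure_incseq_remainder[of "G k", OF polish_topology_forD(6)[OF T G] inc ek])
      then show ?thesis unfolding GS by blast
    qed
    then obtain n where n: "\<And>k. measure M (S - G k (n k)) < e * (1/2)^k / 4" by metis
    define K where "K = (\<Inter>k. G k (n k))"
    have K: "closedin T K" unfolding K_def by (intro closedin_Inter) (use G in auto)
    have KS: "K \<subseteq> S" using closedin_subset[OF K] Td by simp
    have "mtotally_bounded K"
      unfolding mtotally_bounded_def
    proof (intro allI impI)
      fix r :: real assume r: "0 < r"
      obtain k :: nat where k: "1 / real (Suc k) < r / 2"
        using r by (meson half_gt_zero nat_approx_posE)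
      \<comment> \<open>the balls that meet \<open>K\<close>, recentred at points of \<open>K\<close> at the cost of doubling the radius\<close>
      define I where "I = {i. i < n k \<and> mcball (c i) (1 / real (Suc k)) \<inter> K \<noteq> {}}"
      have "\<exists>p. p \<in> mcball (c i) (1 / real (Suc k)) \<inter> K" if "i \<in> I" for i using that unfolding I_def by blast
      then obtain p where p: "\<And>i. i \<in> I \<Longrightarrow> p i \<in> mcball (c i) (1 / real (Suc k)) \<inter> K" by metis
      have "K \<subseteq> (\<Union>x\<in>p ` I. mball x r)"
      proof
        fix x assume x: "x \<in> K"
        then obtain i where i: "i < n k" "x \<in> mcball (c i) (1 / real (Suc k))"
          unfolding K_def G_def by blast
        then have iI: "i \<in> I" using x by (auto simp: I_def)
        have pS: "p i \<in> S" using p[OF iI] KS by blast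
        have "d (p i) x \<le> d (p i) (c i) + d (c i) x" using triangle pS c i(2) by auto
        also have "\<dots> \<le> 1 / real (Suc k) + 1 / real (Suc k)" using p[OF iI] i(2) by (intro add_mono) (auto simp: commute)
        also have "\<dots> < r" using k by simp
        finally have "x \<in> mball (p i) r" using pS i(2) by auto
        then show "x \<in> (\<Union>x\<in>p ` I. mball x r)" using iI by blast
      qed
      then show "\<exists>D. finite D \<and> D \<subseteq> K \<and> K \<subseteq> (\<Union>x\<in>D. mball x r)"
        using p by (intro exI[of _ "p ` I"]) (auto simp: I_def)
    qed
    then have "compactin mtopology (mtopology closure_of K)"
      using mtotally_bounded_eq_compact_closure_of[OF complete] by blast
    then have compact: "compactin T K" using closure_of_closedin[of mtopology K] K Td by simp
    have "measure M (\<Union>k. S - G k (n k)) \<le> e / 2"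
      using n polish_topology_forD(6)[OF T G] S by (intro measure_UN_geometric) (auto intro: less_imp_le)
    also have "(\<Union>k. S - G k (n k)) = space M - K" unfolding K_def S by auto
    finally show thesis using that[OF compact] e by simp
  qed
qed

text \<open>On a suitable compact set of almost full measure, countably many given measurable sets are
  relatively clopen: remove the small differences between open and closed approximations of them.\<close>

lemma polish_compact_clopen:
  assumes T: "polish_topology_for M T" and A: "\<And>n::nat. A n \<in> sets M" and e: "0 < e"
  obtains K where "compactin T K" "K \<in> sets M" "measure M (space M - K) < e"
    "\<And>n. closedin T (K \<inter> A n)" "\<And>n. closedin T (K - A n)"
proof -
  note op = polish_topology_forD(5)[OF T] and cl = polish_topology_forD(6)[OF T]
  have "\<exists>F U. closedin T F \<and> openin T U \<and> F \<subseteq> A n \<and> A n \<subseteq> U \<and> measure M (U - F) < e * (1/2)^n / 4" for n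
    by (rule polish_regular[OF T A[of n], of "e * (1/2)^n / 4"]) (use e in auto)
  then obtain F U where F: "\<And>i. closedin T (F i)" and U: "\<And>i. openin T (U i)"
    and FU: "\<And>i. F i \<subseteq> A i" "\<And>i. A i \<subseteq> U i" "\<And>i. measure M (U i - F i) < e * (1/2)^i / 4" by metis
  have "0 < e / 2" using e by simp
  then obtain K0 where K0: "compactin T K0" "measure M (space M - K0) < e / 2" by (rule polish_tight[OF T])
  have K0c: "closedin T K0"
    using compactin_imp_closedin[OF metrizable_imp_Hausdorff_space[OF polish_topology_forD(4)[OF T]] K0(1)] .
  define D where "D = (\<Inter>n. (topspace T - U n) \<union> F n)"
  have D: "closedin T D" unfolding D_def using F U by (intro closedin_Inter) auto
  define K where "K = K0 \<inter> D"
  have K: "closedin T K" unfolding K_def by (rule closedin_Int[OF K0c D])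
  have compact: "compactin T K" by (rule closed_compactin[OF K0(1) _ K]) (simp add: K_def)
  have m: "space M - K0 \<in> sets M" "(\<Union>n. U n - F n) \<in> sets M" using cl[OF K0c] op[OF U] cl[OF F] by auto
  have "measure M (\<Union>n. U n - F n) \<le> e / 2"
    using op[OF U] cl[OF F] FU(3) by (intro measure_UN_geometric) (auto intro: less_imp_le)
  moreover have "measure M (space M - K) \<le> measure M ((space M - K0) \<union> (\<Union>n. U n - F n))"
    by (rule finite_measure_mono) (use m polish_topology_forD(3)[OF T] in \<open>auto simp: K_def D_def\<close>)
  moreover have "measure M ((space M - K0) \<union> (\<Union>n. U n - F n)) \<le> measure M (space M - K0) + measure M (\<Union>n. U n - F n)"
    by (rule measure_Un_le[OF m])
  ultimately have "measure M (space M - K) < e" using K0(2) by simp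
  moreover have "K \<inter> A n = K \<inter> F n" for n using FU(1,2)[of n] by (auto simp: K_def D_def)
  then have "closedin T (K \<inter> A n)" for n using closedin_Int[OF K F] by simp
  moreover have "K - A n = K \<inter> (topspace T - U n)" for n
    using FU(1,2)[of n] closedin_subset[OF K] by (auto simp: K_def D_def)
  then have "closedin T (K - A n)" for n using closedin_Int[OF K closedin_diff[OF closedin_topspace U]] by simp
  ultimately show thesis using that compact cl[OF K] by blast
qed

text \<open>The finite unions of sets of a countable base are dense in the measure algebra, by outer regularity.\<close>

lemma polish_countable_dense:
  assumes T: "polish_topology_for M T"
  obtains \<A> where "countable \<A>" "\<A> \<subseteq> sets M"
    "\<And>A e. A \<in> sets M \<Longrightarrow> 0 < e \<Longrightarrow> \<exists>D\<in>\<A>. measure M ((A - D) \<union> (D - A)) < e"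
proof -
  obtain \<B> where \<B>: "countable \<B>" "\<And>V. V \<in> \<B> \<Longrightarrow> openin T V"
    and base: "\<And>U x. openin T U \<Longrightarrow> x \<in> U \<Longrightarrow> \<exists>V\<in>\<B>. x \<in> V \<and> V \<subseteq> U"
    using polish_topology_forD(2)[OF T] unfolding second_countable_def by metis
  define \<A> where "\<A> = Union ` {F. finite F \<and> F \<subseteq> \<B>}"
  show thesis
  proof
    show "countable \<A>" unfolding \<A>_def using countable_Collect_finite_subset[OF \<B>(1)] by simp
    show \<A>: "\<A> \<subseteq> sets M"
      unfolding \<A>_def using polish_topology_forD(5)[OF T \<B>(2)] by (auto intro!: sets.finite_Union)
    fix A and e :: real assume A: "A \<in> sets M" and e: "0 < e"
    then have e2: "0 < e / 2" by simp
    obtain F U where FU: "closedin T F" "openin T U" "F \<subseteq> A" "A \<subseteq> U" "measure M (U - F) < e / 2"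
      by (rule polish_regular[OF T A e2]) blast
    note Us = polish_topology_forD(5)[OF T FU(2)] and Fs = polish_topology_forD(6)[OF T FU(1)]
    define \<B>' where "\<B>' = insert {} {V \<in> \<B>. V \<subseteq> U}"
    have \<B>': "countable \<B>'" "\<B>' \<noteq> {}" using \<B>(1) by (auto simp: \<B>'_def)
    define b where "b = from_nat_into \<B>'"
    have b: "b i \<in> \<B>'" for i unfolding b_def by (rule from_nat_into[OF \<B>'(2)])
    have bU: "(\<Union>n. \<Union>i<n. b i) = U"
    proof
      show "(\<Union>n. \<Union>i<n. b i) \<subseteq> U" using b by (fastforce simp: \<B>'_def)
      show "U \<subseteq> (\<Union>n. \<Union>i<n. b i)"
      proof
        fix x assume "x \<in> U"
        then obtain V where V: "V \<in> \<B>'" "x \<in> V" using base[OF FU(2)] by (auto simp: \<B>'_def)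
        obtain i where "V = b i" using from_nat_into_surj[OF \<B>'(1) V(1)] unfolding b_def by blast
        then show "x \<in> (\<Union>n. \<Union>i<n. b i)" using V(2) by blast
      qed
    qed
    have "openin T (b i)" for i using b[of i] \<B>(2) by (auto simp: \<B>'_def)
    then have bs: "(\<Union>i<n. b i) \<in> sets M" for n using polish_topology_forD(5)[OF T] by blast
    have inc: "(\<Union>i<n. b i) \<subseteq> (\<Union>i<Suc n. b i)" for n by (intro UN_mono) auto
    obtain n where n: "measure M ((\<Union>n. \<Union>i<n. b i) - (\<Union>i<n. b i)) < e / 2"
      by (rule measure_incseq_remainder[of "\<lambda>n. \<Union>i<n. b i", OF bs inc e2])
    let ?D = "\<Union>i<n. b i"
    have "?D = \<Union>(b ` {..<n} - {{}})" by auto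
    moreover have "b ` {..<n} - {{}} \<subseteq> \<B>" using b by (auto simp: \<B>'_def)
    ultimately have "?D \<in> \<A>" unfolding \<A>_def by (intro image_eqI[where x="b ` {..<n} - {{}}"]) auto
    moreover have "measure M ((A - ?D) \<union> (?D - A)) < e"
    proof -
      have "?D \<subseteq> U" using bU by blast
      then have "measure M ((A - ?D) \<union> (?D - A)) \<le> measure M ((U - F) \<union> (U - ?D))"
        using FU(3,4) Us Fs bs by (intro finite_measure_mono) auto
      also have "\<dots> \<le> measure M (U - F) + measure M (U - ?D)"
        using Us Fs bs by (intro measure_Un_le) auto
      also have "\<dots> < e" using FU(5) n unfolding bU by simp
      finally show ?thesis .
    qed
    ultimately show "\<exists>D\<in>\<A>. measure M ((A - D) \<union> (D - A)) < e" by blast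
  qed
qed

end

section \<open>Operators vanishing on rectangles\<close>

definition vanishes_on :: "'a measure \<Rightarrow> 'b measure \<Rightarrow> ('a, 'b) oper \<Rightarrow> 'a set \<Rightarrow> 'b set \<Rightarrow> bool" where
  "vanishes_on M N T \<alpha> \<beta> \<longleftrightarrow> (\<forall>f\<in>L2 M. AE y in N. y \<in> \<beta> \<longrightarrow> T (proj_op \<alpha> f) y = 0)"

lemma vanishes_on_iff: "vanishes_on M N T \<alpha> \<beta> \<longleftrightarrow> op_eq M N (proj_op \<beta> \<circ> T \<circ> proj_op \<alpha>) zero_op"
proof -
  have "(proj_op \<beta> \<circ> T \<circ> proj_op \<alpha>) f y = zero_op f y \<longleftrightarrow> (y \<in> \<beta> \<longrightarrow> T (proj_op \<alpha> f) y = 0)" for f y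
    by (simp add: proj_op_apply[of \<beta>] zero_op_def indicator_def)
  then show ?thesis unfolding vanishes_on_def op_eq_def by simp
qed

lemma vanishes_on_subset:
  assumes v: "vanishes_on M N T \<alpha> \<beta>" and \<alpha>: "\<alpha>' \<in> sets M" "\<alpha>' \<subseteq> \<alpha>" and \<beta>: "\<beta>' \<subseteq> \<beta>"
  shows "vanishes_on M N T \<alpha>' \<beta>'"
  unfolding vanishes_on_def
proof
  fix f assume "f \<in> L2 M"
  then have "AE y in N. y \<in> \<beta> \<longrightarrow> T (proj_op \<alpha> (proj_op \<alpha>' f)) y = 0"
    using v proj_op_L2[OF \<alpha>(1)] unfolding vanishes_on_def by blast
  moreover have "proj_op \<alpha> (proj_op \<alpha>' f) = proj_op \<alpha>' f"
    using \<alpha>(2) by (intro ext) (auto simp: proj_op_apply indicator_def)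
  ultimately show "AE y in N. y \<in> \<beta>' \<longrightarrow> T (proj_op \<alpha>' f) y = 0"
    using \<beta> by (auto elim: eventually_mono)
qed

lemma vanishes_on_empty:
  assumes "T \<in> bounded_ops M N"
  shows "vanishes_on M N T {} \<beta>" "vanishes_on M N T \<alpha> {}"
  using bounded_ops_zero[OF assms] by (auto simp: vanishes_on_def proj_op_apply elim: eventually_mono)

lemma vanishes_on_union_right:
  assumes "vanishes_on M N T \<alpha> \<beta>" "vanishes_on M N T \<alpha> \<beta>'"
  shows "vanishes_on M N T \<alpha> (\<beta> \<union> \<beta>')"
  using assms unfolding vanishes_on_def by (auto elim: eventually_elim2)

lemma vanishes_on_union_left:
  assumes T: "T \<in> bounded_ops M N" and \<alpha>: "\<alpha> \<in> sets M" "\<alpha>' \<in> sets M" "\<alpha> \<inter> \<alpha>' = {}"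
    and v: "vanishes_on M N T \<alpha> \<beta>" "vanishes_on M N T \<alpha>' \<beta>"
  shows "vanishes_on M N T (\<alpha> \<union> \<alpha>') \<beta>"
  unfolding vanishes_on_def
proof
  fix f assume f: "f \<in> L2 M"
  have "proj_op (\<alpha> \<union> \<alpha>') f = (\<lambda>x. proj_op \<alpha> f x + proj_op \<alpha>' f x)"
    using \<alpha>(3) by (intro ext) (auto simp: proj_op_apply indicator_def)
  then have "AE y in N. T (proj_op (\<alpha> \<union> \<alpha>') f) y = T (proj_op \<alpha> f) y + T (proj_op \<alpha>' f) y"
    using bounded_ops_add[OF T proj_op_L2[OF \<alpha>(1) f] proj_op_L2[OF \<alpha>(2) f]] by simp
  moreover have "AE y in N. y \<in> \<beta> \<longrightarrow> T (proj_op \<alpha> f) y = 0" "AE y in N. y \<in> \<beta> \<longrightarrow> T (proj_op \<alpha>' f) y = 0"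
    using v f by (auto simp: vanishes_on_def)
  ultimately show "AE y in N. y \<in> \<beta> \<longrightarrow> T (proj_op (\<alpha> \<union> \<alpha>') f) y = 0"
    by eventually_elim simp
qed

text \<open>Splitting both sides of the rectangle along one member of the cover leaves pieces that the other members
  cover.\<close>

lemma vanishes_on_finite_cover:
  fixes A :: "nat \<Rightarrow> 'a set" and B :: "nat \<Rightarrow> 'b set"
  assumes T: "T \<in> bounded_ops M N" and J: "finite J"
    and A: "\<And>n. A n \<in> sets M" and v: "\<And>n. vanishes_on M N T (A n) (B n)"
    and "\<alpha> \<in> sets M" "\<alpha> \<times> \<beta> \<subseteq> (\<Union>n\<in>J. A n \<times> B n)"
  shows "vanishes_on M N T \<alpha> \<beta>"
  using J assms(5,6)
proof (induction J arbitrary: \<alpha> \<beta>)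
  case empty
  then have "\<alpha> = {} \<or> \<beta> = {}" by auto
  then show ?case using vanishes_on_empty[OF T] by blast
next
  case (insert n J)
  have a: "\<alpha> \<inter> A n \<in> sets M" "\<alpha> - A n \<in> sets M" using insert.prems A by auto
  have "vanishes_on M N T (\<alpha> \<inter> A n) (\<beta> \<inter> B n)"
    by (rule vanishes_on_subset[OF v a(1), of n]) auto
  moreover have "vanishes_on M N T (\<alpha> \<inter> A n) (\<beta> - B n)"
    by (rule insert.IH[OF a(1)]) (use insert.prems in fastforce)
  ultimately have "vanishes_on M N T (\<alpha> \<inter> A n) (\<beta> \<inter> B n \<union> (\<beta> - B n))"
    by (rule vanishes_on_union_right)
  then have 1: "vanishes_on M N T (\<alpha> \<inter> A n) \<beta>" by (simp add: Int_Diff_Un)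
  have 2: "vanishes_on M N T (\<alpha> - A n) \<beta>"
    by (rule insert.IH[OF a(2)]) (use insert.prems in fastforce)
  have "vanishes_on M N T (\<alpha> \<inter> A n \<union> (\<alpha> - A n)) \<beta>"
    by (rule vanishes_on_union_left[OF T a _ 1 2]) auto
  then show ?case by (simp add: Int_Diff_Un)
qed

text \<open>The measure \<open>|f|\<^sup>2 dM\<close> is finite and controls how much of \<open>f\<close> is lost by cutting off.\<close>

lemma density_norm_square:
  assumes f: "f \<in> L2 M"
  shows "finite_measure (density M (\<lambda>x. ennreal ((norm (f x))\<^sup>2)))"
    and "A \<in> sets M \<Longrightarrow> measure (density M (\<lambda>x. ennreal ((norm (f x))\<^sup>2))) A = (L2_norm M (proj_op A f))\<^sup>2"
proof -
  have [measurable]: "f \<in> borel_measurable M" by (rule L2_measurable[OF f])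
  have em: "emeasure (density M (\<lambda>x. ennreal ((norm (f x))\<^sup>2))) A = ennreal ((L2_norm M (proj_op A f))\<^sup>2)"
    if A: "A \<in> sets M" for A
  proof -
    have "emeasure (density M (\<lambda>x. ennreal ((norm (f x))\<^sup>2))) A = (\<integral>\<^sup>+x. ennreal ((norm (f x))\<^sup>2) * indicator A x \<partial>M)"
      using A by (intro emeasure_density) measurable
    also have "\<dots> = (\<integral>\<^sup>+x. ennreal ((norm (proj_op A f x))\<^sup>2) \<partial>M)"
      by (intro nn_integral_cong) (auto simp: proj_op_apply indicator_def)
    finally show ?thesis by (simp add: L2_nn_integral[OF proj_op_L2[OF A f]])
  qed
  show "finite_measure (density M (\<lambda>x. ennreal ((norm (f x))\<^sup>2)))"
    by (rule finite_measureI) (simp add: em)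
  show "A \<in> sets M \<Longrightarrow> measure (density M (\<lambda>x. ennreal ((norm (f x))\<^sup>2))) A = (L2_norm M (proj_op A f))\<^sup>2"
    by (simp add: em measure_def)
qed

lemma polish_topology_for_cong:
  "space M' = space M \<Longrightarrow> sets M' = sets M \<Longrightarrow> polish_topology_for M' T \<longleftrightarrow> polish_topology_for M T"
  by (simp add: polish_topology_for_def)

lemma L2_compact_clopen:
  assumes T: "polish_topology_for M T" and f: "f \<in> L2 M" and A: "\<And>n::nat. A n \<in> sets M" and e: "0 < e"
  obtains K where "compactin T K" "K \<in> sets M" "L2_norm M (proj_op (space M - K) f) < e"
    "\<And>n. closedin T (K \<inter> A n)" "\<And>n. closedin T (K - A n)"
proof -
  let ?D = "density M (\<lambda>x. ennreal ((norm (f x))\<^sup>2))"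
  interpret finite_measure ?D by (rule density_norm_square(1)[OF f])
  have T': "polish_topology_for ?D T" using T by (simp add: polish_topology_for_cong[of ?D M])
  have A': "A n \<in> sets ?D" for n using A by simp
  have e2: "0 < e\<^sup>2" using e by simp
  obtain K where K: "compactin T K" "K \<in> sets ?D" "measure ?D (space ?D - K) < e\<^sup>2"
    "\<And>n. closedin T (K \<inter> A n)" "\<And>n. closedin T (K - A n)"
    by (rule polish_compact_clopen[where A = A, OF T' A' e2]) blast
  have "(L2_norm M (proj_op (space M - K) f))\<^sup>2 < e\<^sup>2"
    using K(2,3) density_norm_square(2)[OF f, of "space M - K"] by auto
  then have "L2_norm M (proj_op (space M - K) f) < e" using e by (auto intro: power2_less_imp_less)
  then show thesis using that K by simp
qed

text \<open>Up to small sets both sides of the rectangle are compact, and the sides of the covering rectangles are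
  relatively open in them, so that finitely many of the covering rectangles suffice.\<close>

lemma vanishes_on_countable_cover:
  fixes A :: "nat \<Rightarrow> 'a set" and B :: "nat \<Rightarrow> 'b set"
  assumes M: "polish_topology_for M S" and N: "polish_topology_for N S'" and T: "T \<in> bounded_ops M N"
    and A: "\<And>n. A n \<in> sets M" and B: "\<And>n. B n \<in> sets N" and v: "\<And>n. vanishes_on M N T (A n) (B n)"
    and \<alpha>: "\<alpha> \<in> sets M" and \<beta>: "\<beta> \<in> sets N" and cover: "\<alpha> \<times> \<beta> \<subseteq> (\<Union>n. A n \<times> B n)"
  shows "vanishes_on M N T \<alpha> \<beta>"
  unfolding vanishes_on_def
proof
  fix f assume f: "f \<in> L2 M"
  note pf = proj_op_L2[OF \<alpha> f]
  note Tf = bounded_ops_L2[OF T pf]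
  define g where "g = proj_op \<beta> (T (proj_op \<alpha> f))"
  have g: "g \<in> L2 N" unfolding g_def by (rule proj_op_L2[OF \<beta> Tf])
  have T0: "0 \<le> op_norm M N T" by (rule op_norm_nonneg[OF T])
  have small: "(L2_norm N g)\<^sup>2 \<le> e * (op_norm M N T * (L2_norm N g + L2_norm M f))" if e: "0 < e" for e
  proof -
    \<comment> \<open>the rectangle itself goes in front, so that its compact part is closed\<close>
    define A' where "A' n = (if n = 0 then \<alpha> else A (n - 1))" for n
    define B' where "B' n = (if n = 0 then \<beta> else B (n - 1))" for n
    have A': "A' n \<in> sets M" for n using A \<alpha> by (simp add: A'_def)
    have B': "B' n \<in> sets N" for n using B \<beta> by (simp add: B'_def)
    obtain K where K: "compactin S K" "K \<in> sets M" "L2_norm M (proj_op (space M - K) f) < e"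
      "\<And>n. closedin S (K \<inter> A' n)" "\<And>n. closedin S (K - A' n)"
      by (rule L2_compact_clopen[where A = A', OF M f A' e]) blast
    obtain L where L: "compactin S' L" "L \<in> sets N" "L2_norm N (proj_op (space N - L) g) < e"
      "\<And>n. closedin S' (L \<inter> B' n)" "\<And>n. closedin S' (L - B' n)"
      by (rule L2_compact_clopen[where A = B', OF N g B' e]) blast
    define U where "U n = topspace S - (K - A n)" for n
    define V where "V n = topspace S' - (L - B n)" for n
    have U: "openin S (U n)" for n unfolding U_def using K(5)[of "Suc n"] by (simp add: A'_def openin_diff)
    have V: "openin S' (V n)" for n unfolding V_def using L(5)[of "Suc n"] by (simp add: B'_def openin_diff)
    have "compactin S (K \<inter> \<alpha>)" by (rule closed_compactin[OF K(1)]) (use K(4)[of 0] in \<open>auto simp: A'_def\<close>)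
    moreover have "compactin S' (L \<inter> \<beta>)" by (rule closed_compactin[OF L(1)]) (use L(4)[of 0] in \<open>auto simp: B'_def\<close>)
    ultimately have compact: "compactin (prod_topology S S') ((K \<inter> \<alpha>) \<times> (L \<inter> \<beta>))" by (simp add: compactin_Times)
    have KS: "K \<subseteq> topspace S" "L \<subseteq> topspace S'" using K(1) L(1) compactin_subset_topspace by blast+
    have "(K \<inter> \<alpha>) \<times> (L \<inter> \<beta>) \<subseteq> \<Union>(range (\<lambda>n. U n \<times> V n))"
    proof
      fix z assume z: "z \<in> (K \<inter> \<alpha>) \<times> (L \<inter> \<beta>)"
      then obtain n where n: "z \<in> A n \<times> B n" using cover by auto
      have "z \<in> U n \<times> V n" using z n KS unfolding U_def V_def by auto
      then show "z \<in> \<Union>(range (\<lambda>n. U n \<times> V n))" by blast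
    qed
    moreover have "openin (prod_topology S S') W" if "W \<in> range (\<lambda>n. U n \<times> V n)" for W
      using that U V by (auto simp: openin_prod_Times_iff)
    ultimately obtain F where F: "finite F" "F \<subseteq> range (\<lambda>n. U n \<times> V n)" "(K \<inter> \<alpha>) \<times> (L \<inter> \<beta>) \<subseteq> \<Union>F"
      using compactinD[OF compact, of "range (\<lambda>n. U n \<times> V n)"] by blast
    then obtain J where J: "finite J" "F = (\<lambda>n. U n \<times> V n) ` J" using finite_subset_image[OF F(1,2)] by blast
    have "(K \<inter> \<alpha>) \<times> (L \<inter> \<beta>) \<subseteq> (\<Union>n\<in>J. A n \<times> B n)"
    proof
      fix z assume z: "z \<in> (K \<inter> \<alpha>) \<times> (L \<inter> \<beta>)"
      then have "z \<in> \<Union>F" using F(3) by (rule rev_subsetD)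
      then obtain n where n: "n \<in> J" "z \<in> U n \<times> V n" unfolding J(2) by blast
      have "z \<in> A n \<times> B n" using z n(2) unfolding U_def V_def by auto
      then show "z \<in> (\<Union>n\<in>J. A n \<times> B n)" using n(1) by blast
    qed
    then have "vanishes_on M N T (K \<inter> \<alpha>) (L \<inter> \<beta>)"
      using K(2) \<alpha> by (intro vanishes_on_finite_cover[OF T J(1) A v]) auto
    then have van: "AE y in N. y \<in> L \<inter> \<beta> \<longrightarrow> T (proj_op (K \<inter> \<alpha>) f) y = 0"
      using f by (simp add: vanishes_on_def)
    have K\<alpha>: "K \<inter> \<alpha> \<in> sets M" "\<alpha> - K \<in> sets M" using K(2) \<alpha> by auto
    note p1 = proj_op_L2[OF K\<alpha>(1) f] and p2 = proj_op_L2[OF K\<alpha>(2) f]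
    note T1 = bounded_ops_L2[OF T p1] and T2 = bounded_ops_L2[OF T p2]
    have split: "AE y in N. T (proj_op \<alpha> f) y = T (proj_op (K \<inter> \<alpha>) f) y + T (proj_op (\<alpha> - K) f) y"
    proof -
      have "proj_op \<alpha> f = (\<lambda>x. proj_op (K \<inter> \<alpha>) f x + proj_op (\<alpha> - K) f x)"
        by (intro ext) (auto simp: proj_op_apply indicator_def)
      then show ?thesis using bounded_ops_add[OF T p1 p2] by simp
    qed
    have "complex_of_real ((L2_norm N g)\<^sup>2) = L2_inner N (T (proj_op \<alpha> f)) g"
      unfolding L2_inner_self[symmetric]
      unfolding L2_inner_def by (rule Bochner_Integration.integral_cong) (auto simp: g_def proj_op_apply indicator_def)
    also have "\<dots> = L2_inner N (\<lambda>y. T (proj_op (K \<inter> \<alpha>) f) y + T (proj_op (\<alpha> - K) f) y) g"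
      by (rule L2_inner_cong_AE[OF Tf L2_add[OF T1 T2] g g split]) simp
    also have "\<dots> = L2_inner N (T (proj_op (K \<inter> \<alpha>) f)) g + L2_inner N (T (proj_op (\<alpha> - K) f)) g"
      by (rule L2_inner_add_left[OF T1 T2 g])
    also have "L2_inner N (T (proj_op (K \<inter> \<alpha>) f)) g = L2_inner N (T (proj_op (K \<inter> \<alpha>) f)) (proj_op (space N - L) g)"
      unfolding L2_inner_def
    proof (rule integral_cong_AE)
      have L': "space N - L \<in> sets N" using L(2) by auto
      show "(\<lambda>y. T (proj_op (K \<inter> \<alpha>) f) y * cnj (g y)) \<in> borel_measurable N"
        "(\<lambda>y. T (proj_op (K \<inter> \<alpha>) f) y * cnj (proj_op (space N - L) g y)) \<in> borel_measurable N"
        by (intro borel_measurable_integrable L2_inner_integrable T1 g proj_op_L2[OF L'])+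
      show "AE y in N. T (proj_op (K \<inter> \<alpha>) f) y * cnj (g y) = T (proj_op (K \<inter> \<alpha>) f) y * cnj (proj_op (space N - L) g y)"
        using van AE_space by eventually_elim (auto simp: g_def proj_op_apply indicator_def)
    qed
    finally have "(L2_norm N g)\<^sup>2 = norm (L2_inner N (T (proj_op (K \<inter> \<alpha>) f)) (proj_op (space N - L) g) + L2_inner N (T (proj_op (\<alpha> - K) f)) g)"
      by (metis norm_of_real abs_of_nonneg zero_le_power2)
    also have "\<dots> \<le> norm (L2_inner N (T (proj_op (K \<inter> \<alpha>) f)) (proj_op (space N - L) g)) + norm (L2_inner N (T (proj_op (\<alpha> - K) f)) g)"
      by (rule norm_triangle_ineq)
    also have "\<dots> \<le> (op_norm M N T * L2_norm M f) * e + (op_norm M N T * e) * L2_norm N g"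
    proof (rule add_mono)
      have "norm (L2_inner N (T (proj_op (K \<inter> \<alpha>) f)) (proj_op (space N - L) g)) \<le>
          L2_norm N (T (proj_op (K \<inter> \<alpha>) f)) * L2_norm N (proj_op (space N - L) g)"
        using L(2) by (intro L2_cauchy_schwarz T1 proj_op_L2 g) auto
      also have "\<dots> \<le> (op_norm M N T * L2_norm M f) * e"
      proof (rule mult_mono)
        have "L2_norm N (T (proj_op (K \<inter> \<alpha>) f)) \<le> op_norm M N T * L2_norm M (proj_op (K \<inter> \<alpha>) f)" by (rule op_norm_bound[OF T p1])
        also have "\<dots> \<le> op_norm M N T * L2_norm M f" by (intro mult_left_mono L2_norm_proj_op_le K\<alpha> f T0)
        finally show "L2_norm N (T (proj_op (K \<inter> \<alpha>) f)) \<le> op_norm M N T * L2_norm M f" .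
      qed (use L(3) T0 in auto)
      finally show "norm (L2_inner N (T (proj_op (K \<inter> \<alpha>) f)) (proj_op (space N - L) g)) \<le> (op_norm M N T * L2_norm M f) * e" .
      have "norm (L2_inner N (T (proj_op (\<alpha> - K) f)) g) \<le> L2_norm N (T (proj_op (\<alpha> - K) f)) * L2_norm N g"
        by (rule L2_cauchy_schwarz[OF T2 g])
      also have "\<dots> \<le> (op_norm M N T * e) * L2_norm N g"
      proof (rule mult_right_mono)
        have "L2_norm M (proj_op (\<alpha> - K) f) \<le> L2_norm M (proj_op (space M - K) f)"
          using K(2) sets.sets_into_space[OF \<alpha>]
          by (intro L2_norm_mono L2_measurable[OF p2] proj_op_L2 f) (auto simp: proj_op_apply indicator_def)
        then have "L2_norm M (proj_op (\<alpha> - K) f) \<le> e" using K(3) by simp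
        then have "op_norm M N T * L2_norm M (proj_op (\<alpha> - K) f) \<le> op_norm M N T * e" by (intro mult_left_mono T0)
        then show "L2_norm N (T (proj_op (\<alpha> - K) f)) \<le> op_norm M N T * e" using op_norm_bound[OF T p2] by simp
      qed simp
      finally show "norm (L2_inner N (T (proj_op (\<alpha> - K) f)) g) \<le> (op_norm M N T * e) * L2_norm N g" .
    qed
    also have "\<dots> = e * (op_norm M N T * (L2_norm N g + L2_norm M f))" by (simp add: algebra_simps)
    finally show ?thesis .
  qed
  have "(L2_norm N g)\<^sup>2 \<le> 0 + e" if e: "0 < e" for e
  proof -
    define c where "c = op_norm M N T * (L2_norm N g + L2_norm M f)"
    have c: "0 \<le> c" using T0 by (simp add: c_def)
    have "(L2_norm N g)\<^sup>2 \<le> e / (c + 1) * c" using small[of "e / (c + 1)"] e c unfolding c_def[symmetric] by simp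
    also have "\<dots> \<le> e" using e c by (simp add: field_simps)
    finally show ?thesis by simp
  qed
  then have "(L2_norm N g)\<^sup>2 \<le> 0" by (rule field_le_epsilon)
  then have "AE y in N. g y = 0" by (intro L2_norm_eq_0D[OF g]) simp
  then show "AE y in N. y \<in> \<beta> \<longrightarrow> T (proj_op \<alpha> f) y = 0"
    by eventually_elim (auto simp: g_def proj_op_apply indicator_def)
qed

lemma vanishes_on_null:
  assumes T: "T \<in> bounded_ops M N" and "\<alpha> \<in> null_sets M"
  shows "vanishes_on M N T \<alpha> \<beta>"
  unfolding vanishes_on_def
proof
  fix f assume f: "f \<in> L2 M"
  have \<alpha>: "\<alpha> \<in> sets M" using assms(2) by blast
  have "AE x in M. proj_op \<alpha> f x = 0"
    using AE_not_in[OF assms(2)] by eventually_elim (simp add: proj_op_apply)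
  then have "AE y in N. T (proj_op \<alpha> f) y = T (\<lambda>x. 0) y"
    by (intro bounded_ops_cong_AE[OF T] proj_op_L2[OF \<alpha> f] L2_zero)
  with bounded_ops_zero[OF T] show "AE y in N. y \<in> \<beta> \<longrightarrow> T (proj_op \<alpha> f) y = 0" by eventually_elim simp
qed

lemma vanishes_on_marginal_cover:
  assumes M: "standard_borel_measure M" and N: "standard_borel_measure N" and T: "T \<in> bounded_ops M N"
    and \<C>: "countable \<C>" "\<C> \<subseteq> rectangles M N"
    and v: "\<And>\<alpha> \<beta>. \<alpha> \<in> sets M \<Longrightarrow> \<beta> \<in> sets N \<Longrightarrow> \<alpha> \<times> \<beta> \<in> \<C> \<Longrightarrow> vanishes_on M N T \<alpha> \<beta>"
    and \<alpha>: "\<alpha> \<in> sets M" and \<beta>: "\<beta> \<in> sets N" and cover: "marg_contains M N (\<Union>\<C>) (\<alpha> \<times> \<beta>)"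
  shows "vanishes_on M N T \<alpha> \<beta>"
proof -
  obtain S where S: "polish_topology_for M S" using M unfolding standard_borel_measure_def polish_topology_for_def by blast
  obtain S' where S': "polish_topology_for N S'" using N unfolding standard_borel_measure_def polish_topology_for_def by blast
  obtain X0 Y0 where X0: "X0 \<in> null_sets M" and Y0: "Y0 \<in> null_sets N"
    and sub: "\<alpha> \<times> \<beta> - \<Union>\<C> \<subseteq> X0 \<times> space N \<union> space M \<times> Y0"
    using cover unfolding marg_contains_def marg_null_def by blast
  \<comment> \<open>adjoin the empty rectangle to have something to enumerate even if \<open>\<C>\<close> is empty\<close>
  define \<D> where "\<D> = insert ({} \<times> {}) \<C>"
  have \<D>: "countable \<D>" "\<D> \<noteq> {}" using \<C>(1) by (auto simp: \<D>_def)
  have "\<exists>A B. A \<in> sets M \<and> B \<in> sets N \<and> from_nat_into \<D> n = A \<times> B \<and> vanishes_on M N T A B" for n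
  proof -
    have "from_nat_into \<D> n \<in> \<D>" by (rule from_nat_into[OF \<D>(2)])
    then consider "from_nat_into \<D> n = {} \<times> {}" | "from_nat_into \<D> n \<in> \<C>" by (auto simp: \<D>_def)
    then show ?thesis
    proof cases
      case 1
      show ?thesis by (rule exI[of _ "{}"], rule exI[of _ "{}"]) (use 1 vanishes_on_empty[OF T] in simp)
    next
      case 2
      then obtain A B where "A \<in> sets M" "B \<in> sets N" "from_nat_into \<D> n = A \<times> B"
        using \<C>(2) unfolding rectangles_def by blast
      then show ?thesis using v 2 by metis
    qed
  qed
  then obtain A B where A: "\<And>n. A n \<in> sets M" and B: "\<And>n. B n \<in> sets N"
    and AB: "\<And>n. from_nat_into \<D> n = A n \<times> B n" "\<And>n. vanishes_on M N T (A n) (B n)" by metis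
  have "\<Union>\<C> = (\<Union>n. A n \<times> B n)"
  proof -
    have "\<Union>\<C> = \<Union>\<D>" by (simp add: \<D>_def)
    also have "\<dots> = \<Union>(range (from_nat_into \<D>))" using range_from_nat_into[OF \<D>(2,1)] by simp
    finally show ?thesis by (simp add: AB(1))
  qed
  have cov: "(\<alpha> - X0) \<times> (\<beta> - Y0) \<subseteq> (\<Union>n. A n \<times> B n)"
  proof
    fix z assume z: "z \<in> (\<alpha> - X0) \<times> (\<beta> - Y0)"
    then have z': "z \<notin> X0 \<times> space N \<union> space M \<times> Y0" "z \<in> \<alpha> \<times> \<beta>" by auto
    have "z \<in> \<Union>\<C>"
    proof (rule ccontr)
      assume "z \<notin> \<Union>\<C>"
      with z'(2) have "z \<in> \<alpha> \<times> \<beta> - \<Union>\<C>" by (rule DiffI)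
      from subsetD[OF sub this] z'(1) show False by (rule notE[rotated])
    qed
    then show "z \<in> (\<Union>n. A n \<times> B n)" by (simp only: \<open>\<Union>\<C> = (\<Union>n. A n \<times> B n)\<close>)
  qed
  have a: "\<alpha> - X0 \<in> sets M" "\<alpha> \<inter> X0 \<in> sets M" and b: "\<beta> - Y0 \<in> sets N" using \<alpha> \<beta> X0 Y0 by auto
  have "vanishes_on M N T (\<alpha> - X0) (\<beta> - Y0)"
    by (rule vanishes_on_countable_cover[OF S S' T A B AB(2) a(1) b cov])
  then have 1: "vanishes_on M N T (\<alpha> - X0) \<beta>"
    unfolding vanishes_on_def
  proof (intro ballI)
    fix f assume v: "\<forall>f\<in>L2 M. AE y in N. y \<in> \<beta> - Y0 \<longrightarrow> T (proj_op (\<alpha> - X0) f) y = 0" and "f \<in> L2 M"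
    then have "AE y in N. y \<in> \<beta> - Y0 \<longrightarrow> T (proj_op (\<alpha> - X0) f) y = 0" by blast
    with AE_not_in[OF Y0] show "AE y in N. y \<in> \<beta> \<longrightarrow> T (proj_op (\<alpha> - X0) f) y = 0" by eventually_elim simp
  qed
  have "\<alpha> \<inter> X0 \<in> null_sets M" by (rule null_sets_subset[OF X0 a(2)]) auto
  then have 2: "vanishes_on M N T (\<alpha> \<inter> X0) \<beta>" by (rule vanishes_on_null[OF T])
  have "vanishes_on M N T (\<alpha> \<inter> X0 \<union> (\<alpha> - X0)) \<beta>"
    by (rule vanishes_on_union_left[OF T a(2,1) _ 2 1]) auto
  then show ?thesis by (simp add: Int_Diff_Un)
qed


section \<open>Existence of \<open>\<omega>\<close>-unions\<close>

lemma (in sigma_finite_measure) equivalent_finite_measure: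
  obtains M' where "finite_measure M'" "space M' = space M" "sets M' = sets M" "null_sets M' = null_sets M"
proof -
  obtain h :: "'a \<Rightarrow> real" where h: "h \<in> borel_measurable M" "\<And>x. 0 < h x" "integrable M h"
    by (rule obtain_positive_integrable_function) blast
  let ?M = "density M (\<lambda>x. ennreal (h x))"
  show thesis
  proof
    have "emeasure ?M (space M) = (\<integral>\<^sup>+x. ennreal (h x) \<partial>M)"
      using h(1) by (subst emeasure_density) (auto intro!: nn_integral_cong)
    also have "\<dots> < \<infinity>" using integrableD(2)[OF h(3)] h(2) by (simp add: less_top abs_of_pos)
    finally show "finite_measure ?M" by (intro finite_measureI) simp
    have pos: "ennreal (h x) \<noteq> 0" for x using h(2)[of x] by (simp add: ennreal_eq_0_iff not_le)
    have "N \<in> null_sets ?M \<longleftrightarrow> N \<in> null_sets M" for N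
    proof -
      have "N \<in> null_sets ?M \<longleftrightarrow> N \<in> sets M \<and> (AE x in M. x \<in> N \<longrightarrow> ennreal (h x) = 0)"
        using h(1) by (intro null_sets_density_iff) measurable
      also have "\<dots> \<longleftrightarrow> N \<in> sets M \<and> (AE x in M. x \<notin> N)" by (simp add: pos)
      also have "\<dots> \<longleftrightarrow> N \<in> null_sets M" using AE_iff_null_sets by blast
      finally show ?thesis .
    qed
    then show "null_sets ?M = null_sets M" by blast
  qed auto
qed

lemma (in finite_measure) AE_eventually_in_approximants:
  assumes \<gamma>: "\<gamma> \<in> sets M" and s: "\<And>n::nat. s n \<in> sets M" and d: "\<And>n. d n \<in> sets M"
    and sd: "\<And>n. measure M ((s n - d n) \<union> (d n - s n)) < (1/2)^n"
    and \<gamma>d: "\<And>n. measure M ((\<gamma> - d n) \<union> (d n - \<gamma>)) < (1/2)^n"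
  shows "AE x in M. eventually (\<lambda>n. x \<in> space M - (\<gamma> - s n)) sequentially"
proof (rule borel_cantelli_AE1)
  show "\<gamma> - s n \<in> sets M" for n using \<gamma> s by blast
  show "emeasure M (\<gamma> - s n) < \<infinity>" for n by (simp add: less_top[symmetric])
  have "measure M (\<gamma> - s n) \<le> 2 * (1/2)^n" for n
  proof -
    have "measure M (\<gamma> - s n) \<le> measure M (((\<gamma> - d n) \<union> (d n - \<gamma>)) \<union> ((s n - d n) \<union> (d n - s n)))"
      using \<gamma> s[of n] d[of n] by (intro finite_measure_mono) auto
    also have "\<dots> \<le> measure M ((\<gamma> - d n) \<union> (d n - \<gamma>)) + measure M ((s n - d n) \<union> (d n - s n))"
      using \<gamma> s[of n] d[of n] by (intro measure_Un_le) auto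
    also have "\<dots> \<le> 2 * (1/2)^n" using sd[of n] \<gamma>d[of n] by simp
    finally show ?thesis .
  qed
  then have le: "norm (measure M (\<gamma> - s n)) \<le> 2 * (1/2)^n" for n by simp
  have "summable (\<lambda>n. 2 * (1/2::real)^n)" by (intro summable_mult summable_geometric) simp
  from summable_comparison_test'[OF this le] show "summable (\<lambda>n. measure M (\<gamma> - s n))" .
qed

text \<open>The measure algebra is separable, so a countable subfamily approximates each of the rectangles;
  by Borel--Cantelli almost every point of a side of a rectangle lies in almost all of the sides of
  sufficiently close rectangles.\<close>

lemma omega_union_exists:
  assumes M: "standard_borel_measure M" "sigma_finite_measure M"
    and N: "standard_borel_measure N" "sigma_finite_measure N"
    and \<E>: "\<E> \<subseteq> rectangles M N"
  shows "\<exists>U. is_omega_union M N \<E> U"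
proof -
  obtain M' where M': "finite_measure M'" "space M' = space M" "sets M' = sets M" "null_sets M' = null_sets M"
    by (rule sigma_finite_measure.equivalent_finite_measure[OF M(2)])
  obtain N' where N': "finite_measure N'" "space N' = space N" "sets N' = sets N" "null_sets N' = null_sets N"
    by (rule sigma_finite_measure.equivalent_finite_measure[OF N(2)])
  interpret M': finite_measure M' by (rule M'(1))
  interpret N': finite_measure N' by (rule N'(1))
  obtain S where "polish_topology_for M S" using M unfolding standard_borel_measure_def polish_topology_for_def by blast
  then have S: "polish_topology_for M' S" using polish_topology_for_cong M' by blast
  obtain S' where "polish_topology_for N S'" using N unfolding standard_borel_measure_def polish_topology_for_def by blast
  then have S': "polish_topology_for N' S'" using polish_topology_for_cong N' by blast
  obtain \<A> where \<A>: "countable \<A>" "\<A> \<subseteq> sets M'"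
    "\<And>A e. A \<in> sets M' \<Longrightarrow> 0 < e \<Longrightarrow> \<exists>D\<in>\<A>. measure M' ((A - D) \<union> (D - A)) < e"
    by (rule M'.polish_countable_dense[OF S]) blast
  obtain \<B> where \<B>: "countable \<B>" "\<B> \<subseteq> sets N'"
    "\<And>A e. A \<in> sets N' \<Longrightarrow> 0 < e \<Longrightarrow> \<exists>D\<in>\<B>. measure N' ((A - D) \<union> (D - A)) < e"
    by (rule N'.polish_countable_dense[OF S']) blast
  define near where "near n D E \<alpha> \<beta> \<longleftrightarrow> \<alpha> \<in> sets M \<and> \<beta> \<in> sets N \<and> \<alpha> \<times> \<beta> \<in> \<E> \<and>
      measure M' ((\<alpha> - D) \<union> (D - \<alpha>)) < (1/2)^n \<and> measure N' ((\<beta> - E) \<union> (E - \<beta>)) < (1/2)^n" for n :: nat and D E \<alpha> \<beta>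
  define c where "c = (\<lambda>(n, D, E). SOME p. near n D E (fst p) (snd p))"
  define I where "I = {(n, D, E). D \<in> \<A> \<and> E \<in> \<B> \<and> (\<exists>\<alpha> \<beta>. near n D E \<alpha> \<beta>)}"
  have c: "near n D E (fst (c (n, D, E))) (snd (c (n, D, E)))" if I: "(n, D, E) \<in> I" for n D E
  proof -
    obtain \<alpha> \<beta> where "near n D E (fst (\<alpha>, \<beta>)) (snd (\<alpha>, \<beta>))" using I unfolding I_def by auto
    then show ?thesis unfolding c_def prod.case by (rule someI)
  qed
  define \<C> where "\<C> = (\<lambda>i. fst (c i) \<times> snd (c i)) ` I"
  have "I \<subseteq> UNIV \<times> \<A> \<times> \<B>" by (auto simp: I_def)
  then have "countable I" by (rule countable_subset) (intro countable_SIGMA \<A> \<B>, auto)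
  then have C1: "countable \<C>" unfolding \<C>_def by simp
  have C2: "\<C> \<subseteq> \<E>"
    unfolding \<C>_def using c by (force simp: near_def)
  have "marg_contains M N (\<Union>\<C>) E" if E0: "E \<in> \<E>" for E
  proof -
    obtain \<alpha> \<beta> where \<alpha>: "\<alpha> \<in> sets M" and \<beta>: "\<beta> \<in> sets N" and E: "E = \<alpha> \<times> \<beta>"
      using subsetD[OF \<E> E0] unfolding rectangles_def by blast
    have "\<exists>D\<in>\<A>. measure M' ((\<alpha> - D) \<union> (D - \<alpha>)) < (1/2)^n" for n :: nat using \<alpha> M' by (intro \<A>(3)) auto
    then obtain D where D: "\<And>n::nat. D n \<in> \<A>" "\<And>n. measure M' ((\<alpha> - D n) \<union> (D n - \<alpha>)) < (1/2)^n" by metis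
    have "\<exists>D\<in>\<B>. measure N' ((\<beta> - D) \<union> (D - \<beta>)) < (1/2)^n" for n :: nat using \<beta> N' by (intro \<B>(3)) auto
    then obtain F where F: "\<And>n::nat. F n \<in> \<B>" "\<And>n. measure N' ((\<beta> - F n) \<union> (F n - \<beta>)) < (1/2)^n" by metis
    have iI: "(n, D n, F n) \<in> I" for n
    proof -
      have "near n (D n) (F n) \<alpha> \<beta>"
        unfolding near_def using D(2) F(2) \<alpha> \<beta> E0 E by blast
      then show ?thesis unfolding I_def using D(1) F(1) by blast
    qed
    define a where "a n = fst (c (n, D n, F n))" for n
    define b where "b n = snd (c (n, D n, F n))" for n
    have near: "near n (D n) (F n) (a n) (b n)" for n using c[OF iI] by (simp add: a_def b_def)
    have ab: "a n \<times> b n \<in> \<C>" for n unfolding \<C>_def a_def b_def using iI by blast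
    have "AE x in M'. eventually (\<lambda>n. x \<in> space M' - (\<alpha> - a n)) sequentially"
      by (rule M'.AE_eventually_in_approximants[where d = D]) (use near \<alpha> D \<A>(2) M' in \<open>auto simp: near_def\<close>)
    then obtain X0 where X0: "X0 \<in> null_sets M'" "{x \<in> space M'. \<not> eventually (\<lambda>n. x \<in> space M' - (\<alpha> - a n)) sequentially} \<subseteq> X0"
      unfolding eventually_ae_filter by blast
    have "AE x in N'. eventually (\<lambda>n. x \<in> space N' - (\<beta> - b n)) sequentially"
      by (rule N'.AE_eventually_in_approximants[where d = F]) (use near \<beta> F \<B>(2) N' in \<open>auto simp: near_def\<close>)
    then obtain Y0 where Y0: "Y0 \<in> null_sets N'" "{x \<in> space N'. \<not> eventually (\<lambda>n. x \<in> space N' - (\<beta> - b n)) sequentially} \<subseteq> Y0"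
      unfolding eventually_ae_filter by blast
    have "\<alpha> \<times> \<beta> - \<Union>\<C> \<subseteq> X0 \<times> space N \<union> space M \<times> Y0"
    proof
      fix z assume z: "z \<in> \<alpha> \<times> \<beta> - \<Union>\<C>"
      then obtain x y where xy: "z = (x, y)" "x \<in> \<alpha>" "y \<in> \<beta>" by blast
      then have sp: "x \<in> space M" "y \<in> space N" using sets.sets_into_space \<alpha> \<beta> by blast+
      show "z \<in> X0 \<times> space N \<union> space M \<times> Y0"
      proof (rule ccontr)
        assume "z \<notin> X0 \<times> space N \<union> space M \<times> Y0"
        then have "eventually (\<lambda>n. x \<in> space M' - (\<alpha> - a n)) sequentially" "eventually (\<lambda>n. y \<in> space N' - (\<beta> - b n)) sequentially"
          using X0(2) Y0(2) xy sp M'(2) N'(2) by auto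
        then have "eventually (\<lambda>n. x \<in> a n \<and> y \<in> b n) sequentially"
          by eventually_elim (use xy in auto)
        then obtain n where "x \<in> a n" "y \<in> b n" using eventually_happens by force
        then show False using z xy ab by blast
      qed
    qed
    then show ?thesis using X0(1) Y0(1) M'(4) N'(4) unfolding marg_contains_def marg_null_def E by blast
  qed
  then show ?thesis unfolding is_omega_union_def using C1 C2 by blast
qed

section \<open>The support of the multivalued part\<close>

lemma marg_null_subset: "marg_null M N E \<Longrightarrow> F \<subseteq> E \<Longrightarrow> marg_null M N F"
  unfolding marg_null_def by (meson order_trans)

lemma marg_null_empty: "marg_null M N {}"
  unfolding marg_null_def by (rule bexI[of _ "{}"], rule bexI[of _ "{}"]) auto

lemma marg_null_Union:
  assumes cnt: "countable \<D>" and nul: "\<And>D. D \<in> \<D> \<Longrightarrow> marg_null M N D"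
  shows "marg_null M N (\<Union>\<D>)"
proof -
  obtain A B where AB: "\<And>D. D \<in> \<D> \<Longrightarrow> A D \<in> null_sets M \<and> B D \<in> null_sets N \<and>
      D \<subseteq> A D \<times> space N \<union> space M \<times> B D"
    using nul unfolding marg_null_def by metis
  have "(\<Union>D\<in>\<D>. A D) \<in> null_sets M" "(\<Union>D\<in>\<D>. B D) \<in> null_sets N"
    using AB cnt by (auto intro!: null_sets_UN')
  moreover have "\<Union>\<D> \<subseteq> (\<Union>D\<in>\<D>. A D) \<times> space N \<union> space M \<times> (\<Union>D\<in>\<D>. B D)"
  proof
    fix z assume "z \<in> \<Union>\<D>"
    then obtain D where D: "D \<in> \<D>" "z \<in> D" by auto
    then have "z \<in> A D \<times> space N \<union> space M \<times> B D" using AB by blast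
    then show "z \<in> (\<Union>D\<in>\<D>. A D) \<times> space N \<union> space M \<times> (\<Union>D\<in>\<D>. B D)" using D(1) by auto
  qed
  ultimately show ?thesis unfolding marg_null_def by blast
qed

text \<open>By localisation, the rectangles on which \<open>\<phi>\<close> is a w*-closable multiplier are exactly the
  rectangles on which every operator of the multivalued part vanishes.\<close>

lemma kappa_wstar_support:
  assumes M: "standard_borel_measure M" "sigma_finite_measure M"
    and N: "standard_borel_measure N" "sigma_finite_measure N"
  shows "is_support M N (wstar_multivalued_part M N \<phi>) (kappa_wstar M N \<phi>)"
proof -
  interpret M: sigma_finite_measure M by (rule M(2))
  interpret N: sigma_finite_measure N by (rule N(2))
  interpret pair_sigma_finite M N ..
  let ?S = "space M \<times> space N" and ?W = "wstar_multivalued_part M N \<phi>" and ?\<kappa> = "kappa_wstar M N \<phi>"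
  define \<E> where "\<E> = {\<alpha> \<times> \<beta> | \<alpha> \<beta>. \<alpha> \<in> sets M \<and> \<beta> \<in> sets N \<and>
       wstar_closable_multiplier (restrict_space M \<alpha>) (restrict_space N \<beta>) \<phi>}"
  define U where "U = omega_union M N \<E>"
  have \<E>: "\<E> \<subseteq> rectangles M N" unfolding \<E>_def rectangles_def by blast
  have "is_omega_union M N \<E> U"
    unfolding U_def omega_union_def by (rule someI_ex[OF omega_union_exists[OF M N \<E>]])
  then obtain \<C> where \<C>: "countable \<C>" "\<C> \<subseteq> \<E>" "U = \<Union>\<C>"
    and U: "\<And>E. E \<in> \<E> \<Longrightarrow> marg_null M N (E - U)"
    unfolding is_omega_union_def marg_contains_def by (elim conjE exE) blast
  have \<kappa>: "?\<kappa> = ?S - U" unfolding kappa_wstar_def U_def \<E>_def ..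
  have rect: "E \<subseteq> ?S" if E: "E \<in> rectangles M N" for E
  proof -
    obtain \<alpha> \<beta> where "\<alpha> \<in> sets M" "\<beta> \<in> sets N" "E = \<alpha> \<times> \<beta>" using E unfolding rectangles_def by blast
    then show ?thesis by (simp add: Sigma_mono sets.sets_into_space)
  qed
  have US: "U \<subseteq> ?S" unfolding \<C>(3) using rect[OF subsetD[OF subset_trans[OF \<C>(2) \<E>]]] by (rule Union_least)
  have Wb: "T \<in> bounded_ops M N" if "T \<in> ?W" for T
    using that wstar_multivalued_part_bimodule[of \<phi>] unfolding bimodule_def by blast
  have van: "vanishes_on M N T \<alpha> \<beta>" if T: "T \<in> ?W" and E: "\<alpha> \<times> \<beta> \<in> \<E>" for T \<alpha> \<beta>
  \<comment> \<open>only a nonempty rectangle determines its sides\<close>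
  proof (cases "\<alpha> = {} \<or> \<beta> = {}")
    case True
    then show ?thesis using vanishes_on_empty[OF Wb[OF T]] by blast
  next
    case False
    then have "\<alpha> \<in> sets M" "\<beta> \<in> sets N" "wstar_closable_multiplier (restrict_space M \<alpha>) (restrict_space N \<beta>) \<phi>"
      using E unfolding \<E>_def by (auto simp: times_eq_iff)
    then show ?thesis using T wstar_closable_on_rectangle_iff vanishes_on_iff by blast
  qed
  have "omega_open M N U"
    unfolding omega_open_def marg_equiv_def
    using US \<C> \<E> by (intro conjI exI[of _ \<C>]) (auto simp: marg_null_empty)
  moreover have "?S - ?\<kappa> = U" unfolding \<kappa> by (rule double_diff[OF US subset_refl])
  ultimately have closed: "omega_closed M N ?\<kappa>" unfolding omega_closed_def \<kappa> by auto
  have supp: "supports_op M N ?\<kappa> T" if T: "T \<in> ?W" for T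
    unfolding supports_op_def
  proof (intro ballI impI)
    fix \<alpha> \<beta> assume \<alpha>: "\<alpha> \<in> sets M" and \<beta>: "\<beta> \<in> sets N" and "marg_disjoint M N (\<alpha> \<times> \<beta>) ?\<kappa>"
    moreover have "\<alpha> \<times> \<beta> - \<Union>\<C> \<subseteq> \<alpha> \<times> \<beta> \<inter> ?\<kappa>"
      using Sigma_mono[OF sets.sets_into_space[OF \<alpha>] sets.sets_into_space[OF \<beta>]] unfolding \<kappa> \<C>(3) by auto
    ultimately have "marg_contains M N (\<Union>\<C>) (\<alpha> \<times> \<beta>)"
      unfolding marg_disjoint_def marg_contains_def using marg_null_subset by blast
    then have "vanishes_on M N T \<alpha> \<beta>"
      using van[OF T] \<C>(2) \<E> by (intro vanishes_on_marginal_cover[OF M(1) N(1) Wb[OF T] \<C>(1) _ _ \<alpha> \<beta>]) auto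
    then show "op_eq M N (proj_op \<beta> \<circ> T \<circ> proj_op \<alpha>) zero_op" by (simp only: vanishes_on_iff)
  qed
  have least: "marg_contains M N \<kappa>' ?\<kappa>" if \<kappa>': "omega_closed M N \<kappa>'" and s: "\<And>T. T \<in> ?W \<Longrightarrow> supports_op M N \<kappa>' T" for \<kappa>'
  proof -
    obtain \<D> where \<D>: "countable \<D>" "\<D> \<subseteq> rectangles M N"
      and eq: "marg_null M N ((?S - \<kappa>' - \<Union>\<D>) \<union> (\<Union>\<D> - (?S - \<kappa>')))"
      using \<kappa>' unfolding omega_closed_def omega_open_def marg_equiv_def by blast
    have "marg_null M N (D - U)" if D: "D \<in> \<D>" for D
    proof (rule U)
      obtain \<alpha> \<beta> where \<alpha>: "\<alpha> \<in> sets M" and \<beta>: "\<beta> \<in> sets N" and D': "D = \<alpha> \<times> \<beta>"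
        using subsetD[OF \<D>(2) D] unfolding rectangles_def by blast
      have "\<alpha> \<times> \<beta> \<inter> \<kappa>' \<subseteq> (?S - \<kappa>' - \<Union>\<D>) \<union> (\<Union>\<D> - (?S - \<kappa>'))" using D D' by auto
      then have "marg_disjoint M N (\<alpha> \<times> \<beta>) \<kappa>'" unfolding marg_disjoint_def by (rule marg_null_subset[OF eq])
      then have "\<forall>T\<in>?W. op_eq M N (proj_op \<beta> \<circ> T \<circ> proj_op \<alpha>) zero_op"
        using s \<alpha> \<beta> unfolding supports_op_def by blast
      then show "D \<in> \<E>" unfolding \<E>_def D' using \<alpha> \<beta> wstar_closable_on_rectangle_iff[OF \<alpha> \<beta>] by blast
    qed
    then have "marg_null M N (\<Union>(insert ((?S - \<kappa>' - \<Union>\<D>) \<union> (\<Union>\<D> - (?S - \<kappa>'))) ((\<lambda>D. D - U) ` \<D>)))"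
      using \<D>(1) eq by (intro marg_null_Union) auto
    then show ?thesis unfolding marg_contains_def \<kappa> by (rule marg_null_subset) auto
  qed
  show ?thesis unfolding is_support_def using closed supp least by blast
qed

lemma compact_ops_op_diff:
  assumes S: "S \<in> compact_ops M N" and T: "T \<in> compact_ops M N"
  shows "(\<lambda>f y. S f y - T f y) \<in> compact_ops M N"
proof -
  note Sb = compact_ops_bounded[OF S] and Tb = compact_ops_bounded[OF T]
  have "\<exists>r g. strict_mono r \<and> g \<in> L2 N \<and> (\<lambda>n. L2_norm N (\<lambda>y. S (u (r n)) y - T (u (r n)) y - g y)) \<longlonglongrightarrow> 0"
    if u: "\<And>n::nat. u n \<in> L2 M" "\<And>n. L2_norm M (u n) \<le> 1" for u
  proof -
    obtain r1 :: "nat \<Rightarrow> nat" and g1 where r1: "strict_mono r1" "g1 \<in> L2 N" "(\<lambda>n. L2_norm N (\<lambda>y. S (u (r1 n)) y - g1 y)) \<longlonglongrightarrow> 0"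
      by (rule compact_opsD[OF S u])
    obtain r2 :: "nat \<Rightarrow> nat" and g2 where r2: "strict_mono r2" "g2 \<in> L2 N" "(\<lambda>n. L2_norm N (\<lambda>y. T (u (r1 (r2 n))) y - g2 y)) \<longlonglongrightarrow> 0"
      by (rule compact_opsD[OF T, of "\<lambda>n. u (r1 n)"]) (auto intro: u)
    have l1: "(\<lambda>n. L2_norm N (\<lambda>y. S (u (r1 (r2 n))) y - g1 y)) \<longlonglongrightarrow> 0"
      using LIMSEQ_subseq_LIMSEQ[OF r1(3) r2(1)] by (simp add: comp_def)
    have "(\<lambda>n. L2_norm N (\<lambda>y. S (u (r1 (r2 n))) y - T (u (r1 (r2 n))) y - (g1 y - g2 y))) \<longlonglongrightarrow> 0"
    proof (rule Lim_null_comparison)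
      show "(\<lambda>n. L2_norm N (\<lambda>y. S (u (r1 (r2 n))) y - g1 y) + L2_norm N (\<lambda>y. T (u (r1 (r2 n))) y - g2 y)) \<longlonglongrightarrow> 0"
        using tendsto_add[OF l1 r2(3)] by simp
      have "L2_norm N (\<lambda>y. S v y - T v y - (g1 y - g2 y)) \<le> L2_norm N (\<lambda>y. S v y - g1 y) + L2_norm N (\<lambda>y. T v y - g2 y)"
        if v: "v \<in> L2 M" for v
      proof -
        have "(\<lambda>y. S v y - T v y - (g1 y - g2 y)) = (\<lambda>y. (S v y - g1 y) - (T v y - g2 y))" by auto
        then show ?thesis
          using L2_norm_triangle_diff[OF L2_diff[OF bounded_ops_L2[OF Sb v] r1(2)] L2_diff[OF bounded_ops_L2[OF Tb v] r2(2)]] by simp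
      qed
      then show "\<forall>\<^sub>F n in sequentially. norm (L2_norm N (\<lambda>y. S (u (r1 (r2 n))) y - T (u (r1 (r2 n))) y - (g1 y - g2 y)))
          \<le> L2_norm N (\<lambda>y. S (u (r1 (r2 n))) y - g1 y) + L2_norm N (\<lambda>y. T (u (r1 (r2 n))) y - g2 y)"
        using u(1) by simp
    qed
    then show ?thesis
      using strict_mono_o[OF r1(1) r2(1)] L2_diff[OF r1(2) r2(2)]
      by (intro exI[of _ "r1 \<circ> r2"] exI[of _ "\<lambda>y. g1 y - g2 y"]) (simp add: comp_def)
  qed
  then show ?thesis unfolding compact_ops_def using bounded_ops_op_diff[OF Sb Tb] by simp
qed

theorem theorem5p4:
  fixes M :: "'a measure" and N :: "'b measure" and \<phi> :: "'a \<times> 'b \<Rightarrow> complex"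
  assumes "standard_borel_measure M" and "sigma_finite_measure M"
    and "standard_borel_measure N" and "sigma_finite_measure N"
    and "\<phi> \<in> borel_measurable (M \<Otimes>\<^sub>M N)"
  shows "(\<not> operator_M_set M N (kappa_wstar M N \<phi>) \<longrightarrow> closable_multiplier M N \<phi>) \<and>
         (operator_M1_set M N (kappa_wstar M N \<phi>) \<longrightarrow> \<not> closable_multiplier M N \<phi>)"
proof -
  interpret M: sigma_finite_measure M by (rule assms(2))
  interpret N: sigma_finite_measure N by (rule assms(4))
  interpret pair_sigma_finite M N ..
  let ?W = "wstar_multivalued_part M N \<phi>" and ?\<kappa> = "kappa_wstar M N \<phi>"
  let ?G = "norm_closure M N (mult_graph M N \<phi>)"
  have supp: "is_support M N ?W ?\<kappa>" by (rule kappa_wstar_support[OF assms(1-4)])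
  have W: "?W \<in> wstar_closed_bimodules_on M N ?\<kappa>"
    unfolding wstar_closed_bimodules_on_def
    using wstar_multivalued_part_bimodule wstar_multivalued_part_closed supp by blast
  have M_set: "operator_M_set M N ?\<kappa>" if not_closable: "\<not> closable_multiplier M N \<phi>"
  proof -
    obtain A B A' B' where AB: "(A, B) \<in> ?G" and AB': "(A', B') \<in> ?G" and eq: "op_eq M N A A'" and neq: "\<not> op_eq M N B B'"
      using not_closable unfolding closable_multiplier_def is_op_graph_def by blast
    let ?C = "\<lambda>f y. B f y - B' f y"
    have "?C \<in> compact_ops M N"
      using AB AB' by (intro compact_ops_op_diff) (auto simp: norm_closure_def)
    moreover have "?C \<in> ?W"
      using wstar_graph_diff[OF subsetD[OF norm_closure_subset_wstar_graph AB] subsetD[OF norm_closure_subset_wstar_graph AB'] eq]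
      by (simp add: wstar_multivalued_part_def)
    moreover have "\<not> op_eq M N ?C zero_op"
      using neq by (simp add: op_eq_def zero_op_def)
    ultimately show ?thesis
      using supp unfolding operator_M_set_def is_support_def by blast
  qed
  have not_closable: "\<not> closable_multiplier M N \<phi>" if M1: "operator_M1_set M N ?\<kappa>"
  proof
    assume closable: "closable_multiplier M N \<phi>"
    obtain T where T: "T \<in> compact_ops M N" "\<not> op_eq M N T zero_op" "T \<in> M_min M N ?\<kappa>"
      using M1 unfolding operator_M1_set_def by blast
    have "T \<in> ?W" using T(3) W unfolding M_min_def by blast
    then have "(zero_op, T) \<in> ?G" by (rule compact_wstar_multivalued_part[OF T(1)])
    moreover have "zero_op \<in> ?W" using wstar_multivalued_part_bimodule[of \<phi>] by (simp add: bimodule_def)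
    then have "(zero_op, zero_op) \<in> ?G" by (rule compact_wstar_multivalued_part[OF zero_op_compact])
    moreover have "op_eq M N zero_op zero_op" by (simp add: op_eq_def)
    ultimately have "op_eq M N T zero_op"
      using closable unfolding closable_multiplier_def is_op_graph_def by blast
    then show False using T(2) by blast
  qed
  show ?thesis using M_set not_closable by blast
qed

end
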